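(* Let $\mathbf w=(\omega_k)_{k\ge 0}$ be a weight sequence (of any type I, II or III), let $\mathcal{T}_n$ be the associated simply generated tree with $n$ vertices, let $v_n$ be a uniformly chosen vertex of $\mathcal{T}_n$, and let $\mathcal{T}$ be the Bienaymé–Galton–Watson tree with the offspring distribution $\xi$ associated with $\mathbf w$. As $n\to\infty$ along those $n$ for which $\mathcal{T}_n$ is defined, \[ \partial_{\mathrm p}(\mathcal{T}_n,v_n)\xrightarrow{d}\partial(\mathcal{T}),\qquad \mathbf{E}\bigl[\partial_{\mathrm p}(\mathcal{T}_n,v_n)^p\bigr]\to\mathbf{E}\bigl[\partial(\mathcal{T})^p\bigr]\quad\text{for every } p\ge 1. \]
   Context: **Simply generated trees.** A weight sequence is a sequence $\mathbf w=(\omega_k)_{k\ge0}$ of non-negative reals with $\omega_0>0$ and $\omega_k>0$ for at least one $k\ge2$. For $n\ge 1$, $\mathcal{T}_n$ is the random rooted plane tree with $n$ vertices such that $\mathbf P(\mathcal{T}_n=T)$ is proportional to $\prod_{v\in T}\omega_{d_T^+(v)}$ for each $n$-vertex rooted plane tree $T$, where $d_T^+(v)$ is the outdegree (number of children) of $v$. Only those $n$ are considered for which some $n$-vertex tree has positive weight ("$\mathcal{T}_n$ is defined"). The vertex $v_n$ is uniform among the vertices of $\mathcal{T}_n$, conditionally on $\mathcal{T}_n$. **Types and offspring law $\xi$.** Let $\Phi(z)=\sum_{k\ge0}\omega_kz^k$ with radius of convergence $R\in[0,\infty]$. Type I: there is a (finite) $\tau\in(0,R]$ with $\Phi(\tau)<\infty$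 and $\tau\Phi'(\tau)/\Phi(\tau)=1$; then $\mathbf P(\xi=k)=\omega_k\tau^k/\Phi(\tau)$. Type II: $R>0$, $\Phi(R)<\infty$ and $R\Phi'(R)/\Phi(R)<1$; then $\mathbf P(\xi=k)=\omega_kR^k/\Phi(R)$. Type III: $R=0$; then $\xi=0$ almost surely, so that $\mathcal{T}$ is a single vertex. **Distance to the border and protection number.** A leaf is a vertex with no children. For a rooted tree $T$, $\partial(T)$ is the minimal graph distance from the root to a leaf of $T$ ($\infty$ if there is no leaf). For a vertex $v$ of $T$, the fringe subtree of $T$ at $v$ is the subtree consisting of $v$ and all its descendants, rooted at $v$; the protection number $\partial_{\mathrm p}(T,v)$ is the distance to the border $\partial$ of this fringe subtree. *)

theory Defs
  imports "HOL-Probability.Probability"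
begin

section \<open>Rooted plane trees\<close>

text \<open>
  A rooted plane tree is a set of vertices in Ulam--Harris notation: the root is the empty word and
  the children of \<open>v\<close>, from left to right, are \<open>v @ [0]\<close>, \<open>v @ [1]\<close>, and so on. Each rooted plane
  tree is represented by exactly one such set. The distance from the root to \<open>v\<close> is \<open>length v\<close>.
\<close>

type_synonym vertex = "nat list"

definition plane_tree :: "vertex set \<Rightarrow> bool" where
  "plane_tree T \<longleftrightarrow> [] \<in> T \<and>
     (\<forall>v i. v @ [i] \<in> T \<longrightarrow> v \<in> T) \<and>
     (\<forall>v i j. v @ [i] \<in> T \<longrightarrow> j < i \<longrightarrow> v @ [j] \<in> T)"

definition plane_trees :: "nat \<Rightarrow> vertex set set" where
  "plane_trees n = {T. plane_tree T \<and> finite T \<and> card T = n}"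

definition outdegree :: "vertex set \<Rightarrow> vertex \<Rightarrow> nat" where
  "outdegree T v = card {i. v @ [i] \<in> T}"

definition leaves :: "vertex set \<Rightarrow> vertex set" where
  "leaves T = {v \<in> T. \<forall>i. v @ [i] \<notin> T}"

text \<open>In \<^typ>\<open>enat\<close> the infimum of the empty set is \<open>\<infinity>\<close>.\<close>

definition border_dist :: "vertex set \<Rightarrow> enat" where
  "border_dist T = (INF v\<in>leaves T. enat (length v))"

definition fringe_subtree :: "vertex set \<Rightarrow> vertex \<Rightarrow> vertex set" where
  "fringe_subtree T v = {u. v @ u \<in> T}"

definition protection_number :: "vertex set \<Rightarrow> vertex \<Rightarrow> enat" where
  "protection_number T v = border_dist (fringe_subtree T v)"


section \<open>Simply generated trees\<close>

definition weight_sequence :: "(nat \<Rightarrow> real) \<Rightarrow> bool" where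
  "weight_sequence w \<longleftrightarrow> (\<forall>k. 0 \<le> w k) \<and> 0 < w 0 \<and> (\<exists>k\<ge>2. 0 < w k)"

definition tree_weight :: "(nat \<Rightarrow> real) \<Rightarrow> vertex set \<Rightarrow> real" where
  "tree_weight w T = (\<Prod>v\<in>T. w (outdegree T v))"

definition simply_generated_defined :: "(nat \<Rightarrow> real) \<Rightarrow> nat \<Rightarrow> bool" where
  "simply_generated_defined w n \<longleftrightarrow> (\<exists>T\<in>plane_trees n. 0 < tree_weight w T)"

definition simply_generated_tree :: "(nat \<Rightarrow> real) \<Rightarrow> nat \<Rightarrow> vertex set pmf" where
  "simply_generated_tree w n = embed_pmf (\<lambda>T.
     if T \<in> plane_trees n then tree_weight w T / (\<Sum>S\<in>plane_trees n. tree_weight w S) else 0)"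

lemma plane_tree_take:
  assumes "plane_tree T" "v \<in> T"
  shows "take k v \<in> T"
  using assms(2)
proof (induction v rule: rev_induct)
  case Nil
  then show ?case by simp
next
  case (snoc i v)
  then have "v \<in> T" using assms(1) unfolding plane_tree_def by blast
  then show ?case using snoc by (cases "k \<le> length v") auto
qed

lemma plane_tree_finite_bound:
  assumes T: "plane_tree T" "finite T" and v: "v \<in> T"
  shows "length v < card T" "set v \<subseteq> {..<card T}"
proof -
  have inj: "inj_on (\<lambda>k. take k v) {..length v}"
    by (rule inj_onI) (metis atMost_iff length_take min.absorb2)
  have "card ((\<lambda>k. take k v) ` {..length v}) \<le> card T"
    using plane_tree_take[OF T(1) v] by (intro card_mono T image_subsetI)
  then show "length v < card T" using inj by (simp add: card_image)
  show "set v \<subseteq> {..<card T}"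
  proof
    fix i assume "i \<in> set v"
    then obtain xs ys where "v = (xs @ [i]) @ ys" by (auto dest: split_list)
    then have i: "xs @ [i] \<in> T"
      using plane_tree_take[OF T(1) v, of "Suc (length xs)"] by simp
    have "(\<lambda>j. xs @ [j]) ` {..i} \<subseteq> T"
    proof (rule image_subsetI)
      fix j assume "j \<in> {..i}"
      then consider "j = i" | "j < i" by fastforce
      then show "xs @ [j] \<in> T"
        using i T(1) unfolding plane_tree_def by cases blast+
    qed
    then have "card ((\<lambda>j. xs @ [j]) ` {..i}) \<le> card T" by (intro card_mono T)
    moreover have "inj_on (\<lambda>j. xs @ [j]) {..i}" by (auto intro: inj_onI)
    ultimately show "i \<in> {..<card T}" by (simp add: card_image)
  qed
qed

lemma finite_plane_trees: "finite (plane_trees n)"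
proof (rule finite_subset)
  show "plane_trees n \<subseteq> Pow {v. set v \<subseteq> {..<n} \<and> length v \<le> n}"
  proof
    fix T assume "T \<in> plane_trees n"
    then have T: "plane_tree T" "finite T" "card T = n" by (simp_all add: plane_trees_def)
    have "set v \<subseteq> {..<n} \<and> length v \<le> n" if "v \<in> T" for v
      using plane_tree_finite_bound[OF T(1,2) that] T(3) by simp
    then show "T \<in> Pow {v. set v \<subseteq> {..<n} \<and> length v \<le> n}" by blast
  qed
  show "finite (Pow {v. set v \<subseteq> {..<n} \<and> length v \<le> n})"
    by (simp add: finite_lists_length_le)
qed

lemma pmf_simply_generated_tree:
  assumes w: "weight_sequence w" and n: "simply_generated_defined w n"
  shows "pmf (simply_generated_tree w n) T =
    (if T \<in> plane_trees n then tree_weight w T / (\<Sum>S\<in>plane_trees n. tree_weight w S) else 0)"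
proof -
  let ?Z = "\<Sum>S\<in>plane_trees n. tree_weight w S"
  let ?f = "\<lambda>T. if T \<in> plane_trees n then tree_weight w T / ?Z else 0"
  have nn: "0 \<le> tree_weight w S" for S
    using w unfolding weight_sequence_def tree_weight_def by (intro prod_nonneg) auto
  have Z: "0 < ?Z"
    using n nn finite_plane_trees unfolding simply_generated_defined_def
    by (auto intro: sum_pos2)
  have "(\<integral>\<^sup>+ T. ennreal (?f T) \<partial>count_space UNIV) = (\<Sum>T\<in>plane_trees n. ennreal (?f T))"
    by (intro nn_integral_count_space'[OF finite_plane_trees]) auto
  also have "\<dots> = ennreal (\<Sum>T\<in>plane_trees n. tree_weight w T / ?Z)"
    using nn Z by (subst sum_ennreal[symmetric]) auto
  also have "\<dots> = 1"
    using Z by (simp add: sum_divide_distrib[symmetric])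
  finally show ?thesis
    unfolding simply_generated_tree_def using nn Z
    by (subst pmf_embed_pmf) auto
qed

definition protection_law :: "(nat \<Rightarrow> real) \<Rightarrow> nat \<Rightarrow> enat pmf" where
  "protection_law w n =
     bind_pmf (simply_generated_tree w n) (\<lambda>T. map_pmf (protection_number T) (pmf_of_set T))"

definition admissible_sizes :: "(nat \<Rightarrow> real) \<Rightarrow> nat filter" where
  "admissible_sizes w = inf sequentially (principal {n. simply_generated_defined w n})"


section \<open>The associated offspring distribution\<close>

text \<open>
  Values in \<^typ>\<open>ennreal\<close> make sense at the radius of convergence as well, where
  \<open>gen_deriv w\<close> is the left derivative of \<open>gen_fun w\<close>, possibly infinite.
\<close>

definition gen_fun :: "(nat \<Rightarrow> real) \<Rightarrow> real \<Rightarrow> ennreal" where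
  "gen_fun w t = (\<Sum>k. ennreal (w k * t ^ k))"

definition gen_deriv :: "(nat \<Rightarrow> real) \<Rightarrow> real \<Rightarrow> ennreal" where
  "gen_deriv w t = (\<Sum>k. ennreal (real k * w k * t ^ (k - 1)))"

definition tilted_by :: "(nat \<Rightarrow> real) \<Rightarrow> real \<Rightarrow> nat pmf \<Rightarrow> bool" where
  "tilted_by w t \<xi> \<longleftrightarrow> (\<forall>k. ennreal (pmf \<xi> k) = ennreal (w k * t ^ k) / gen_fun w t)"

definition type_I :: "(nat \<Rightarrow> real) \<Rightarrow> real \<Rightarrow> bool" where
  "type_I w \<tau> \<longleftrightarrow> 0 < \<tau> \<and> ereal \<tau> \<le> conv_radius w \<and> gen_fun w \<tau> < \<infinity> \<and>
     ennreal \<tau> * gen_deriv w \<tau> / gen_fun w \<tau> = 1"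

text \<open>
  For a weight sequence, the sum of \<open>w k * t ^ k\<close> at \<open>t = \<infinity>\<close> is infinite, so that in type II
  the radius of convergence is a real number.
\<close>

definition type_II :: "(nat \<Rightarrow> real) \<Rightarrow> real \<Rightarrow> bool" where
  "type_II w \<rho> \<longleftrightarrow> 0 < \<rho> \<and> conv_radius w = ereal \<rho> \<and> gen_fun w \<rho> < \<infinity> \<and>
     ennreal \<rho> * gen_deriv w \<rho> / gen_fun w \<rho> < 1"

definition type_III :: "(nat \<Rightarrow> real) \<Rightarrow> bool" where
  "type_III w \<longleftrightarrow> conv_radius w = 0"

text \<open>Every weight sequence has exactly one of the three types, and \<open>\<tau>\<close> is unique in type I.\<close>

definition offspring_distribution :: "(nat \<Rightarrow> real) \<Rightarrow> nat pmf \<Rightarrow> bool" where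
  "offspring_distribution w \<xi> \<longleftrightarrow>
     (\<exists>\<tau>. type_I w \<tau> \<and> tilted_by w \<tau> \<xi>) \<or>
     (\<exists>\<rho>. type_II w \<rho> \<and> tilted_by w \<rho> \<xi>) \<or>
     (type_III w \<and> \<xi> = return_pmf 0)"


section \<open>The Galton--Watson tree\<close>

text \<open>
  Every word \<open>v\<close> carries an independent copy \<open>N v\<close> of \<open>\<xi>\<close>; if \<open>v\<close> is a vertex of the tree, it has
  \<open>N v\<close> children. The tree may be infinite.
\<close>

definition bgw_space :: "nat pmf \<Rightarrow> (vertex \<Rightarrow> nat) measure" where
  "bgw_space \<xi> = (\<Pi>\<^sub>M v\<in>UNIV. measure_pmf \<xi>)"

definition bgw_tree :: "(vertex \<Rightarrow> nat) \<Rightarrow> vertex set" where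
  "bgw_tree N = {u. \<forall>k<length u. u ! k < N (take k u)}"

definition bgw_border_law :: "nat pmf \<Rightarrow> enat measure" where
  "bgw_border_law \<xi> = distr (bgw_space \<xi>) borel (\<lambda>N. border_dist (bgw_tree N))"

lemma border_dist_le_iff:
  "border_dist T \<le> enat m \<longleftrightarrow> (\<exists>v\<in>leaves T. length v \<le> m)"
proof
  assume le: "border_dist T \<le> enat m"
  let ?A = "(\<lambda>v. enat (length v)) ` leaves T"
  have "?A \<noteq> {}"
    using le unfolding border_dist_def by (auto simp: top_enat_def)
  then have "Inf ?A \<in> ?A" by (auto simp: Inf_enat_def intro: LeastI)
  then show "\<exists>v\<in>leaves T. length v \<le> m" using le unfolding border_dist_def by auto
next
  assume "\<exists>v\<in>leaves T. length v \<le> m"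
  then show "border_dist T \<le> enat m"
    unfolding border_dist_def by (auto intro: INF_lower2)
qed

lemma measurable_border_dist_bgw_tree:
  "(\<lambda>N. border_dist (bgw_tree N)) \<in> measurable (bgw_space \<xi>) borel"
proof (rule borel_measurableI_le)
  fix y :: enat
  have N[measurable]: "(\<lambda>N. N v) \<in> measurable (bgw_space \<xi>) (count_space UNIV)" for v
    using measurable_component_singleton[of v UNIV "\<lambda>_. measure_pmf \<xi>"]
    unfolding bgw_space_def by simp
  have [measurable]: "Measurable.pred (bgw_space \<xi>) (\<lambda>N. v \<in> bgw_tree N)" for v
    unfolding bgw_tree_def by simp
  show "{N \<in> space (bgw_space \<xi>). border_dist (bgw_tree N) \<le> y} \<in> sets (bgw_space \<xi>)"
    by (cases y) (simp_all add: border_dist_le_iff leaves_def Bex_def)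
qed


section \<open>Convergence in distribution and moments\<close>

text \<open>
  The topology on \<^typ>\<open>enat\<close> is the order topology, that is, the one-point compactification of the
  natural numbers.
\<close>

definition converges_in_distribution ::
    "('i \<Rightarrow> 'a::topological_space measure) \<Rightarrow> 'a measure \<Rightarrow> 'i filter \<Rightarrow> bool" where
  "converges_in_distribution M L F \<longleftrightarrow>
     (\<forall>f :: 'a \<Rightarrow> real. continuous_on UNIV f \<longrightarrow> bounded (range f) \<longrightarrow>
        ((\<lambda>i. \<integral>x. f x \<partial>M i) \<longlongrightarrow> (\<integral>x. f x \<partial>L)) F)"

definition enat_powr :: "enat \<Rightarrow> real \<Rightarrow> ennreal" where
  "enat_powr x p = (case x of enat m \<Rightarrow> ennreal (real m powr p) | \<infinity> \<Rightarrow> \<infinity>)"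

definition moment :: "enat measure \<Rightarrow> real \<Rightarrow> ennreal" where
  "moment M p = (\<integral>\<^sup>+ x. enat_powr x p \<partial>M)"

end

theory Submission
  imports Defs
begin

text \<open>
  Reading the outdegrees of \<open>T\<^sub>n\<close> in preorder, cyclically from the uniform vertex \<open>v\<^sub>n\<close>, gives by the
  cycle lemma a sequence of length \<open>n\<close> and sum \<open>n - 1\<close> distributed proportionally to the product
  of the weights of its entries, and the fringe subtree at \<open>v\<^sub>n\<close> is the tree coded by a prefix.
  Given its multiset of entries such a sequence is exchangeable, so once the relative frequency of
  each entry \<open>k\<close> concentrates exponentially at \<open>P(\<xi> = k)\<close>, its prefixes have in the limit
  the law of independent copies of \<open>\<xi>\<close>, that is, of the code of the Galton--Watson tree.

  In types I and II this concentration is Chernoff's bound for independent copies of \<open>\<xi>\<close>, because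
  conditioning on the sum costs only a subexponential factor: otherwise the generating function
  \<open>F = s \<Phi>(F)\<close> of trees would be finite for some \<open>s > 1\<close>, although \<open>\<Phi>(x) \<ge> x\<close> for the
  generating function \<open>\<Phi>\<close> of \<open>\<xi>\<close>. In type III, superexponentially large weights make sequences
  with many positive entries of bounded size exponentially unlikely. Since the Galton--Watson tree
  is almost surely finite, no mass of the limit is lost by testing finite trees only.

  Moments are controlled by the leftmost path: protection number at least \<open>m\<close> forces the first \<open>m\<close>
  entries of the sequence to be nonzero, which has uniformly exponentially small probability.
\<close>

section \<open>Plane trees and their preorder degree sequences\<close>

text \<open>The type of the weights enters the final argument only through
  \<open>concentrated w (pmf \<xi>)\<close>, the total mass one of the finite trees, and
  \<open>0 < pmf \<xi> 0\<close>. Concentration in probability would not be enough. In types I and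
  II the bound must survive division by the probability of the conditioning event, for which only
  subexponential decay is known: no moment of \<open>\<xi>\<close> beyond the mean is available, so
  no polynomial lower bound is at hand. For the moments, a failure probability
  \<open>C * \<rho> ^ n\<close> is turned into \<open>C * \<rho> ^ m\<close>, since protection
  number \<open>m\<close> requires more than \<open>m\<close> vertices; the resulting geometric
  bound is uniform in \<open>n\<close> and dominates every series whose limit is taken. The lower
  bound behind the subexponential factor is first obtained only along some sequence of sizes.
  Concatenating sequences makes the weights supermultiplicative, and this extends the bound to all
  sizes at which the tree is defined, which need not be all positive integers.\<close>

datatype ptree = Node "ptree list"

instance ptree :: countable by countable_datatype

fun code :: "ptree \<Rightarrow> nat list" where
  "code (Node ts) = length ts # concat (map code ts)"

lemma code_not_Nil [simp]: "code t \<noteq> []"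
  by (cases t) simp

text \<open>\<open>k\<close> counts the subtrees still to be read. An entry \<open>a\<close> closes
  one pending subtree and opens \<open>a\<close> new ones, so the induction has to run over forests
  rather than trees.\<close>

lemma parse_forest:
  "sum_list d + k \<le> length d \<Longrightarrow> \<exists>ts r. length ts = k \<and> d = concat (map code ts) @ r"
proof (induction d arbitrary: k)
  case Nil
  then show ?case by simp
next
  case (Cons a d)
  show ?case
  proof (cases k)
    case 0
    then show ?thesis by simp
  next
    case (Suc l)
    then have "sum_list d + (a + l) \<le> length d"
      using Cons.prems by simp
    from Cons.IH[OF this] obtain ts r where
      ts: "length ts = a + l" "d = concat (map code ts) @ r" by blast
    have "concat (map code ts) = concat (map code (take a ts)) @ concat (map code (drop a ts))"
      by (metis append_take_drop_id concat_append map_append)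
    then have "a # d = concat (map code (Node (take a ts) # drop a ts)) @ r"
      using ts by simp
    moreover have "length (Node (take a ts) # drop a ts) = k"
      using ts Suc by simp
    ultimately show ?thesis by metis
  qed
qed

lemma parse_forest_unique:
  "d = concat (map code ts) @ r \<Longrightarrow> d = concat (map code ts') @ r' \<Longrightarrow> length ts = length ts' \<Longrightarrow>
    ts = ts' \<and> r = r'"
proof (induction d arbitrary: ts ts')
  case Nil
  then show ?case by (cases ts; cases ts') auto
next
  case (Cons a d)
  show ?case
  proof (cases ts)
    case Nil
    then show ?thesis using Cons.prems by simp
  next
    case (Cons t vs)
    obtain us where t: "t = Node us" by (cases t)
    from Cons Cons.prems(3) obtain t' vs' where ts': "ts' = t' # vs'" by (cases ts') auto
    obtain us' where t': "t' = Node us'" by (cases t')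
    have "d = concat (map code (us @ vs)) @ r" "d = concat (map code (us' @ vs')) @ r'"
      and len: "length us = length us'" "length vs = length vs'"
      using Cons.prems Cons ts' t t' by auto
    from Cons.IH[OF this(1,2)] len have "us @ vs = us' @ vs' \<and> r = r'" by simp
    then show ?thesis using Cons t ts' t' len by simp
  qed
qed

text \<open>Every vertex except the root is counted exactly once as a child.\<close>

lemma sum_list_code: "Suc (sum_list (code t)) = length (code t)"
proof (induction t)
  case (Node ts)
  have "sum_list (concat (map code us)) + length us = length (concat (map code us))"
    if "set us \<subseteq> set ts" for us
    using that by (induction us) (use Node in \<open>force simp: Suc_le_eq\<close>)+
  from this[of ts] show ?case by simp
qed

text \<open>Whatever follows the first complete code is ignored, so \<open>decode\<close> applies
  directly to a rotated code. It is meaningful when some prefix is a code, for instance if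
  \<open>sum_list d < length d\<close> (\<open>decode_prefix\<close>).\<close>

definition decode :: "nat list \<Rightarrow> ptree" where
  "decode d = (THE t. \<exists>r. d = code t @ r)"

lemma code_append_inj:
  assumes "code t @ r = code t' @ r'"
  shows "t = t'" "r = r'"
  using parse_forest_unique[of "code t @ r" "[t]" r "[t']" r'] assms by auto

lemma inj_code: "inj code"
  by (rule injI) (metis append_Nil2 code_append_inj(1))

lemma decode_code [simp]: "decode (code t @ r) = t"
  unfolding decode_def by (rule the_equality) (auto dest: code_append_inj(1))

lemma decode_prefix:
  assumes "sum_list d < length d"
  obtains r where "d = code (decode d) @ r"
proof -
  from parse_forest[of d 1] assms obtain ts r where
    "length ts = 1" "d = concat (map code ts) @ r" by auto
  then obtain t where "d = code t @ r" by (cases ts) auto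
  then show ?thesis using that by (metis decode_code)
qed

text \<open>Listed in preorder, so that index \<open>i\<close> refers to the same vertex as position
  \<open>i\<close> of \<open>code\<close>.\<close>

fun fringes :: "ptree \<Rightarrow> ptree list" where
  "fringes (Node ts) = Node ts # concat (map fringes ts)"

lemma length_fringes: "length (fringes t) = length (code t)"
proof (induction t)
  case (Node ts)
  then have "map (length \<circ> fringes) ts = map (length \<circ> code) ts" by simp
  from arg_cong[OF this, of sum_list] show ?case by (simp add: length_concat)
qed

lemma drop_code_fringes:
  "i < length (code t) \<Longrightarrow> \<exists>r. drop i (code t) = code (fringes t ! i) @ r"
proof (induction t arbitrary: i)
  case (Node ts)
  have forest: "\<exists>r. drop i (concat (map code us)) = code (concat (map fringes us) ! i) @ r"
    if "set us \<subseteq> set ts" "i < length (concat (map code us))" for us i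
    using that
  proof (induction us arbitrary: i)
    case Nil
    then show ?case by simp
  next
    case (Cons u us)
    show ?case
    proof (cases "i < length (code u)")
      case True
      then show ?thesis using Node.IH[of u i] Cons.prems
        by (auto simp: nth_append length_fringes)
    next
      case False
      then show ?thesis using Cons.IH[of "i - length (code u)"] Cons.prems
        by (auto simp: nth_append length_fringes)
    qed
  qed
  show ?case
  proof (cases i)
    case 0
    then show ?thesis by simp
  next
    case (Suc j)
    then show ?thesis using forest[of ts j] Node.prems by simp
  qed
qed

definition seqs :: "nat \<Rightarrow> nat \<Rightarrow> nat list set" where
  "seqs n m = {d. length d = n \<and> sum_list d = m}"

definition wt :: "(nat \<Rightarrow> real) \<Rightarrow> nat list \<Rightarrow> real" where
  "wt w d = prod_list (map w d)"

lemma finite_seqs: "finite (seqs n m)"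
proof (rule finite_subset)
  show "seqs n m \<subseteq> {d. set d \<subseteq> {..m} \<and> length d = n}"
    unfolding seqs_def by (auto dest: member_le_sum_list)
  show "finite {d. set d \<subseteq> {..m} \<and> length d = n}"
    by (simp add: finite_lists_length_eq)
qed

lemma finite_size_ptree: "finite {t. length (code t) = n}"
proof (rule finite_imageD)
  show "finite (code ` {t. length (code t) = n})"
  proof (rule finite_subset)
    show "code ` {t. length (code t) = n} \<subseteq> seqs n (n - 1)"
      by (auto simp: seqs_def sum_list_code[symmetric])
  qed (rule finite_seqs)
qed (use inj_code in \<open>auto intro: inj_on_subset\<close>)

section \<open>The cycle lemma\<close>

lemma rotate_eq: "i \<le> length d \<Longrightarrow> rotate i d = drop i d @ take i d"
  by (cases "i = length d") (auto simp: rotate_drop_take)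

text \<open>A prefix whose sum is below its length begins with a complete code; for a proper prefix
  of a code this contradicts unique readability.\<close>

lemma sum_list_take_code_ge:
  assumes "i < length (code t)"
  shows "i \<le> sum_list (take i (code t))"
proof (rule ccontr)
  assume "\<not> ?thesis"
  then have "sum_list (take i (code t)) < length (take i (code t))" using assms by simp
  then obtain r where r: "take i (code t) = code (decode (take i (code t))) @ r"
    by (rule decode_prefix)
  then have "code t @ [] = code (decode (take i (code t))) @ (r @ drop i (code t))"
    by (metis append.assoc append_Nil2 append_take_drop_id)
  from code_append_inj(2)[OF this] have "drop i (code t) = []" by simp
  then show False using assms by simp
qed

lemma rotate_cancel: "rotate i xs = rotate i ys \<Longrightarrow> xs = ys"
proof (induction i)
  case (Suc i)
  then have "rotate1 (rotate i xs) = rotate1 (rotate i ys)" by simp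
  then have "rotate i xs = rotate i ys"
    by (cases "rotate i xs"; cases "rotate i ys") auto
  then show ?case by (rule Suc.IH)
qed simp

lemma mset_rotate_eq [simp]: "mset (rotate i xs) = mset xs"
  proof (induction i)
  case (Suc i)
  then show ?case by (cases "rotate i xs") auto
qed simp

text \<open>The rotation is determined because the partial sums of \<open>d ! j - 1\<close> along a code stay
  nonnegative until the last step.\<close>

lemma rotate_code_inj:
  assumes "rotate i (code t) = rotate j (code t')" "i \<le> j" "j < n"
    and n: "length (code t) = n" "length (code t') = n"
  shows "i = j \<and> t = t'"
proof -
  define k where "k = j - i"
  have "rotate j (code t') = rotate i (rotate k (code t'))"
    using assms by (simp add: rotate_rotate k_def)
  then have eq: "code t = rotate k (code t')"
    using assms(1) by (auto dest: rotate_cancel)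
  have "k = 0"
  proof (rule ccontr)
    assume "k \<noteq> 0"
    have kn: "k < n" using assms by (simp add: k_def)
    have rot: "code t = drop k (code t') @ take k (code t')"
      using eq kn n by (simp add: rotate_eq)
    \<comment> \<open>For \<open>0 < k < n\<close> the two blocks are proper prefixes, one of
      \<open>code t\<close> and one of \<open>code t'\<close>, so each has sum at least its length.
      The total would be at least \<open>n\<close>, but it is \<open>n - 1\<close>.\<close>
    have "take (n - k) (code t) = drop k (code t')"
      using rot n kn by simp
    then have "n - k \<le> sum_list (drop k (code t'))"
      using sum_list_take_code_ge[of "n - k" t] kn n \<open>k \<noteq> 0\<close> by simp
    moreover have "k \<le> sum_list (take k (code t'))"
      using sum_list_take_code_ge[of k t'] kn n by simp
    moreover have "sum_list (take k (code t')) + sum_list (drop k (code t')) = sum_list (code t')"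
      by (metis append_take_drop_id sum_list_append)
    ultimately show False using sum_list_code[of t'] n kn by simp
  qed
  then show ?thesis using eq assms(2) inj_code by (auto simp: k_def dest: injD)
qed

text \<open>Cut at the first minimum of the walk \<open>s\<close> with steps
  \<open>d ! j - 1\<close>. Read from there, the walk cannot reach -1 before the last step, so the
  decoded prefix exhausts the word.\<close>

lemma rotate_to_code:
  assumes "Suc (sum_list d) = length d"
  shows "\<exists>t i. i < length d \<and> d = rotate i (code t)"
proof -
  define s where "s i = int (sum_list (take i d)) - int i" for i
  define n where "n = length d"
  have sn: "s n = -1" "s 0 = 0" using assms by (auto simp: s_def n_def)
  have n0: "n > 0" using assms by (cases d) (auto simp: n_def)
  define M where "M = Min (s ` {..n})"
  have M: "M \<in> s ` {..n}" "\<And>i. i \<le> n \<Longrightarrow> M \<le> s i"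
    unfolding M_def by (auto intro: Min_in Min_le)
  define m where "m = (LEAST i. i \<le> n \<and> s i = M)"
  have m: "m \<le> n" "s m = M"
    using LeastI_ex[of "\<lambda>i. i \<le> n \<and> s i = M"] M(1) unfolding m_def by auto
  have less: "M < s i" if "i < m" for i
    using that not_less_Least[of i "\<lambda>i. i \<le> n \<and> s i = M"] M(2)[of i] m(1)
    unfolding m_def[symmetric] by auto
  \<comment> \<open>The walk ends at -1, below its start, so the minimum is not at 0; hence the
    inverse rotation by \<open>n - m\<close> is a rotation by less than \<open>n\<close>.\<close>
  have "m \<noteq> 0" using m M(2)[of n] sn by (metis less_irrefl order_trans order.refl zero_less_one neg_0_le_iff_le not_one_le_zero)
  define e where "e = drop m d @ take m d"
  have e: "length e = n" "sum_list e = sum_list d"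
    unfolding e_def n_def using m(1) n_def
    by (simp_all, metis add.commute append_take_drop_id sum_list_append)
  have "sum_list e < length e" using e assms by (simp add: n_def)
  then obtain r where r: "e = code (decode e) @ r" by (rule decode_prefix)
  have "r = []"
  proof (rule ccontr)
    assume "r \<noteq> []"
    define l where "l = length (code (decode e))"
    have l: "l < n" "l > 0" using r e \<open>r \<noteq> []\<close>
      by (metis l_def length_append less_add_same_cancel1 length_greater_0_conv)
         (simp add: l_def)
    have le: "take l e = code (decode e)" using r l_def by (metis append_eq_conv_conj)
    have suml: "int (sum_list (take l e)) - int l = -1"
      using sum_list_code[of "decode e"] le l_def by simp
    have split: "sum_list (take i d) + sum_list (drop i d) = sum_list d" for i
      by (metis append_take_drop_id sum_list_append)
    \<comment> \<open>A code of length \<open>l < n\<close> would take the walk one below its value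
      at \<open>m\<close>. Before the wrap-around this undercuts the minimum; after it, since a full
      turn lowers the walk by one, the minimum would already be attained at some
      \<open>i < m\<close>.\<close>
    show False
    proof (cases "l \<le> n - m")
      case True
      have tk: "take (m + l) d = take m d @ take l (drop m d)" by (rule take_add)
      have "take l e = take l (drop m d)" using True by (simp add: e_def n_def)
      then have "s (m + l) = s m - 1" using suml tk by (simp add: s_def)
      moreover have "m + l \<le> n" using True m(1) by simp
      ultimately show False using M(2)[of "m + l"] m(2) by simp
    next
      case False
      define i where "i = l - (n - m)"
      have i: "i < m" using l i_def False m(1) by simp
      have "take l e = drop m d @ take i d"
        using False i by (simp add: e_def n_def i_def)
      then have "int (sum_list d) - int (sum_list (take m d)) + int (sum_list (take i d)) - int l = -1"
        using suml split[of m] by simp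
      then have "s n + int n - (s m + int m) + (s i + int i) - int l = -1"
        by (simp add: s_def n_def)
      then have "s i = s m" using sn(1) i_def False m(1) by simp
      then show False using less[OF i] m(2) by simp
    qed
  qed
  then have e2: "e = code (decode e)" using r by simp
  have "rotate (n - m) e = d"
  proof (cases "m = n")
    case True
    then show ?thesis by (simp add: e_def n_def)
  next
    case False
    then show ?thesis using m(1) e(1) \<open>m \<noteq> 0\<close> by (simp add: rotate_eq e_def n_def)
  qed
  moreover have "n - m < n" using n0 \<open>m \<noteq> 0\<close> by simp
  ultimately show ?thesis using e2 n_def by metis
qed

lemma cycle_lemma:
  assumes "0 < n"
  shows "bij_betw (\<lambda>(t, i). rotate i (code t)) ({t. length (code t) = n} \<times> {..<n}) (seqs n (n - 1))"
  unfolding bij_betw_def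
proof
  show "inj_on (\<lambda>(t, i). rotate i (code t)) ({t. length (code t) = n} \<times> {..<n})"
  proof (rule inj_onI, clarsimp)
    fix t i t' j
    assume "rotate i (code t) = rotate j (code t')" "i < length (code t)" "j < length (code t)"
      "length (code t') = length (code t)" 
    then show "t = t' \<and> i = j"
      using rotate_code_inj[of i t j t'] rotate_code_inj[of j t' i t] by (metis nle_le)
  qed
  show "(\<lambda>(t, i). rotate i (code t)) ` ({t. length (code t) = n} \<times> {..<n}) = seqs n (n - 1)"
  proof (intro equalityI subsetI)
    fix d assume "d \<in> (\<lambda>(t, i). rotate i (code t)) ` ({t. length (code t) = n} \<times> {..<n})"
    then obtain t i where d: "d = rotate i (code t)" "length (code t) = n" by auto
    have "sum_list d = sum_list (code t)"
      unfolding d(1) by (metis mset_rotate_eq sum_mset_sum_list)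
    then show "d \<in> seqs n (n - 1)"
      using d sum_list_code[of t] by (simp add: seqs_def)
  next
    fix d assume "d \<in> seqs n (n - 1)"
    then have d: "length d = n" "Suc (sum_list d) = length d" using assms by (auto simp: seqs_def)
    from rotate_to_code[OF d(2)] obtain t i where "i < n" "d = rotate i (code t)"
      using d by auto
    then show "d \<in> (\<lambda>(t, i). rotate i (code t)) ` ({t. length (code t) = n} \<times> {..<n})"
      using d by (intro image_eqI[of _ _ "(t, i)"]) auto
  qed
qed

lemma wt_mset: "mset d = mset d' \<Longrightarrow> wt w d = wt w d'"
  unfolding wt_def by (metis mset_map prod_mset_prod_list)

text \<open>Rotating the code so that vertex \<open>i\<close> comes first puts the code of its
  fringe subtree in front, where \<open>decode\<close> finds it, and keeps the weight. With
  \<open>g = 1\<close> this also compares \<open>Z\<close> with the total weight of the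
  trees.\<close>

lemma sum_fringes_eq_sum_seqs:
  assumes "0 < n"
  shows "(\<Sum>t | length (code t) = n. wt w (code t) * (\<Sum>s\<leftarrow>fringes t. g s)) =
    (\<Sum>d\<in>seqs n (n - 1). wt w d * g (decode d))"
proof -
  have "(\<Sum>d\<in>seqs n (n - 1). wt w d * g (decode d)) =
    (\<Sum>(t, i)\<in>{t. length (code t) = n} \<times> {..<n}.
        wt w (rotate i (code t)) * g (decode (rotate i (code t))))"
    by (subst sum.reindex_bij_betw[OF cycle_lemma[OF assms], symmetric])
       (simp add: case_prod_unfold)
  also have "\<dots> = (\<Sum>(t, i)\<in>{t. length (code t) = n} \<times> {..<n}. wt w (code t) * g (fringes t ! i))"
  proof (intro sum.cong refl, clarsimp)
    fix t i assume i: "i < length (code t)"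
    from drop_code_fringes[OF i] obtain r where "drop i (code t) = code (fringes t ! i) @ r" ..
    then have "decode (rotate i (code t)) = fringes t ! i"
      using i by (simp add: rotate_eq)
    then show "wt w (rotate i (code t)) * g (decode (rotate i (code t))) = wt w (code t) * g (fringes t ! i)"
      using wt_mset[OF mset_rotate_eq[of i "code t"], of w] by simp
  qed
  also have "\<dots> = (\<Sum>t | length (code t) = n. \<Sum>i<n. wt w (code t) * g (fringes t ! i))"
    by (simp add: sum.cartesian_product)
  also have "\<dots> = (\<Sum>t | length (code t) = n. wt w (code t) * (\<Sum>s\<leftarrow>fringes t. g s))"
    by (intro sum.cong refl)
       (simp add: sum_distrib_left sum_list_sum_nth length_fringes atLeast0LessThan)
  finally show ?thesis by simp
qed

section \<open>Trees as sets of vertices\<close>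

lemma size_nth_less [termination_simp]: "i < length ts \<Longrightarrow> size (ts ! i) < Suc (size_list size ts)"
  by (meson less_Suc_eq_le nth_mem size_list_estimation' order.refl)

fun verts :: "ptree \<Rightarrow> vertex set" where
  "verts (Node ts) = insert [] (\<Union>i<length ts. (#) i ` verts (ts ! i))"

lemma Nil_in_verts [simp]: "[] \<in> verts t"
  by (cases t) simp

lemma Cons_in_verts [simp]: "i # u \<in> verts (Node ts) \<longleftrightarrow> i < length ts \<and> u \<in> verts (ts ! i)"
  by auto

declare verts.simps [simp del]

lemma verts_Node_eq: "verts (Node ts) = insert [] ((\<lambda>(i, u). i # u) ` (SIGMA i:{..<length ts}. verts (ts ! i)))"
  by (force simp: verts.simps)

lemma finite_verts [simp]: "finite (verts t)"
  by (induction t) (simp add: verts.simps)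

lemma plane_tree_verts: "plane_tree (verts t)"
proof (induction t)
  case (Node ts)
  have sub: "plane_tree (verts (ts ! i))" if "i < length ts" for i
    using Node that by simp
  show ?case
    unfolding plane_tree_def
  proof (intro conjI allI impI)
    fix v i assume *: "v @ [i] \<in> verts (Node ts)"
    have cons: "u \<in> verts (ts ! l) \<and> (\<forall>j<i. u @ [j] \<in> verts (ts ! l))" if "v = l # u" for l u
    proof -
      have "l < length ts" "u @ [i] \<in> verts (ts ! l)" using * that by auto
      then show ?thesis using sub[of l] unfolding plane_tree_def by blast
    qed
    show "v \<in> verts (Node ts)"
      using * cons by (cases v) auto
    fix j assume "j < i"
    then show "v @ [j] \<in> verts (Node ts)"
      using * cons by (cases v) auto
  qed simp
qed

lemma outdegree_verts_Nil [simp]: "outdegree (verts (Node ts)) [] = length ts"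
  by (simp add: outdegree_def)

lemma outdegree_verts_Cons [simp]:
  "i < length ts \<Longrightarrow> outdegree (verts (Node ts)) (i # u) = outdegree (verts (ts ! i)) u"
  by (simp add: outdegree_def)

lemma fringe_subtree_Nil [simp]: "fringe_subtree T [] = T"
  by (simp add: fringe_subtree_def)

lemma fringe_subtree_verts_Cons [simp]:
  "i < length ts \<Longrightarrow> fringe_subtree (verts (Node ts)) (i # u) = fringe_subtree (verts (ts ! i)) u"
  by (simp add: fringe_subtree_def)

text \<open>Stated in the locale to yield both \<open>sum.verts_Node\<close> and
  \<open>prod.verts_Node\<close>.\<close>

lemma (in comm_monoid_set) verts_Node:
  "F g (verts (Node ts)) = f (g []) (F (\<lambda>i. F (\<lambda>u. g (i # u)) (verts (ts ! i))) {..<length ts})"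
proof -
  have "F g ((\<lambda>(i, u). i # u) ` (SIGMA i:{..<length ts}. verts (ts ! i))) =
      F (\<lambda>(i, u). g (i # u)) (SIGMA i:{..<length ts}. verts (ts ! i))"
    by (subst reindex) (auto simp: inj_on_def comp_def case_prod_unfold)
  also have "\<dots> = F (\<lambda>i. F (\<lambda>u. g (i # u)) (verts (ts ! i))) {..<length ts}"
    by (subst Sigma) auto
  finally show ?thesis
    unfolding verts_Node_eq by (subst insert) auto
qed

lemma sum_fringe_verts:
  "(\<Sum>v\<in>verts t. g (fringe_subtree (verts t) v)) = (\<Sum>s\<leftarrow>fringes t. g (verts s))"
  for g :: "vertex set \<Rightarrow> 'a :: comm_monoid_add"
proof (induction t)
  case (Node ts)
  have "(\<Sum>v\<in>verts (Node ts). g (fringe_subtree (verts (Node ts)) v)) =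
      g (verts (Node ts)) + (\<Sum>i<length ts. \<Sum>u\<in>verts (ts ! i). g (fringe_subtree (verts (ts ! i)) u))"
    by (simp add: sum.verts_Node)
  also have "\<dots> = g (verts (Node ts)) + (\<Sum>i<length ts. \<Sum>s\<leftarrow>fringes (ts ! i). g (verts s))"
    using Node by (auto intro!: sum.cong)
  also have "(\<Sum>i<length ts. \<Sum>s\<leftarrow>fringes (ts ! i). g (verts s)) =
      (\<Sum>t\<leftarrow>ts. \<Sum>s\<leftarrow>fringes t. g (verts s))"
    by (simp add: sum_list_sum_nth atLeast0LessThan)
  also have "\<dots> = (\<Sum>s\<leftarrow>concat (map fringes ts). g (verts s))"
    by (induction ts) auto
  finally show ?case by simp
qed

lemma prod_outdegree_verts:
  "(\<Prod>v\<in>verts t. w (outdegree (verts t) v)) = prod_list (map w (code t))"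
  for w :: "nat \<Rightarrow> 'a :: comm_monoid_mult"
proof (induction t)
  case (Node ts)
  have "(\<Prod>v\<in>verts (Node ts). w (outdegree (verts (Node ts)) v)) =
      w (length ts) * (\<Prod>i<length ts. \<Prod>u\<in>verts (ts ! i). w (outdegree (verts (ts ! i)) u))"
    by (simp add: prod.verts_Node)
  also have "\<dots> = w (length ts) * (\<Prod>i<length ts. prod_list (map w (code (ts ! i))))"
    using Node by (auto intro!: prod.cong arg_cong[where f = "(*) _"])
  also have "(\<Prod>i<length ts. prod_list (map w (code (ts ! i)))) = prod_list (map (\<lambda>t. prod_list (map w (code t))) ts)"
    using prod.list_conv_set_nth[of "map (\<lambda>t. prod_list (map w (code t))) ts"]
    by (simp add: atLeast0LessThan)
  also have "\<dots> = prod_list (map w (concat (map code ts)))"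
    by (induction ts) auto
  finally show ?case by simp
qed

lemma tree_weight_verts: "tree_weight w (verts t) = wt w (code t)"
  by (simp add: tree_weight_def wt_def prod_outdegree_verts)

lemma card_verts: "card (verts t) = length (code t)"
proof -
  have "card (verts t) = (\<Sum>v\<in>verts t. 1)" by simp
  also have "\<dots> = length (fringes t)"
    by (subst sum_fringe_verts[of "\<lambda>_. 1"]) (simp add: sum_list_triv)
  finally show ?thesis by (simp add: length_fringes)
qed

lemma verts_inject: "verts t = verts t' \<Longrightarrow> t = t'"
proof (induction t arbitrary: t')
  case (Node ts)
  obtain ts' where t': "t' = Node ts'" by (cases t')
  have len: "length ts = length ts'"
    using arg_cong[OF Node.prems, of "\<lambda>T. outdegree T []"] t' by simp
  have "ts ! i = ts' ! i" if "i < length ts" for i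
  proof (rule Node.IH)
    show "ts ! i \<in> set ts" using that by simp
    have "u \<in> verts (ts ! i) \<longleftrightarrow> u \<in> verts (ts' ! i)" for u
      using Cons_in_verts[of i u ts] Cons_in_verts[of i u ts'] Node.prems t' that len by simp
    then show "verts (ts ! i) = verts (ts' ! i)" by blast
  qed
  then show ?case using t' len by (simp add: list_eq_iff_nth_eq)
qed

lemma down_closed_eq_lessThan:
  fixes A :: "nat set"
  assumes "finite A" "\<And>i j. i \<in> A \<Longrightarrow> j < i \<Longrightarrow> j \<in> A"
  shows "A = {..<card A}"
proof (cases "A = {}")
  case False
  have "A = {..Max A}"
  proof (intro equalityI subsetI)
    fix x assume "x \<in> {..Max A}"
    then show "x \<in> A" using assms(2)[OF Max_in[OF assms(1) False], of x]
      Max_in[OF assms(1) False] by (cases "x = Max A") auto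
  qed (use assms(1) in auto)
  then have "card A = Suc (Max A)" by (metis card_atMost)
  with \<open>A = {..Max A}\<close> show ?thesis by (metis lessThan_Suc_atMost)
qed simp

lemma children_eq_lessThan:
  assumes "plane_tree T" "finite T"
  shows "v @ [i] \<in> T \<longleftrightarrow> i < outdegree T v"
proof -
  have "{i. v @ [i] \<in> T} = {..<outdegree T v}"
    unfolding outdegree_def
  proof (rule down_closed_eq_lessThan)
    have sub: "(\<lambda>i. v @ [i]) ` {i. v @ [i] \<in> T} \<subseteq> T" by auto
    show "finite {i. v @ [i] \<in> T}"
      by (rule finite_imageD[OF finite_subset[OF sub assms(2)]]) (simp add: inj_on_def)
    fix i j assume "i \<in> {i. v @ [i] \<in> T}" "j < i"
    then show "j \<in> {i. v @ [i] \<in> T}" using assms(1) unfolding plane_tree_def by blast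
  qed
  then show ?thesis by auto
qed

text \<open>Each branch at the root, with its first letter removed, is again a plane tree, and
  smaller because it misses the root.\<close>

lemma ex_verts:
  assumes "plane_tree T" "finite T"
  shows "\<exists>t. T = verts t"
  using assms
proof (induction "card T" arbitrary: T rule: less_induct)
  case less
  define k where "k = outdegree T []"
  have k: "[i] \<in> T \<longleftrightarrow> i < k" for i
    using children_eq_lessThan[OF less.prems, of "[]" i] by (simp add: k_def)
  have "\<exists>t. {u. i # u \<in> T} = verts t" if "i < k" for i
  proof (rule less.hyps)
    have inj: "inj_on ((#) i) A" for A by simp
    have sub: "(#) i ` {u. i # u \<in> T} \<subseteq> T - {[]}" by auto
    show fin: "finite {u. i # u \<in> T}"
      by (rule finite_imageD[OF finite_subset[OF sub] inj]) (simp add: less.prems(2))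
    have "[] \<in> T" using less.prems by (simp add: plane_tree_def)
    then have "card (T - {[]}) < card T" using less.prems(2) by (intro psubset_card_mono) auto
    moreover have "card ((#) i ` {u. i # u \<in> T}) \<le> card (T - {[]})"
      using sub less.prems(2) by (intro card_mono) auto
    ultimately show "card {u. i # u \<in> T} < card T" by (simp add: card_image)
    show "plane_tree {u. i # u \<in> T}"
      unfolding plane_tree_def
    proof (intro conjI allI impI; simp only: mem_Collect_eq)
      show "[i] \<in> T" using k that by simp
      fix v j assume "i # v @ [j] \<in> T"
      then have *: "(i # v) @ [j] \<in> T" by simp
      then show "i # v \<in> T" using less.prems(1) unfolding plane_tree_def by blast
      fix l assume "l < j"
      then have "(i # v) @ [l] \<in> T" using * less.prems(1) unfolding plane_tree_def by blast
      then show "i # v @ [l] \<in> T" by simp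
    qed
  qed
  then obtain f where f: "\<And>i. i < k \<Longrightarrow> {u. i # u \<in> T} = verts (f i)" by metis
  have "u \<in> T \<longleftrightarrow> u \<in> verts (Node (map f [0..<k]))" for u
  proof (cases u)
    case Nil
    then show ?thesis using less.prems by (simp add: plane_tree_def)
  next
    case (Cons i v)
    have "i < k" if "i # v \<in> T"
      using plane_tree_take[OF less.prems(1) that, of 1] k by simp
    moreover have "v \<in> {u. i # u \<in> T} \<longleftrightarrow> v \<in> verts (f i)" if "i < k"
      using f[OF that] by (rule arg_cong)
    ultimately show ?thesis unfolding Cons by (cases "i < k") auto
  qed
  then have "T = verts (Node (map f [0..<k]))" by blast
  then show ?case by (rule exI)
qed

lemma bij_betw_verts: "bij_betw verts {t. length (code t) = n} (plane_trees n)"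
  unfolding bij_betw_def
proof
  show "inj_on verts {t. length (code t) = n}"
    by (auto intro: inj_onI verts_inject)
  show "verts ` {t. length (code t) = n} = plane_trees n"
  proof (intro equalityI subsetI)
    fix T assume "T \<in> plane_trees n"
    then have T: "plane_tree T" "finite T" "card T = n" by (auto simp: plane_trees_def)
    from ex_verts[OF T(1,2)] obtain t where "T = verts t" ..
    then show "T \<in> verts ` {t. length (code t) = n}" using T(3) by (intro image_eqI[of _ _ t]) (simp_all add: card_verts)
  qed (auto simp: plane_trees_def plane_tree_verts card_verts)
qed

section \<open>Finite trees as events for the Galton--Watson tree\<close>

lemma bgw_tree_snoc: "v @ [i] \<in> bgw_tree N \<longleftrightarrow> v \<in> bgw_tree N \<and> i < N v"
  by (auto simp: bgw_tree_def nth_append less_Suc_eq all_conj_distrib)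

text \<open>Makes the event depend on finitely many coordinates only, so that it is a cylinder and
  its probability a finite product.\<close>

lemma bgw_tree_eq_iff:
  assumes T: "plane_tree T" "finite T"
  shows "bgw_tree N = T \<longleftrightarrow> (\<forall>v\<in>T. N v = outdegree T v)"
proof
  assume eq: "bgw_tree N = T"
  show "\<forall>v\<in>T. N v = outdegree T v"
  proof
    fix v assume "v \<in> T"
    then have "i < N v \<longleftrightarrow> i < outdegree T v" for i
      using bgw_tree_snoc[of v i N] children_eq_lessThan[OF T, of v i] eq by simp
    then show "N v = outdegree T v" by (metis nat_neq_iff)
  qed
next
  assume N: "\<forall>v\<in>T. N v = outdegree T v"
  have "u \<in> bgw_tree N \<longleftrightarrow> u \<in> T" for u
  proof (induction u rule: rev_induct)
    case Nil
    then show ?case using T(1) by (simp add: bgw_tree_def plane_tree_def)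
  next
    case (snoc i v)
    have "v @ [i] \<in> T \<Longrightarrow> v \<in> T" using T(1) unfolding plane_tree_def by blast
    then show ?case
      using snoc N children_eq_lessThan[OF T, of v i] by (auto simp: bgw_tree_snoc)
  qed
  then show "bgw_tree N = T" by blast
qed

lemma bgw_tree_verts_event:
  "{N \<in> space (bgw_space \<xi>). bgw_tree N = verts t} \<in> sets (bgw_space \<xi>)"
  "emeasure (bgw_space \<xi>) {N \<in> space (bgw_space \<xi>). bgw_tree N = verts t} = ennreal (wt (pmf \<xi>) (code t))"
proof -
  have eq: "{N \<in> space (bgw_space \<xi>). bgw_tree N = verts t} =
      prod_emb UNIV (\<lambda>_. measure_pmf \<xi>) (verts t) (Pi\<^sub>E (verts t) (\<lambda>v. {outdegree (verts t) v}))"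
  proof (rule set_eqI)
    fix N
    have "restrict N (verts t) \<in> Pi\<^sub>E (verts t) (\<lambda>v. {outdegree (verts t) v}) \<longleftrightarrow>
        (\<forall>v\<in>verts t. N v = outdegree (verts t) v)"
      by (simp add: PiE_iff)
    then show "N \<in> {N \<in> space (bgw_space \<xi>). bgw_tree N = verts t} \<longleftrightarrow>
        N \<in> prod_emb UNIV (\<lambda>_. measure_pmf \<xi>) (verts t) (Pi\<^sub>E (verts t) (\<lambda>v. {outdegree (verts t) v}))"
      by (simp add: bgw_tree_eq_iff[OF plane_tree_verts finite_verts] prod_emb_def bgw_space_def
          space_PiM)
  qed
  show "{N \<in> space (bgw_space \<xi>). bgw_tree N = verts t} \<in> sets (bgw_space \<xi>)"
    unfolding eq unfolding bgw_space_def by (rule sets_PiM_I) auto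
  have "emeasure (bgw_space \<xi>) {N \<in> space (bgw_space \<xi>). bgw_tree N = verts t} =
      (\<Prod>v\<in>verts t. emeasure (measure_pmf \<xi>) {outdegree (verts t) v})"
    unfolding eq unfolding bgw_space_def
    by (rule emeasure_PiM_emb) (auto intro: measure_pmf.prob_space_axioms)
  also have "\<dots> = (\<Prod>v\<in>verts t. ennreal (pmf \<xi> (outdegree (verts t) v)))"
    by (simp add: emeasure_pmf_single)
  also have "\<dots> = ennreal (\<Prod>v\<in>verts t. pmf \<xi> (outdegree (verts t) v))"
    by (simp add: prod_ennreal)
  finally show "emeasure (bgw_space \<xi>) {N \<in> space (bgw_space \<xi>). bgw_tree N = verts t} = ennreal (wt (pmf \<xi>) (code t))"
    by (simp add: prod_outdegree_verts wt_def)
qed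

text \<open>Preorder reads the leftmost path first, so its inner vertices occupy the initial
  positions of the code.\<close>

lemma leftmost_leaf:
  "\<exists>j. replicate j 0 \<in> leaves (verts t) \<and> j < length (code t) \<and> (\<forall>i<j. code t ! i \<noteq> 0)"
proof (induction t)
  case (Node ts)
  show ?case
  proof (cases ts)
    case Nil
    then show ?thesis by (intro exI[of _ 0]) (simp add: leaves_def)
  next
    case (Cons s ss)
    with Node[of s] obtain j where j: "replicate j 0 \<in> leaves (verts s)" "j < length (code s)"
      "\<forall>i<j. code s ! i \<noteq> 0" by auto
    show ?thesis
    proof (intro exI[of _ "Suc j"] conjI allI impI)
      show "replicate (Suc j) 0 \<in> leaves (verts (Node ts))"
        using j(1) Cons by (simp add: leaves_def)
      show "Suc j < length (code (Node ts))" using j(2) Cons by simp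
      show "code (Node ts) ! i \<noteq> 0" if "i < Suc j" for i
        using that j Cons by (cases i) (auto simp: nth_append)
    qed
  qed
qed

lemma border_dist_le: "v \<in> leaves T \<Longrightarrow> border_dist T \<le> enat (length v)"
  unfolding border_dist_def by (rule INF_lower)

text \<open>\<open>the_enat\<close> loses nothing here, because a finite tree has a leaf
  (\<open>border_dist_verts\<close>).\<close>

definition border :: "ptree \<Rightarrow> nat" where
  "border t = the_enat (border_dist (verts t))"

lemma border_dist_verts: "border_dist (verts t) = enat (border t)"
proof -
  from leftmost_leaf[of t] obtain j where "replicate j 0 \<in> leaves (verts t)" by blast
  then have "border_dist (verts t) \<le> enat j" by (auto dest: border_dist_le)
  then obtain k where "border_dist (verts t) = enat k" using enat_ile by blast
  then show ?thesis by (simp add: border_def)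
qed

lemma le_borderD:
  assumes "m \<le> border t"
  shows "m < length (code t)" "i < m \<Longrightarrow> code t ! i \<noteq> 0"
proof -
  from leftmost_leaf[of t] obtain j where j: "replicate j 0 \<in> leaves (verts t)" "j < length (code t)"
    "\<forall>i<j. code t ! i \<noteq> 0" by auto
  have "border_dist (verts t) \<le> enat j"
    using border_dist_le[OF j(1)] by simp
  then have "m \<le> j" using assms by (simp add: border_dist_verts)
  with j show "m < length (code t)" "i < m \<Longrightarrow> code t ! i \<noteq> 0" by auto
qed

section \<open>Weights of degree sequences\<close>

text \<open>The coefficient of order \<open>m\<close> in the \<open>n\<close>-th power of the
  generating function of \<open>w\<close> (\<open>Z_eq_fps_nth\<close>). For \<open>0 < n\<close>
  and \<open>m = n - 1\<close> it is \<open>n\<close> times the total weight of the trees with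
  \<open>n\<close> vertices (\<open>weighted_trees_eq_Z\<close>).\<close>

definition Z :: "(nat \<Rightarrow> real) \<Rightarrow> nat \<Rightarrow> nat \<Rightarrow> real" where
  "Z w n m = (\<Sum>d\<in>seqs n m. wt w d)"

lemma wt_Nil [simp]: "wt w [] = 1" and wt_Cons [simp]: "wt w (a # d) = w a * wt w d"
  by (simp_all add: wt_def)

lemma wt_nonneg: "(\<And>k. 0 \<le> w k) \<Longrightarrow> 0 \<le> wt w d"
  by (induction d) auto

lemma Z_nonneg: "(\<And>k. 0 \<le> w k) \<Longrightarrow> 0 \<le> Z w n m"
  unfolding Z_def by (intro sum_nonneg wt_nonneg)

lemma Z_0: "Z w 0 m = (if m = 0 then 1 else 0)"
proof -
  have "seqs 0 m = (if m = 0 then {[]} else {})" by (auto simp: seqs_def)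
  then show ?thesis by (simp add: Z_def)
qed

lemma Z_Suc: "Z w (Suc n) m = (\<Sum>k\<le>m. w k * Z w n (m - k))"
proof -
  have eq: "seqs (Suc n) m = (\<lambda>(k, d). k # d) ` (SIGMA k:{..m}. seqs n (m - k))"
  proof (intro equalityI subsetI)
    fix d assume "d \<in> seqs (Suc n) m"
    then show "d \<in> (\<lambda>(k, d). k # d) ` (SIGMA k:{..m}. seqs n (m - k))"
      by (cases d) (auto simp: seqs_def image_iff)
  qed (auto simp: seqs_def)
  have "Z w (Suc n) m = (\<Sum>(k, d)\<in>(SIGMA k:{..m}. seqs n (m - k)). w k * wt w d)"
    unfolding Z_def eq by (subst sum.reindex) (auto simp: inj_on_def case_prod_unfold)
  also have "\<dots> = (\<Sum>k\<le>m. \<Sum>d\<in>seqs n (m - k). w k * wt w d)"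
    by (subst sum.Sigma) (auto simp: finite_seqs)
  finally show ?thesis by (simp add: Z_def sum_distrib_left)
qed

lemma Z_eq_fps_nth: "Z w n m = fps_nth (Abs_fps w ^ n) m"
  by (induction n arbitrary: m) (simp_all add: Z_0 Z_Suc fps_mult_nth atLeast0AtMost)

text \<open>A single term of a convolution of non-negative sequences; combinatorially,
  concatenation.\<close>

lemma Z_mult_le:
  assumes "\<And>k. 0 \<le> w k"
  shows "Z w n m * Z w n' m' \<le> Z w (n + n') (m + m')"
proof -
  have "Z w n m * Z w n' m' = Z w n m * Z w n' (m + m' - m)" by simp
  also have "\<dots> \<le> (\<Sum>i=0..m + m'. Z w n i * Z w n' (m + m' - i))"
    by (rule member_le_sum) (auto intro: mult_nonneg_nonneg Z_nonneg assms)
  also have "\<dots> = Z w (n + n') (m + m')"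
    by (simp add: Z_eq_fps_nth power_add fps_mult_nth)
  finally show ?thesis .
qed

lemma Z_power_le:
  assumes "\<And>k. 0 \<le> w k"
  shows "Z w n m ^ j \<le> Z w (j * n) (j * m)"
proof (induction j)
  case (Suc j)
  have "Z w n m ^ Suc j \<le> Z w n m * Z w (j * n) (j * m)"
    using Suc Z_nonneg[of w] assms by (auto intro: mult_left_mono)
  also have "\<dots> \<le> Z w (Suc j * n) (Suc j * m)"
    using Z_mult_le[of w n m "j * n" "j * m"] assms by simp
  finally show ?case .
qed (simp add: Z_0)

text \<open>Dropping the constraint on the sum leaves \<open>n\<close> free choices of an
  entry.\<close>

lemma Z_le_power:
  assumes "\<And>k. 0 \<le> w k" "\<And>j. (\<Sum>k\<le>j. w k) \<le> S"
  shows "Z w n m \<le> S ^ n"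
proof (induction n arbitrary: m)
  case (Suc n)
  have "0 \<le> S" using assms(1)[of 0] assms(2)[of 0] by simp
  have "Z w (Suc n) m \<le> (\<Sum>k\<le>m. w k * S ^ n)"
    unfolding Z_Suc by (intro sum_mono mult_left_mono Suc assms)
  also have "\<dots> = (\<Sum>k\<le>m. w k) * S ^ n" by (simp add: sum_distrib_right)
  also have "\<dots> \<le> S * S ^ n" using assms(2) \<open>0 \<le> S\<close> by (intro mult_right_mono) auto
  finally show ?case by simp
qed (simp add: Z_0)

text \<open>Exponential moments of an entry count are partition functions for weights with one entry
  changed. The concentration proofs of all types start from this.\<close>

lemma sum_wt_count:
  "(\<Sum>d\<in>seqs n m. wt w d * x ^ count_list d b) = Z (w(b := x * w b)) n m"
proof -
  have "wt w d * x ^ count_list d b = wt (w(b := x * w b)) d" for d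
    by (induction d) auto
  then show ?thesis by (simp add: Z_def)
qed

lemma wt_tilt:
  assumes "\<And>k. p k = w k * \<tau> ^ k / c"
  shows "wt p d = wt w d * \<tau> ^ sum_list d / c ^ length d"
  by (induction d) (simp_all add: assms power_add)

text \<open>Extends a bound along some sizes to all admissible ones. \<open>K - 1\<close> copies of
  a sequence of length \<open>m\<close> and sum \<open>m - 1\<close>, together with one entry
  \<open>K\<close>, form a block whose length and sum are both \<open>N\<close>. Appending such
  blocks preserves the difference of length and sum, so each residue class modulo \<open>N\<close>
  only needs its smallest admissible size.\<close>

lemma Z_subexponential:
  fixes p :: "nat \<Rightarrow> real"
  assumes p: "\<And>k. 0 \<le> p k" "0 < p K" "2 \<le> K"
    and inf: "\<And>s M. 1 < s \<Longrightarrow> \<exists>m\<ge>M. (1 / s) ^ m \<le> Z p m (m - 1)"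
    and s: "1 < s"
  shows "\<exists>\<kappa>>0. \<forall>n. 0 < n \<longrightarrow> 0 < Z p n (n - 1) \<longrightarrow> \<kappa> * (1 / s) ^ n \<le> Z p n (n - 1)"
proof -
  \<comment> \<open>Splits \<open>(1 / s) ^ N\<close> into two factors \<open>(1 / t) ^ N\<close>:
    one is paid by the \<open>K - 1\<close> copies, the other drops below \<open>p K\<close> and is
    paid by the entry \<open>K\<close>.\<close>
  define t where "t = sqrt s"
  have t: "1 < t" "t * t = s" using s by (auto simp: t_def)
  then have t01: "0 \<le> 1 / t" "1 / t \<le> 1" by auto
  obtain M where M: "(1 / t) ^ M < p K"
    using real_arch_pow_inv[of "p K" "1 / t"] p(2) t by auto
  obtain m where m: "m \<ge> Suc M" "(1 / t) ^ m \<le> Z p m (m - 1)" using inf[OF t(1)] by blast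
  define N where "N = 1 + (K - 1) * m"
  have N_ge: "(K - 1) * m \<le> N" "M \<le> N"
  proof -
    have "1 * m \<le> (K - 1) * m" using p(3) by (intro mult_right_mono) auto
    then show "(K - 1) * m \<le> N" "M \<le> N" using m(1) unfolding N_def by linarith+
  qed
  have N2: "N = K + (K - 1) * (m - 1)"
    using m(1) p(3) unfolding N_def by (cases m; cases K) (auto simp: algebra_simps)
  have "(1 / s) ^ N = (1 / t) ^ N * (1 / t) ^ N"
    by (simp add: t(2)[symmetric] power_mult_distrib power_divide)
  also have "\<dots> \<le> (1 / t) ^ M * (1 / t) ^ ((K - 1) * m)"
    using N_ge t01 by (intro mult_mono power_decreasing) auto
  also have "\<dots> \<le> p K * Z p m (m - 1) ^ (K - 1)"
  proof (intro mult_mono)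
    show "(1 / t) ^ ((K - 1) * m) \<le> Z p m (m - 1) ^ (K - 1)"
      unfolding mult.commute[of "K - 1"] power_mult using t01 by (intro power_mono m(2)) auto
  qed (use M p t01 in auto)
  also have "\<dots> \<le> p K * Z p ((K - 1) * m) ((K - 1) * (m - 1))"
    using p by (intro mult_left_mono Z_power_le) auto
  also have "p K = Z p 1 K" by (simp add: Z_eq_fps_nth)
  also have "Z p 1 K * Z p ((K - 1) * m) ((K - 1) * (m - 1)) \<le> Z p N N"
    using Z_mult_le[of p 1 K "(K - 1) * m" "(K - 1) * (m - 1)"] p(1) N2 by (simp add: N_def)
  finally have bN: "(1 / s) ^ N \<le> Z p N N" .
  have "N > 0" by (simp add: N_def)

  define A where "A r = {n. 0 < n \<and> 0 < Z p n (n - 1) \<and> n mod N = r}" for r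
  define l where "l r = (LEAST n. n \<in> A r)" for r
  have l: "l r \<in> A r" "\<And>n. n \<in> A r \<Longrightarrow> l r \<le> n" if "A r \<noteq> {}" for r
    using that unfolding l_def by (auto intro: LeastI Least_le)
  \<comment> \<open>The element 1 keeps the set non-empty, so that its minimum is defined even if no
    residue class is admissible.\<close>
  define R where "R = insert 1 ((\<lambda>r. Z p (l r) (l r - 1)) ` {r. r < N \<and> A r \<noteq> {}})"
  define \<kappa> where "\<kappa> = Min R"
  have R: "finite R" "R \<noteq> {}" by (auto simp: R_def)
  have pos: "0 < x" if "x \<in> R" for x
    using that l(1) unfolding R_def A_def by auto
  show ?thesis
  proof (intro exI[of _ \<kappa>] conjI allI impI)
    show "\<kappa> > 0" unfolding \<kappa>_def using R pos by (simp add: Min_gr_iff)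
    fix n assume n: "0 < n" "0 < Z p n (n - 1)"
    define r where "r = n mod N"
    have nA: "n \<in> A r" using n by (simp add: A_def r_def)
    then have ne: "A r \<noteq> {}" by blast
    have lr: "l r \<le> n" "l r mod N = r" "0 < l r" using l[OF ne] nA by (auto simp: A_def)
    have "N dvd n - l r" using lr by (metis mod_eq_dvd_iff_nat r_def)
    then obtain j where j: "n - l r = j * N" by (metis dvd_def mult.commute)
    have \<kappa>: "\<kappa> \<le> Z p (l r) (l r - 1)"
      unfolding \<kappa>_def using R(1) ne \<open>N > 0\<close> by (intro Min_le) (auto simp: R_def r_def)
    have "(1 / s) ^ n \<le> (1 / s) ^ (j * N)"
      using s j by (intro power_decreasing) auto
    also have "(1 / s) ^ (j * N) \<le> Z p N N ^ j"
      unfolding mult.commute[of j] power_mult using s by (intro power_mono bN) auto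
    finally have "(1 / s) ^ n \<le> Z p N N ^ j" .
    with \<kappa> have "\<kappa> * (1 / s) ^ n \<le> Z p (l r) (l r - 1) * Z p N N ^ j"
      using s Z_nonneg[of p] p(1) by (intro mult_mono) auto
    also have "\<dots> \<le> Z p (l r) (l r - 1) * Z p (j * N) (j * N)"
      using Z_nonneg[of p] p(1) by (intro mult_left_mono Z_power_le) auto
    also have "\<dots> \<le> Z p (l r + j * N) (l r - 1 + j * N)"
      by (intro Z_mult_le p)
    also have "\<dots> = Z p n (n - 1)" using j lr by (intro arg_cong2[where f = "Z p"]) auto
    finally show "\<kappa> * (1 / s) ^ n \<le> Z p n (n - 1)" .
  qed
qed

section \<open>Generating functions of trees\<close>

lemma nn_integral_lists_of_length:
  fixes h :: "'a \<Rightarrow> ennreal"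
  shows "(\<integral>\<^sup>+ ts. prod_list (map h ts) * indicator {ts. length ts = k} ts \<partial>count_space UNIV) =
    (\<integral>\<^sup>+ t. h t \<partial>count_space UNIV) ^ k"
proof (induction k)
  case 0
  have "(\<integral>\<^sup>+ ts. prod_list (map h ts) * indicator {ts. length ts = 0} ts \<partial>count_space UNIV) =
      (\<integral>\<^sup>+ ts. 1 * indicator {[] :: 'a list} ts \<partial>count_space UNIV)"
    by (intro nn_integral_cong) (auto simp: indicator_def)
  then show ?case by simp
next
  case (Suc k)
  let ?f = "\<lambda>ts. prod_list (map h ts) * indicator {ts. length ts = Suc k} ts"
  let ?g = "\<lambda>ts. prod_list (map h ts) * indicator {ts. length ts = k} ts"
  let ?c = "\<lambda>(t :: 'a, ts). t # ts"
  have "(\<integral>\<^sup>+ ts. ?f ts \<partial>count_space UNIV) = (\<integral>\<^sup>+ ts. ?f ts * indicator (range ?c) ts \<partial>count_space UNIV)"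
  proof (intro nn_integral_cong)
    fix ts show "?f ts = ?f ts * indicator (range ?c) ts"
      by (cases ts) (auto simp: indicator_def image_iff)
  qed
  also have "\<dots> = (\<integral>\<^sup>+ ts. ?f ts \<partial>count_space (range ?c))"
    by (subst nn_integral_count_space_indicator) auto
  also have "\<dots> = (\<integral>\<^sup>+ x. ?f (?c x) \<partial>count_space UNIV)"
    by (rule nn_integral_bij_count_space[symmetric]) (auto simp: bij_betw_def inj_on_def)
  also have "\<dots> = (\<integral>\<^sup>+ x. h (fst x) * ?g (snd x) \<partial>count_space UNIV)"
    by (intro nn_integral_cong) (auto simp: indicator_def)
  also have "\<dots> = (\<integral>\<^sup>+ t. \<integral>\<^sup>+ ts. h t * ?g ts \<partial>count_space UNIV \<partial>count_space UNIV)"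
    by (subst nn_integral_fst_count_space[symmetric]) simp
  also have "\<dots> = (\<integral>\<^sup>+ t. h t \<partial>count_space UNIV) * (\<integral>\<^sup>+ t. h t \<partial>count_space UNIV) ^ k"
    by (simp add: nn_integral_cmult nn_integral_multc Suc)
  finally show ?case by simp
qed

text \<open>Decomposition at the root. In \<open>ennreal\<close> the equation needs no convergence,
  and \<open>F\<close> may be infinite.\<close>

lemma nn_integral_ptree_eq:
  fixes g :: "nat \<Rightarrow> ennreal"
  defines "F \<equiv> (\<integral>\<^sup>+ t. prod_list (map g (code t)) \<partial>count_space UNIV)"
  shows "F = (\<Sum>k. g k * F ^ k)"
proof -
  let ?h = "\<lambda>t. prod_list (map g (code t))"
  have concat: "prod_list (map g (concat (map code ts))) = prod_list (map ?h ts)" for ts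
    by (induction ts) auto
  have "bij Node"
    unfolding bij_def inj_def surj_def by (metis ptree.exhaust ptree.inject)
  then have "F = (\<integral>\<^sup>+ ts. ?h (Node ts) \<partial>count_space UNIV)"
    unfolding F_def by (rule nn_integral_bij_count_space[symmetric])
  also have "\<dots> = (\<integral>\<^sup>+ ts. (\<Sum>k. g k * (prod_list (map ?h ts) * indicator {ts. length ts = k} ts)) \<partial>count_space UNIV)"
  proof (intro nn_integral_cong)
    fix ts :: "ptree list"
    have "(\<Sum>k. g k * (prod_list (map ?h ts) * indicator {ts. length ts = k} ts)) =
        (\<Sum>k\<in>{length ts}. g k * (prod_list (map ?h ts) * indicator {ts. length ts = k} ts))"
      by (rule suminf_finite) (auto simp: indicator_def)
    then show "?h (Node ts) = (\<Sum>k. g k * (prod_list (map ?h ts) * indicator {ts. length ts = k} ts))"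
      by (simp add: concat)
  qed
  also have "\<dots> = (\<Sum>k. g k * (\<integral>\<^sup>+ ts. prod_list (map ?h ts) * indicator {ts. length ts = k} ts \<partial>count_space UNIV))"
    by (subst nn_integral_suminf) (auto simp: nn_integral_cmult)
  also have "\<dots> = (\<Sum>k. g k * F ^ k)"
    unfolding nn_integral_lists_of_length F_def ..
  finally show ?thesis .
qed

lemma nn_integral_ptree_sizes:
  fixes f :: "ptree \<Rightarrow> ennreal"
  shows "(\<integral>\<^sup>+ t. f t \<partial>count_space UNIV) = (\<Sum>n. \<Sum>t | length (code t) = n. f t)"
proof -
  have "(\<integral>\<^sup>+ t. f t \<partial>count_space UNIV) =
      (\<integral>\<^sup>+ t. (\<Sum>n. f t * indicator {t. length (code t) = n} t) \<partial>count_space UNIV)"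
  proof (intro nn_integral_cong)
    fix t
    have "(\<Sum>n. f t * indicator {t. length (code t) = n} t) =
        (\<Sum>n\<in>{length (code t)}. f t * indicator {t. length (code t) = n} t)"
      by (rule suminf_finite) (auto simp: indicator_def)
    then show "f t = (\<Sum>n. f t * indicator {t. length (code t) = n} t)" by simp
  qed
  also have "\<dots> = (\<Sum>n. \<integral>\<^sup>+ t. f t * indicator {t. length (code t) = n} t \<partial>count_space UNIV)"
    by (subst nn_integral_suminf) auto
  also have "\<dots> = (\<Sum>n. \<integral>\<^sup>+ t. f t \<partial>count_space {t. length (code t) = n})"
    by (subst nn_integral_count_space_indicator) auto
  also have "\<dots> = (\<Sum>n. \<Sum>t | length (code t) = n. f t)"
    by (simp add: nn_integral_count_space_finite finite_size_ptree)
  finally show ?thesis .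
qed

lemma wt_ennreal:
  assumes "\<And>k. 0 \<le> p k" "0 \<le> s"
  shows "prod_list (map (\<lambda>k. ennreal (s * p k)) d) = ennreal (wt p d * s ^ length d)"
  by (induction d) (use assms in \<open>simp_all add: ennreal_mult[symmetric] wt_nonneg mult_ac\<close>)

text \<open>The summands are probabilities of disjoint events; any missing mass belongs to infinite
  trees. The bound makes the mass finite, so that the fixed-point equation becomes
  informative.\<close>

lemma nn_integral_wt_le_1:
  "(\<integral>\<^sup>+ t. ennreal (wt (pmf \<xi>) (code t)) \<partial>count_space UNIV) \<le> 1"
proof -
  interpret prob_space "bgw_space \<xi>"
    unfolding bgw_space_def by (rule prob_space_PiM) (rule measure_pmf.prob_space_axioms)
  let ?E = "\<lambda>t. {N \<in> space (bgw_space \<xi>). bgw_tree N = verts t}"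
  have "disjoint_family ?E"
    unfolding disjoint_family_on_def by (auto dest: verts_inject)
  then have "emeasure (bgw_space \<xi>) (\<Union>t. ?E t) = (\<integral>\<^sup>+ t. emeasure (bgw_space \<xi>) (?E t) \<partial>count_space UNIV)"
    by (intro emeasure_UN_countable) (auto simp: bgw_tree_verts_event(1))
  then show ?thesis
    using emeasure_le_1[of "\<Union>t. ?E t"] by (simp add: bgw_tree_verts_event(2))
qed

section \<open>Probability generating functions compared with the diagonal\<close>

lemma pmf_nat_sums: "(\<lambda>k. pmf \<xi> k) sums (1 :: real)" for \<xi> :: "nat pmf"
proof -
  have "(\<Sum>k. ennreal (pmf \<xi> k)) = 1"
    by (simp add: nn_integral_count_space_nat[symmetric] nn_integral_pmf_eq_1)
  moreover from this have "summable (\<lambda>k. pmf \<xi> k)"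
    by (intro summable_suminf_not_top) auto
  ultimately show ?thesis
    by (simp add: suminf_ennreal2 sums_iff)
qed

text \<open>The generating function lies above its tangent at 1, termwise by Bernoulli's inequality
  and strictly through the term \<open>K\<close>. Since the mean is at most 1, this tangent lies on
  or above the diagonal on [0, 1).\<close>

lemma pgf_gt:
  assumes mean: "(\<Sum>k. ennreal (real k * pmf \<xi> k)) \<le> 1"
    and K: "2 \<le> K" "0 < pmf \<xi> K" and x: "0 \<le> x" "x < 1"
  shows "ennreal x < (\<Sum>k. ennreal (pmf \<xi> k * x ^ k))"
proof -
  have s1: "(\<lambda>k. pmf \<xi> k) sums 1"
    by (rule pmf_nat_sums)
  have s2: "summable (\<lambda>k. real k * pmf \<xi> k)"
    using mean by (intro summable_suminf_not_top) (auto simp: top_unique)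
  have mu: "(\<Sum>k. real k * pmf \<xi> k) \<le> 1"
    using mean s2 by (subst (asm) suminf_ennreal2) auto
  have s3: "summable (\<lambda>k. pmf \<xi> k * x ^ k)"
    using x by (intro summable_comparison_test'[OF sums_summable[OF s1]])
      (auto simp: mult_le_one power_le_one mult_left_le)
  let ?f = "\<lambda>k. pmf \<xi> k * x ^ k - (pmf \<xi> k + (x - 1) * (real k * pmf \<xi> k))"
  have s4: "summable ?f"
    by (intro summable_diff summable_add s2 s3 sums_summable[OF s1] summable_mult)
  have f: "?f k = pmf \<xi> k * (x ^ k - (1 + real k * (x - 1)))" for k
    by (simp add: algebra_simps)
  have bern: "1 + real k * (x - 1) \<le> x ^ k" for k
    using Bernoulli_inequality[of "x - 1" k] x by simp
  have nn: "0 \<le> ?f k" for k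
    unfolding f using bern[of k] by (intro mult_nonneg_nonneg) auto
  \<comment> \<open>Strictness at \<open>K\<close>: multiplying the inequality for
    \<open>K - 1\<close> by \<open>x\<close> leaves the surplus
    \<open>real j * (1 - x)\<^sup>2\<close>.\<close>
  obtain j where j: "K = Suc j" "1 \<le> j" using K(1) by (cases K) auto
  have "1 + real K * (x - 1) < (1 + real j * (x - 1)) * x"
  proof -
    have "0 < real j * ((1 - x) * (1 - x))" using j x by (intro mult_pos_pos) auto
    then show ?thesis by (simp add: j algebra_simps)
  qed
  also have "\<dots> \<le> x ^ K"
    using mult_right_mono[OF bern[of j] x(1)] by (simp add: j mult.commute)
  finally have "0 < ?f K" unfolding f using K(2) by simp
  with s4 nn have "0 < suminf ?f" by (intro suminf_pos2)
  also have "suminf ?f = (\<Sum>k. pmf \<xi> k * x ^ k) - (1 + (x - 1) * (\<Sum>k. real k * pmf \<xi> k))"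
    using s1 s2 s3
    by (simp add: suminf_diff[symmetric] suminf_add[symmetric] suminf_mult[symmetric] sums_iff summable_mult summable_add)
  finally have "1 + (x - 1) * (\<Sum>k. real k * pmf \<xi> k) < (\<Sum>k. pmf \<xi> k * x ^ k)" by simp
  moreover have "x \<le> 1 + (x - 1) * (\<Sum>k. real k * pmf \<xi> k)"
    using mult_left_mono[OF mu, of "1 - x"] x by (simp add: algebra_simps)
  ultimately have "x < (\<Sum>k. pmf \<xi> k * x ^ k)" by simp
  then show ?thesis
    using x s3 by (subst suminf_ennreal2) (auto simp: ennreal_less_iff)
qed

text \<open>The mass of the finite trees is a fixed point of the generating function in [0, 1], and
  \<open>pgf_gt\<close> leaves only 1.\<close>

lemma nn_integral_wt_eq_1:
  assumes mean: "(\<Sum>k. ennreal (real k * pmf \<xi> k)) \<le> 1"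
    and K: "2 \<le> K" "0 < pmf \<xi> K"
  shows "(\<integral>\<^sup>+ t. ennreal (wt (pmf \<xi>) (code t)) \<partial>count_space UNIV) = 1"
proof -
  define F where "F = (\<integral>\<^sup>+ t. ennreal (wt (pmf \<xi>) (code t)) \<partial>count_space UNIV)"
  have F1: "F \<le> 1" unfolding F_def by (rule nn_integral_wt_le_1)
  then obtain x where x: "F = ennreal x" "0 \<le> x" "x \<le> 1"
    by (cases F) (auto simp: top_unique)
  have "F = (\<Sum>k. ennreal (pmf \<xi> k) * F ^ k)"
    using nn_integral_ptree_eq[of "\<lambda>k. ennreal (pmf \<xi> k)"] wt_ennreal[of "pmf \<xi>" 1]
    by (simp add: F_def)
  also have "\<dots> = (\<Sum>k. ennreal (pmf \<xi> k * x ^ k))"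
    using x by (simp add: ennreal_power ennreal_mult)
  finally have "\<not> x < 1" using pgf_gt[OF mean K x(2)] x(1) by auto
  then show ?thesis using x F_def by auto
qed

lemma nn_integral_wt_return_0:
  "(\<integral>\<^sup>+ t. ennreal (wt (pmf (return_pmf 0)) (code t)) \<partial>count_space UNIV) = 1"
proof -
  define F where "F = (\<integral>\<^sup>+ t. ennreal (wt (pmf (return_pmf 0)) (code t)) \<partial>count_space UNIV)"
  have "F = (\<Sum>k. ennreal (pmf (return_pmf 0) k) * F ^ k)"
    using nn_integral_ptree_eq[of "\<lambda>k. ennreal (pmf (return_pmf 0) k)"] wt_ennreal[of "pmf (return_pmf 0)" 1]
    by (simp add: F_def)
  also have "\<dots> = (\<Sum>k\<in>{0}. ennreal (pmf (return_pmf 0) k) * F ^ k)"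
    by (rule suminf_finite) auto
  finally show ?thesis by (simp add: F_def)
qed

text \<open>If the weights of the trees decayed exponentially, then \<open>F = s \<Phi>(F)\<close> would have a finite
  solution \<open>F > 0\<close> for some \<open>s > 1\<close>, contradicting \<open>\<Phi>(x) \<ge> x\<close>.\<close>

lemma Z_not_exponentially_small:
  assumes Phi: "\<And>x. 0 \<le> x \<Longrightarrow> ennreal x \<le> (\<Sum>k. ennreal (pmf \<xi> k * x ^ k))"
    and p0: "0 < pmf \<xi> 0" and s: "1 < s"
  shows "\<exists>m\<ge>M. (1 / s) ^ m \<le> Z (pmf \<xi>) m (m - 1)"
proof (rule ccontr)
  assume "\<not> ?thesis"
  then have small: "Z (pmf \<xi>) m (m - 1) < (1 / s) ^ m" if "m \<ge> M" for m
    using that not_le by blast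
  \<comment> \<open>Half of the assumed decay absorbs the factor \<open>t ^ n\<close>; the other
    half still makes the series converge.\<close>
  define t where "t = sqrt s"
  have t: "1 < t" "t * t = s" using s by (auto simp: t_def)
  define F where "F = (\<integral>\<^sup>+ u. prod_list (map (\<lambda>k. ennreal (t * pmf \<xi> k)) (code u)) \<partial>count_space UNIV)"
  have eq: "F = (\<Sum>k. ennreal (t * pmf \<xi> k) * F ^ k)"
    unfolding F_def by (rule nn_integral_ptree_eq)
  define a where "a n = (\<Sum>u | length (code u) = n. wt (pmf \<xi>) (code u)) * t ^ n" for n
  have a0: "0 \<le> a n" for n
    unfolding a_def using t by (intro mult_nonneg_nonneg sum_nonneg wt_nonneg) auto
  have a_le: "a n \<le> (1 / t) ^ n" if "n \<ge> Suc M" for n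
  proof -
    have "n > 0" using that by simp
    from sum_fringes_eq_sum_seqs[OF this, of "pmf \<xi>" "\<lambda>_. 1"]
    have "(\<Sum>u | length (code u) = n. wt (pmf \<xi>) (code u) * real n) = Z (pmf \<xi>) n (n - 1)"
      unfolding Z_def by (simp add: sum_list_triv length_fringes)
    then have "(\<Sum>u | length (code u) = n. wt (pmf \<xi>) (code u)) * real n = Z (pmf \<xi>) n (n - 1)"
      by (simp add: sum_distrib_right)
    moreover have "(\<Sum>u | length (code u) = n. wt (pmf \<xi>) (code u)) * 1 \<le>
        (\<Sum>u | length (code u) = n. wt (pmf \<xi>) (code u)) * real n"
      using \<open>n > 0\<close> by (intro mult_left_mono sum_nonneg wt_nonneg) auto
    ultimately have "(\<Sum>u | length (code u) = n. wt (pmf \<xi>) (code u)) \<le> (1 / s) ^ n"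
      using small[of n] that by simp
    then have "a n \<le> (1 / s) ^ n * t ^ n"
      unfolding a_def using t by (intro mult_right_mono) auto
    also have "\<dots> = (1 / t) ^ n"
      using t by (simp add: t(2)[symmetric] power_mult_distrib power_divide)
    finally show ?thesis .
  qed
  have "summable (\<lambda>n. (1 / t) ^ n)" using t by (intro summable_geometric) auto
  then have summ: "summable a"
    by (rule summable_comparison_test'[where N = "Suc M"]) (use a_le a0 in auto)
  have "F = (\<Sum>n. ennreal (a n))"
    unfolding F_def nn_integral_ptree_sizes a_def
  proof (intro suminf_cong)
    fix n
    have "(\<Sum>u | length (code u) = n. prod_list (map (\<lambda>k. ennreal (t * pmf \<xi> k)) (code u))) =
        (\<Sum>u | length (code u) = n. ennreal (wt (pmf \<xi>) (code u) * t ^ n))"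
      using t by (intro sum.cong) (auto simp: wt_ennreal)
    then show "(\<Sum>u | length (code u) = n. prod_list (map (\<lambda>k. ennreal (t * pmf \<xi> k)) (code u))) =
        ennreal ((\<Sum>u | length (code u) = n. wt (pmf \<xi>) (code u)) * t ^ n)"
      using t by (simp add: sum_distrib_right wt_nonneg)
  qed
  then have "F = ennreal (suminf a)" using summ a0 by (simp add: suminf_ennreal2)
  then obtain x where x: "F = ennreal x" "0 \<le> x" using suminf_nonneg[OF summ a0] by blast
  have "ennreal t * ennreal x \<le> ennreal t * (\<Sum>k. ennreal (pmf \<xi> k * x ^ k))"
    by (intro mult_left_mono Phi x) auto
  also have "\<dots> = F"
  proof -
    have "ennreal t * (\<Sum>k. ennreal (pmf \<xi> k * x ^ k)) = (\<Sum>k. ennreal t * ennreal (pmf \<xi> k * x ^ k))"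
      by (rule ennreal_suminf_cmult[symmetric])
    also have "\<dots> = (\<Sum>k. ennreal (t * pmf \<xi> k) * ennreal x ^ k)"
      using t x(2) by (intro suminf_cong) (simp add: ennreal_mult ennreal_power mult.assoc)
    also have "\<dots> = F" unfolding x(1)[symmetric] by (rule eq[symmetric])
    finally show ?thesis .
  qed
  finally have "t * x \<le> x" using x t by (simp add: ennreal_mult[symmetric])
  \<comment> \<open>With \<open>t > 1\<close> only \<open>F = 0\<close> is left, but then the
    constant term of the equation, \<open>t * pmf \<xi> 0 > 0\<close>, would have to vanish.\<close>
  then have "x = 0" using x t by (cases "x = 0") auto
  then have "F = 0" using x(1) by simp
  then have "(\<Sum>k. ennreal (t * pmf \<xi> k) * 0 ^ k) = 0" using eq by metis
  then have "ennreal (t * pmf \<xi> 0) * 0 ^ 0 = 0"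
    by (subst (asm) suminf_eq_zero_iff) auto
  then show False using t p0 by simp
qed

section \<open>Concentration of the degree counts in types I and II\<close>

text \<open>Expectation of a function of the degree sequence of the simply generated tree, read in preorder
  cyclically from a uniform vertex (cf. \<open>sum_fringes_eq_sum_seqs\<close>).\<close>

definition expect :: "(nat \<Rightarrow> real) \<Rightarrow> nat \<Rightarrow> (nat list \<Rightarrow> real) \<Rightarrow> real" where
  "expect w n f = (\<Sum>d\<in>seqs n (n - 1). wt w d * f d) / Z w n (n - 1)"

abbreviation probab :: "(nat \<Rightarrow> real) \<Rightarrow> nat \<Rightarrow> (nat list \<Rightarrow> bool) \<Rightarrow> real" where
  "probab w n P \<equiv> expect w n (\<lambda>d. of_bool (P d))"

lemma expect_mono:
  assumes "\<And>k. 0 \<le> w k" "\<And>d. d \<in> seqs n (n - 1) \<Longrightarrow> f d \<le> g d"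
  shows "expect w n f \<le> expect w n g"
  unfolding expect_def using assms
  by (intro divide_right_mono sum_mono mult_left_mono wt_nonneg Z_nonneg)

lemma expect_cong: "(\<And>d. d \<in> seqs n (n - 1) \<Longrightarrow> f d = g d) \<Longrightarrow> expect w n f = expect w n g"
  unfolding expect_def by simp

lemma expect_cmult: "expect w n (\<lambda>d. c * f d) = c * expect w n f"
  unfolding expect_def by (simp add: sum_distrib_left mult_ac)

lemma expect_add: "expect w n (\<lambda>d. f d + g d) = expect w n f + expect w n g"
  unfolding expect_def by (simp add: sum.distrib distrib_left add_divide_distrib)

lemma expect_diff: "expect w n (\<lambda>d. f d - g d) = expect w n f - expect w n g"
  unfolding expect_def by (simp add: sum_subtractf right_diff_distrib diff_divide_distrib)

lemma expect_sum: "expect w n (\<lambda>d. \<Sum>i\<in>I. f i d) = (\<Sum>i\<in>I. expect w n (f i))"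
  unfolding expect_def by (simp add: sum_distrib_left sum_divide_distrib) (rule sum.swap)

lemma expect_const: "0 < Z w n (n - 1) \<Longrightarrow> expect w n (\<lambda>_. c) = c"
  unfolding expect_def by (simp add: Z_def sum_distrib_right[symmetric])

lemma expect_nonneg: "(\<And>k. 0 \<le> w k) \<Longrightarrow> (\<And>d. d \<in> seqs n (n - 1) \<Longrightarrow> 0 \<le> f d) \<Longrightarrow> 0 \<le> expect w n f"
  unfolding expect_def by (intro divide_nonneg_nonneg sum_nonneg mult_nonneg_nonneg wt_nonneg Z_nonneg)

text \<open>The limiting frequencies \<open>p\<close> are a separate argument, so that they stay
  fixed while tilting changes the weights (\<open>concentrated_tilt\<close>).\<close>

definition concentrated :: "(nat \<Rightarrow> real) \<Rightarrow> (nat \<Rightarrow> real) \<Rightarrow> bool" where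
  "concentrated w p \<longleftrightarrow> (\<forall>b. \<forall>\<epsilon>>0. \<exists>C \<rho>. 0 \<le> C \<and> 0 \<le> \<rho> \<and> \<rho> < 1 \<and>
     (\<forall>n>0. 0 < Z w n (n - 1) \<longrightarrow>
        probab w n (\<lambda>d. \<epsilon> * real n < \<bar>real (count_list d b) - p b * real n\<bar>) \<le> C * \<rho> ^ n))"

text \<open>On sequences of given length and sum, tilting multiplies every weight by the same
  constant, which cancels in the quotient.\<close>

lemma expect_tilt:
  assumes "\<And>k. p k = w k * \<tau> ^ k / c" "0 < \<tau>" "0 < c"
  shows "expect p n f = expect w n f" "0 < Z p n (n - 1) \<longleftrightarrow> 0 < Z w n (n - 1)"
proof -
  define a where "a = \<tau> ^ (n - 1) / c ^ n"
  have a: "a > 0" using assms by (simp add: a_def)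
  have wt: "wt p d = a * wt w d" if "d \<in> seqs n (n - 1)" for d
    using that wt_tilt[of p w \<tau> c d] assms(1) by (simp add: seqs_def a_def)
  have Z: "Z p n (n - 1) = a * Z w n (n - 1)"
    unfolding Z_def by (simp add: wt sum_distrib_left)
  show "expect p n f = expect w n f"
    unfolding expect_def Z using a by (simp add: wt mult.assoc sum_distrib_left[symmetric])
  show "0 < Z p n (n - 1) \<longleftrightarrow> 0 < Z w n (n - 1)"
    unfolding Z using a by (simp add: zero_less_mult_iff)
qed

section \<open>Chernoff bounds for the entry counts\<close>

lemma exp_le_quadratic:
  fixes x :: real
  assumes "\<bar>x\<bar> \<le> 1"
  shows "exp x \<le> 1 + x + x\<^sup>2"
proof (cases "0 \<le> x")
  case True
  then show ?thesis using exp_bound[of x] assms by simp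
next
  case False
  define y where "y = - x"
  have y: "0 < y" using False by (simp add: y_def)
  \<comment> \<open>The product equals \<open>1 + y ^ 3\<close>.\<close>
  have "1 \<le> (1 - y + y\<^sup>2) * (1 + y)"
    using y by (simp add: algebra_simps power2_eq_square)
  also have "\<dots> \<le> (1 - y + y\<^sup>2) * exp y"
  proof (intro mult_left_mono)
    show "0 \<le> 1 - y + y\<^sup>2" using assms False by (simp add: y_def)
  qed (rule exp_ge_add_one_self)
  finally have "exp (- y) \<le> 1 - y + y\<^sup>2"
    by (simp add: exp_minus field_simps)
  then show ?thesis by (simp add: y_def)
qed

text \<open>Without the constraint on the sum, the count of \<open>b\<close> is binomial with moment
  generating function \<open>(1 + (exp \<theta> - 1) * pmf \<xi> b) ^ n\<close>.\<close>

lemma chernoff_sum: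
  fixes \<xi> :: "nat pmf"
  assumes "\<bar>\<theta>\<bar> \<le> 1"
  shows "(\<Sum>d\<in>seqs n m. wt (pmf \<xi>) d * exp (\<theta> * real (count_list d b))) \<le>
    exp ((\<theta> + \<theta>\<^sup>2) * pmf \<xi> b * real n)"
proof -
  define q where "q = (pmf \<xi>)(b := exp \<theta> * pmf \<xi> b)"
  have q0: "0 \<le> q k" for k by (simp add: q_def)
  have "(\<Sum>k\<le>j. q k) \<le> 1 + (exp \<theta> - 1) * pmf \<xi> b" for j
  proof -
    have "(\<Sum>k\<le>j. q k) \<le> (\<Sum>k\<in>insert b {..j}. q k)"
      using q0 by (intro sum_mono2) auto
    also have "\<dots> = (\<Sum>k\<in>insert b {..j}. pmf \<xi> k + (if k = b then (exp \<theta> - 1) * pmf \<xi> b else 0))"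
      by (intro sum.cong) (auto simp: q_def algebra_simps)
    also have "\<dots> = (\<Sum>k\<in>insert b {..j}. pmf \<xi> k) + (exp \<theta> - 1) * pmf \<xi> b"
      by (simp only: sum.distrib) (simp add: sum.delta)
    also have "(\<Sum>k\<in>insert b {..j}. pmf \<xi> k) \<le> 1"
      by (subst measure_measure_pmf_finite[symmetric]) auto
    finally show ?thesis by simp
  qed
  then have "Z q n m \<le> (1 + (exp \<theta> - 1) * pmf \<xi> b) ^ n"
    using q0 by (intro Z_le_power)
  also have "\<dots> \<le> exp ((\<theta> + \<theta>\<^sup>2) * pmf \<xi> b) ^ n"
  proof (intro power_mono)
    have "1 + (exp \<theta> - 1) * pmf \<xi> b \<le> 1 + (\<theta> + \<theta>\<^sup>2) * pmf \<xi> b"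
      using exp_le_quadratic[OF assms] by (intro add_left_mono mult_right_mono) auto
    also have "\<dots> \<le> exp ((\<theta> + \<theta>\<^sup>2) * pmf \<xi> b)" by (rule exp_ge_add_one_self)
    finally show "1 + (exp \<theta> - 1) * pmf \<xi> b \<le> exp ((\<theta> + \<theta>\<^sup>2) * pmf \<xi> b)" .
    have "0 \<le> (1 - pmf \<xi> b) + exp \<theta> * pmf \<xi> b"
      by (intro add_nonneg_nonneg mult_nonneg_nonneg) (auto simp: pmf_le_1)
    then show "0 \<le> 1 + (exp \<theta> - 1) * pmf \<xi> b" by (simp add: algebra_simps)
  qed
  also have "\<dots> = exp ((\<theta> + \<theta>\<^sup>2) * pmf \<xi> b * real n)"
    by (simp add: exp_of_nat_mult[symmetric] mult_ac)
  finally have "Z q n m \<le> exp ((\<theta> + \<theta>\<^sup>2) * pmf \<xi> b * real n)" .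
  moreover have "(\<Sum>d\<in>seqs n m. wt (pmf \<xi>) d * exp (\<theta> * real (count_list d b))) = Z q n m"
    unfolding q_def by (subst sum_wt_count[symmetric]) (simp add: exp_of_nat_mult[symmetric] mult.commute)
  ultimately show ?thesis by simp
qed

text \<open>\<open>\<theta> = h\<close> gives the upper tail and \<open>\<theta> = - h\<close> the
  lower one. Dividing the unconditioned Markov bound by \<open>Z\<close> is the cost of conditioning
  on the sum.\<close>

lemma chernoff_tail:
  fixes \<xi> :: "nat pmf"
  assumes h: "\<bar>\<theta>\<bar> = h" "0 \<le> h" "h \<le> 1" and n: "0 < Z (pmf \<xi>) n (n - 1)"
  shows "probab (pmf \<xi>) n (\<lambda>d. h * \<epsilon> * real n < \<theta> * (real (count_list d b) - pmf \<xi> b * real n)) \<le>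
    exp ((h\<^sup>2 - h * \<epsilon>) * real n) / Z (pmf \<xi>) n (n - 1)"
proof -
  let ?c = "exp (- (\<theta> * pmf \<xi> b + h * \<epsilon>) * real n)"
  have "probab (pmf \<xi>) n (\<lambda>d. h * \<epsilon> * real n < \<theta> * (real (count_list d b) - pmf \<xi> b * real n)) \<le>
      expect (pmf \<xi>) n (\<lambda>d. ?c * exp (\<theta> * real (count_list d b)))"
  proof (intro expect_mono)
    fix d
    show "of_bool (h * \<epsilon> * real n < \<theta> * (real (count_list d b) - pmf \<xi> b * real n)) \<le>
        ?c * exp (\<theta> * real (count_list d b))"
    proof (cases "h * \<epsilon> * real n < \<theta> * (real (count_list d b) - pmf \<xi> b * real n)")
      case True
      then have "0 \<le> - (\<theta> * pmf \<xi> b + h * \<epsilon>) * real n + \<theta> * real (count_list d b)"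
        by (simp add: algebra_simps)
      then show ?thesis using True by (simp add: exp_add[symmetric])
    qed simp
  qed auto
  also have "\<dots> = ?c * (\<Sum>d\<in>seqs n (n - 1). wt (pmf \<xi>) d * exp (\<theta> * real (count_list d b))) / Z (pmf \<xi>) n (n - 1)"
    by (simp add: expect_cmult) (simp add: expect_def)
  also have "\<dots> \<le> ?c * exp ((\<theta> + \<theta>\<^sup>2) * pmf \<xi> b * real n) / Z (pmf \<xi>) n (n - 1)"
    using h n by (intro divide_right_mono mult_left_mono chernoff_sum) auto
  also have "?c * exp ((\<theta> + \<theta>\<^sup>2) * pmf \<xi> b * real n) = exp ((h\<^sup>2 * pmf \<xi> b - h * \<epsilon>) * real n)"
  proof -
    have "\<theta>\<^sup>2 = h\<^sup>2" using h by (metis power2_abs)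
    then have "- (\<theta> * pmf \<xi> b + h * \<epsilon>) * real n + (\<theta> + \<theta>\<^sup>2) * pmf \<xi> b * real n =
        (h\<^sup>2 * pmf \<xi> b - h * \<epsilon>) * real n"
      by (simp add: algebra_simps)
    then show ?thesis by (simp only: exp_add[symmetric])
  qed
  also have "exp ((h\<^sup>2 * pmf \<xi> b - h * \<epsilon>) * real n) \<le> exp ((h\<^sup>2 - h * \<epsilon>) * real n)"
  proof -
    have "h\<^sup>2 * pmf \<xi> b \<le> h\<^sup>2 * 1" by (intro mult_left_mono) (auto simp: pmf_le_1)
    then show ?thesis by (simp add: mult_right_mono)
  qed
  finally show ?thesis using n by (simp add: divide_right_mono)
qed

lemma concentrated_pmf:
  fixes \<xi> :: "nat pmf"
  assumes Phi: "\<And>x. 0 \<le> x \<Longrightarrow> ennreal x \<le> (\<Sum>k. ennreal (pmf \<xi> k * x ^ k))"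
    and p0: "0 < pmf \<xi> 0" and K: "2 \<le> K" "0 < pmf \<xi> K"
  shows "concentrated (pmf \<xi>) (pmf \<xi>)"
  unfolding concentrated_def
proof (intro allI impI)
  fix b and \<epsilon> :: real assume \<epsilon>: "\<epsilon> > 0"
  define h where "h = min 1 (\<epsilon> / 2)"
  have h: "0 < h" "h \<le> 1" "h \<le> \<epsilon> / 2" using \<epsilon> by (auto simp: h_def)
  \<comment> \<open>\<open>h \<le> \<epsilon> / 2\<close> makes the Chernoff exponent at most
    \<open>- 2 * \<delta>\<close>. Dividing by the lower bound on \<open>Z\<close> costs
    \<open>exp \<delta> ^ n\<close>, and \<open>exp (- \<delta>) ^ n\<close> remains.\<close>
  define \<delta> where "\<delta> = h * \<epsilon> / 4"
  have \<delta>: "\<delta> > 0" using h \<epsilon> by (simp add: \<delta>_def)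
  have "h\<^sup>2 \<le> h * (\<epsilon> / 2)"
    unfolding power2_eq_square using h by (intro mult_left_mono) auto
  then have exponent: "h\<^sup>2 - h * \<epsilon> \<le> - 2 * \<delta>" by (simp add: \<delta>_def field_simps)
  obtain \<kappa> where \<kappa>: "\<kappa> > 0" "\<And>n. 0 < n \<Longrightarrow> 0 < Z (pmf \<xi>) n (n - 1) \<Longrightarrow> \<kappa> * (1 / exp \<delta>) ^ n \<le> Z (pmf \<xi>) n (n - 1)"
    using Z_subexponential[of "pmf \<xi>" K "exp \<delta>"] Z_not_exponentially_small[OF Phi p0] K \<delta> by auto
  show "\<exists>C \<rho>. 0 \<le> C \<and> 0 \<le> \<rho> \<and> \<rho> < 1 \<and> (\<forall>n>0. 0 < Z (pmf \<xi>) n (n - 1) \<longrightarrow>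
        probab (pmf \<xi>) n (\<lambda>d. \<epsilon> * real n < \<bar>real (count_list d b) - pmf \<xi> b * real n\<bar>) \<le> C * \<rho> ^ n)"
  proof (rule exI[of _ "2 / \<kappa>"], rule exI[of _ "exp (- \<delta>)"], intro conjI allI impI)
    fix n :: nat assume n: "n > 0" "0 < Z (pmf \<xi>) n (n - 1)"
    let ?P = "\<lambda>\<theta> d. h * \<epsilon> * real n < \<theta> * (real (count_list d b) - pmf \<xi> b * real n)"
    have "probab (pmf \<xi>) n (\<lambda>d. \<epsilon> * real n < \<bar>real (count_list d b) - pmf \<xi> b * real n\<bar>) \<le>
        expect (pmf \<xi>) n (\<lambda>d. of_bool (?P h d) + of_bool (?P (- h) d))"
    proof (intro expect_mono)
      fix d
      define y where "y = real (count_list d b) - pmf \<xi> b * real n"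
      have "\<epsilon> * real n < \<bar>y\<bar> \<Longrightarrow> h * (\<epsilon> * real n) < h * y \<or> h * (\<epsilon> * real n) < h * (- y)"
        using mult_strict_left_mono[of "\<epsilon> * real n" "\<bar>y\<bar>" h] h(1) by (cases "0 \<le> y") simp_all
      then show "of_bool (\<epsilon> * real n < \<bar>real (count_list d b) - pmf \<xi> b * real n\<bar>) \<le>
          of_bool (?P h d) + (of_bool (?P (- h) d) :: real)"
        unfolding y_def[symmetric] by (auto simp: mult.assoc)
    qed auto
    also have "\<dots> \<le> 2 * (exp ((h\<^sup>2 - h * \<epsilon>) * real n) / Z (pmf \<xi>) n (n - 1))"
      using chernoff_tail[of h h \<xi> n \<epsilon> b] chernoff_tail[of "- h" h \<xi> n \<epsilon> b] h n
      by (simp add: expect_add)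
    also have "\<dots> \<le> 2 * (exp (- 2 * \<delta> * real n) / (\<kappa> * (1 / exp \<delta>) ^ n))"
    proof (intro mult_left_mono frac_le)
      show "exp ((h\<^sup>2 - h * \<epsilon>) * real n) \<le> exp (- 2 * \<delta> * real n)"
        unfolding exp_le_cancel_iff using exponent by (rule mult_right_mono) simp
    qed (use \<kappa> n in auto)
    also have "\<dots> = 2 / \<kappa> * (exp (- 2 * \<delta> * real n) * exp \<delta> ^ n)"
      using \<kappa>(1) by (simp add: field_simps)
    also have "exp (- 2 * \<delta> * real n) * exp \<delta> ^ n = exp (- \<delta>) ^ n"
    proof -
      have "- 2 * \<delta> * real n + real n * \<delta> = real n * - \<delta>" by (simp add: algebra_simps)
      then show ?thesis by (simp only: exp_of_nat_mult[symmetric] exp_add[symmetric])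
    qed
    finally show "probab (pmf \<xi>) n (\<lambda>d. \<epsilon> * real n < \<bar>real (count_list d b) - pmf \<xi> b * real n\<bar>) \<le>
        2 / \<kappa> * exp (- \<delta>) ^ n" .
  qed (use \<kappa> \<delta> in auto)
qed

text \<open>The tangent at 1 again, now also to the right of 1: there it coincides with the diagonal
  for mean one, but lies below it for a smaller mean.\<close>

lemma pgf_ge:
  assumes mean: "(\<Sum>k. ennreal (real k * pmf \<xi> k)) \<le> 1"
    and "(\<Sum>k. ennreal (real k * pmf \<xi> k)) = 1 \<or> x \<le> 1" and x: "0 \<le> x"
    and summ: "summable (\<lambda>k. pmf \<xi> k * x ^ k)"
  shows "ennreal x \<le> (\<Sum>k. ennreal (pmf \<xi> k * x ^ k))"
proof -
  note s1 = pmf_nat_sums[of \<xi>]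
  have s2: "summable (\<lambda>k. real k * pmf \<xi> k)"
    using mean by (intro summable_suminf_not_top) (auto simp: top_unique)
  have eq: "(\<Sum>k. ennreal (real k * pmf \<xi> k)) = ennreal (\<Sum>k. real k * pmf \<xi> k)"
    using s2 by (intro suminf_ennreal2) auto
  have mu: "(\<Sum>k. real k * pmf \<xi> k) \<le> 1" "(\<Sum>k. real k * pmf \<xi> k) = 1 \<or> x \<le> 1"
    using mean assms(2) unfolding eq by auto
  have "x \<le> 1 + (x - 1) * (\<Sum>k. real k * pmf \<xi> k)"
    using mu(2)
  proof
    assume "x \<le> 1"
    then show ?thesis using mult_left_mono[OF mu(1), of "1 - x"] by (simp add: algebra_simps)
  qed simp
  also have "\<dots> = (\<Sum>k. pmf \<xi> k + (x - 1) * (real k * pmf \<xi> k))"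
    using s1 s2 by (simp add: suminf_add[symmetric] suminf_mult sums_iff summable_mult)
  also have "\<dots> \<le> (\<Sum>k. pmf \<xi> k * x ^ k)"
  proof (rule suminf_le)
    fix k
    have "pmf \<xi> k * (1 + real k * (x - 1)) \<le> pmf \<xi> k * x ^ k"
      using Bernoulli_inequality[of "x - 1" k] x by (intro mult_left_mono) auto
    then show "pmf \<xi> k + (x - 1) * (real k * pmf \<xi> k) \<le> pmf \<xi> k * x ^ k"
      by (simp add: algebra_simps)
  qed (use s1 s2 summ in \<open>auto intro: summable_add summable_mult simp: sums_iff\<close>)
  finally show ?thesis
    using x summ by (subst suminf_ennreal2) (auto intro: ennreal_leI)
qed

lemma tilted_by_facts:
  assumes w: "weight_sequence w" and t: "0 < t" "gen_fun w t < \<infinity>" and \<xi>: "tilted_by w t \<xi>"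
  obtains c where "0 < c" "\<And>k. pmf \<xi> k = w k * t ^ k / c"
    "(\<Sum>k. ennreal (real k * pmf \<xi> k)) = ennreal t * gen_deriv w t / gen_fun w t"
proof -
  have w0: "0 \<le> w k" for k using w by (simp add: weight_sequence_def)
  have "0 < ennreal (w 0 * t ^ 0)" using w by (simp add: weight_sequence_def)
  also have "\<dots> \<le> gen_fun w t"
    unfolding gen_fun_def using sum_le_suminf[of "\<lambda>k. ennreal (w k * t ^ k)" "{0}"] by simp
  finally obtain c where c: "gen_fun w t = ennreal c" "0 < c"
    using t(2) by (cases "gen_fun w t") auto
  have p: "pmf \<xi> k = w k * t ^ k / c" for k
  proof -
    have "ennreal (pmf \<xi> k) = ennreal (w k * t ^ k / c)"
      using \<xi> c w0 t by (simp add: tilted_by_def divide_ennreal)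
    then show ?thesis using c w0 t by (subst (asm) ennreal_inj) auto
  qed
  have "ennreal t * gen_deriv w t = (\<Sum>k. ennreal t * ennreal (real k * w k * t ^ (k - 1)))"
    unfolding gen_deriv_def by (rule ennreal_suminf_cmult[symmetric])
  also have "\<dots> = (\<Sum>k. ennreal (real k * pmf \<xi> k) * ennreal c)"
  proof (intro suminf_cong)
    fix k
    have "t * (real k * w k * t ^ (k - 1)) = real k * pmf \<xi> k * c"
      using c by (cases k) (auto simp: p)
    then show "ennreal t * ennreal (real k * w k * t ^ (k - 1)) = ennreal (real k * pmf \<xi> k) * ennreal c"
      using t c w0 by (simp add: ennreal_mult[symmetric])
  qed
  also have "\<dots> = (\<Sum>k. ennreal (real k * pmf \<xi> k)) * ennreal c"
    by (rule ennreal_suminf_multc)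
  finally have "ennreal t * gen_deriv w t / gen_fun w t = (\<Sum>k. ennreal (real k * pmf \<xi> k))"
    using c by (simp add: ennreal_mult_divide_eq)
  with that[of c] c p show ?thesis by simp
qed

lemma concentrated_tilt:
  assumes "concentrated p q" "\<And>k. p k = w k * \<tau> ^ k / c" "0 < \<tau>" "0 < c"
  shows "concentrated w q"
  using assms(1) unfolding concentrated_def expect_tilt[OF assms(2-4)] .

lemma type_I_II_limit:
  assumes w: "weight_sequence w" and ty: "type_I w t \<or> type_II w t" and \<xi>: "tilted_by w t \<xi>"
  shows "concentrated w (pmf \<xi>)"
    "(\<integral>\<^sup>+ t. ennreal (wt (pmf \<xi>) (code t)) \<partial>count_space UNIV) = 1"
    "0 < pmf \<xi> 0"
proof -
  have t: "0 < t" "gen_fun w t < \<infinity>" using ty by (auto simp: type_I_def type_II_def)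
  obtain c where c: "0 < c" "\<And>k. pmf \<xi> k = w k * t ^ k / c"
    "(\<Sum>k. ennreal (real k * pmf \<xi> k)) = ennreal t * gen_deriv w t / gen_fun w t"
    using tilted_by_facts[OF w t \<xi>] by blast
  obtain K where K: "2 \<le> K" "0 < w K" using w by (auto simp: weight_sequence_def)
  have pK: "0 < pmf \<xi> K" unfolding c(2) using K c(1) t by simp
  show p0: "0 < pmf \<xi> 0" unfolding c(2) using w c(1) by (simp add: weight_sequence_def)
  have mean: "(\<Sum>k. ennreal (real k * pmf \<xi> k)) \<le> 1"
    using ty unfolding c(3) type_I_def type_II_def
    by (elim disjE conjE) (simp only: order.refl, rule less_imp_le)
  have Phi: "ennreal x \<le> (\<Sum>k. ennreal (pmf \<xi> k * x ^ k))" if x: "0 \<le> x" for x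
  proof (cases "summable (\<lambda>k. pmf \<xi> k * x ^ k)")
    case False
    have nonneg: "0 \<le> pmf \<xi> k * x ^ k" for k using x by simp
    have "(\<Sum>k. ennreal (pmf \<xi> k * x ^ k)) = \<top>"
      using False summable_suminf_not_top[of "\<lambda>k. pmf \<xi> k * x ^ k", OF nonneg] by blast
    then show ?thesis by (simp only: top_greatest)
  next
    case True
    from ty have "(\<Sum>k. ennreal (real k * pmf \<xi> k)) = 1 \<or> x \<le> 1"
    proof
      assume "type_I w t"
      then show ?thesis by (simp add: c(3) type_I_def)
    next
      assume ty2: "type_II w t"
      \<comment> \<open>In type II the tilting is at the radius of convergence itself, so the tilted
        series cannot converge beyond 1.\<close>
      have "x \<le> 1"
      proof (rule ccontr)
        assume "\<not> x \<le> 1"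
        have "summable (\<lambda>k. c * (pmf \<xi> k * x ^ k))" using True by (rule summable_mult)
        also have "(\<lambda>k. c * (pmf \<xi> k * x ^ k)) = (\<lambda>k. w k * (t * x) ^ k)"
          using c(1) by (simp add: c(2) power_mult_distrib mult_ac)
        finally have "conv_radius w \<ge> norm (t * x)" by (rule conv_radius_geI)
        then have "t * x \<le> t" using ty2 x t by (simp add: type_II_def)
        then show False using \<open>\<not> x \<le> 1\<close> t by simp
      qed
      then show ?thesis ..
    qed
    from pgf_ge[OF mean this x True] show ?thesis .
  qed
  show "(\<integral>\<^sup>+ t. ennreal (wt (pmf \<xi>) (code t)) \<partial>count_space UNIV) = 1"
    by (rule nn_integral_wt_eq_1[OF mean K(1) pK])
  show "concentrated w (pmf \<xi>)"
    by (rule concentrated_tilt[OF concentrated_pmf[OF Phi p0 K(1) pK] c(2) t(1) c(1)])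
qed

section \<open>Concentration of the degree counts in type III\<close>

text \<open>Otherwise comparison with a geometric series would give convergence at
  \<open>1 / (2 * B)\<close>.\<close>

lemma conv_radius_0_large:
  fixes w :: "nat \<Rightarrow> real"
  assumes w: "\<And>k. 0 \<le> w k" "conv_radius w = 0" and B: "1 \<le> B"
  shows "\<exists>L\<ge>N. B ^ L \<le> w L"
proof (rule ccontr)
  assume "\<not> ?thesis"
  then have less: "w L < B ^ L" if "L \<ge> N" for L using that not_le by blast
  have "summable (\<lambda>L. w L * (1 / (2 * B)) ^ L)"
  proof (rule summable_comparison_test'[where N = N and g = "\<lambda>L. (1 / 2) ^ L"])
    fix L assume "N \<le> L"
    then have "w L * (1 / (2 * B)) ^ L \<le> B ^ L * (1 / (2 * B)) ^ L"
      using less[of L] B by (intro mult_right_mono) auto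
    also have "\<dots> = (1 / 2) ^ L"
      using B by (simp add: power_mult_distrib[symmetric])
    finally show "norm (w L * (1 / (2 * B)) ^ L) \<le> (1 / 2) ^ L"
      using w(1) B by simp
  qed (simp add: summable_geometric)
  from conv_radius_geI[OF this] have "ereal (1 / (2 * B)) \<le> 0" using w(2) B by simp
  then show False using B by (simp add: zero_ereal_def)
qed

text \<open>The additional weight \<open>(x - 1) * w k\<close> is treated as that of a second,
  marked kind of entry \<open>k\<close>; the binomial theorem for power series then sorts by the
  number \<open>j\<close> of marked entries.\<close>

lemma Z_expand:
  "Z (w(k := x * w k)) n m =
    (\<Sum>j\<le>n. real (n choose j) * (if j * k \<le> m then ((x - 1) * w k) ^ j * Z w (n - j) (m - j * k) else 0))"
proof -
  let ?M = "(x - 1) * w k"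
  have "Abs_fps (w(k := x * w k)) = fps_const ?M * fps_X ^ k + Abs_fps w"
    by (rule fps_ext) (auto simp: fps_X_power_nth algebra_simps)
  then have "Z (w(k := x * w k)) n m = fps_nth ((fps_const ?M * fps_X ^ k + Abs_fps w) ^ n) m"
    by (simp add: Z_eq_fps_nth)
  also have "\<dots> = (\<Sum>j\<le>n. fps_nth (of_nat (n choose j) * (fps_const ?M * fps_X ^ k) ^ j * Abs_fps w ^ (n - j)) m)"
    by (simp add: binomial_ring fps_sum_nth)
  also have "\<dots> = (\<Sum>j\<le>n. real (n choose j) * (if j * k \<le> m then ?M ^ j * Z w (n - j) (m - j * k) else 0))"
  proof (intro sum.cong refl)
    fix j
    have "of_nat (n choose j) * (fps_const ?M * fps_X ^ k) ^ j * Abs_fps w ^ (n - j) =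
        fps_const (real (n choose j) * ?M ^ j) * (fps_X ^ (j * k) * Abs_fps w ^ (n - j))"
      by (simp add: power_mult_distrib fps_const_power fps_of_nat[symmetric] fps_const_mult[symmetric]
          power_mult[symmetric] mult_ac del: fps_const_mult)
    then show "fps_nth (of_nat (n choose j) * (fps_const ?M * fps_X ^ k) ^ j * Abs_fps w ^ (n - j)) m =
        real (n choose j) * (if j * k \<le> m then ?M ^ j * Z w (n - j) (m - j * k) else 0)"
      by (simp only: fps_mult_left_const_nth fps_X_power_mult_nth Z_eq_fps_nth) auto
  qed
  finally show ?thesis .
qed

text \<open>Since the weights grow superexponentially, some \<open>w L\<close> is so large that \<open>L\<close> entries \<open>k\<close>, each
  given the weight \<open>M\<close>, together weigh less than \<open>k\<close> entries \<open>L\<close> and \<open>L - k\<close> zeros.\<close>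

lemma Z_replace_entries:
  fixes w :: "nat \<Rightarrow> real"
  assumes w: "\<And>k. 0 \<le> w k" "0 < w 0" "conv_radius w = 0"
    and k: "1 \<le> k" "0 < w k" and M: "0 \<le> M"
  shows "\<exists>C\<ge>0. \<forall>i j m. j * k \<le> m \<longrightarrow> M ^ j * Z w i (m - j * k) \<le> C * Z w (i + j) m"
proof -
  \<comment> \<open>\<open>a \<le> 1\<close> allows \<open>a ^ L\<close> to be replaced by
    \<open>a ^ (L - k)\<close>, as only \<open>L - k\<close> zeros are available, and
    \<open>B \<ge> 1\<close> allows \<open>B ^ L\<close> to be raised to
    \<open>B ^ (L * k)\<close>.\<close>
  define a where "a = min 1 (w 0)"
  have a: "0 < a" "a \<le> 1" "a \<le> w 0" using w(2) by (auto simp: a_def)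
  define B where "B = max 1 (M / a)"
  have B: "1 \<le> B" "M \<le> B * a" using a(1) by (auto simp: B_def max_def field_simps)
  obtain L where L: "k \<le> L" "B ^ L \<le> w L" using conv_radius_0_large[OF w(1,3) B(1)] by blast
  have L0: "0 < L" using L k by simp
  have pow_L: "M ^ L \<le> Z w L (L * k)"
  proof -
    have "M ^ L \<le> (B * a) ^ L" using M B by (intro power_mono) auto
    also have "\<dots> = B ^ (L * 1) * a ^ L" by (simp add: power_mult_distrib)
    also have "\<dots> \<le> B ^ (L * k) * w 0 ^ (L - k)"
    proof (intro mult_mono power_increasing)
      have "a ^ L \<le> a ^ (L - k)" using a by (intro power_decreasing) auto
      also have "\<dots> \<le> w 0 ^ (L - k)" using a by (intro power_mono) auto
      finally show "a ^ L \<le> w 0 ^ (L - k)" .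
    qed (use B a k in auto)
    also have "\<dots> \<le> w L ^ k * w 0 ^ (L - k)"
      unfolding power_mult using L(2) B w(2) by (intro mult_right_mono power_mono) auto
    also have "\<dots> = Z w 1 L ^ k * Z w 1 0 ^ (L - k)" by (simp add: Z_eq_fps_nth)
    also have "\<dots> \<le> Z w (k * 1) (k * L) * Z w ((L - k) * 1) ((L - k) * 0)"
      by (intro mult_mono Z_power_le) (auto simp: Z_nonneg w(1))
    also have "\<dots> \<le> Z w (k * 1 + (L - k) * 1) (k * L + (L - k) * 0)" by (intro Z_mult_le w(1))
    also have "\<dots> = Z w L (L * k)" using L by (simp add: mult.commute)
    finally show ?thesis .
  qed
  \<comment> \<open>Groups of \<open>L\<close> entries are exchanged; the fewer than
    \<open>L\<close> left over stay equal to \<open>k\<close>, which costs at most the constant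
    \<open>D ^ L\<close>.\<close>
  define D where "D = max 1 (M / w k)"
  have D: "1 \<le> D" "M \<le> D * w k" using k(2) by (auto simp: D_def max_def field_simps)
  show ?thesis
  proof (intro exI[of _ "D ^ L"] conjI allI impI)
    show "0 \<le> D ^ L" using D by simp
    fix i j m assume jm: "j * k \<le> m"
    define q r where "q = j div L" and "r = j mod L"
    have j: "j = q * L + r" by (simp add: q_def r_def)
    have "M ^ j * Z w i (m - j * k) = (M ^ L) ^ q * M ^ r * Z w i (m - j * k)"
      by (simp add: j power_add power_mult[symmetric] mult.commute)
    also have "\<dots> \<le> Z w L (L * k) ^ q * (D ^ L * Z w r (r * k)) * Z w i (m - j * k)"
    proof (intro mult_mono power_mono pow_L)
      have "M ^ r \<le> (D * w k) ^ r" using M D by (intro power_mono) auto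
      also have "\<dots> = D ^ r * Z w 1 k ^ r" by (simp add: power_mult_distrib Z_eq_fps_nth)
      also have "\<dots> \<le> D ^ L * Z w (r * 1) (r * k)"
        using D L0 w(1) by (intro mult_mono power_increasing Z_power_le) (auto simp: r_def Z_nonneg less_imp_le)
      finally show "M ^ r \<le> D ^ L * Z w r (r * k)" by simp
    qed (use M D w in \<open>auto simp: Z_nonneg\<close>)
    also have "\<dots> \<le> D ^ L * (Z w (q * L) (q * (L * k)) * Z w r (r * k) * Z w i (m - j * k))"
    proof -
      have "Z w L (L * k) ^ q * (Z w r (r * k) * Z w i (m - j * k)) \<le>
          Z w (q * L) (q * (L * k)) * (Z w r (r * k) * Z w i (m - j * k))"
        by (intro mult_right_mono Z_power_le w(1)) (simp add: Z_nonneg w(1))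
      from mult_left_mono[OF this, of "D ^ L"] D show ?thesis by (simp add: mult_ac)
    qed
    also have "\<dots> \<le> D ^ L * Z w (q * L + r + i) (q * (L * k) + r * k + (m - j * k))"
    proof (intro mult_left_mono)
      have "Z w (q * L) (q * (L * k)) * Z w r (r * k) * Z w i (m - j * k) \<le>
          Z w (q * L + r) (q * (L * k) + r * k) * Z w i (m - j * k)"
        by (intro mult_right_mono Z_mult_le w(1)) (simp add: Z_nonneg w(1))
      also have "\<dots> \<le> Z w (q * L + r + i) (q * (L * k) + r * k + (m - j * k))"
        by (intro Z_mult_le w(1))
      finally show "Z w (q * L) (q * (L * k)) * Z w r (r * k) * Z w i (m - j * k) \<le>
        Z w (q * L + r + i) (q * (L * k) + r * k + (m - j * k))" .
    qed (use D in auto)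
    also have "q * L + r + i = i + j" by (simp add: j)
    also have "q * (L * k) + r * k + (m - j * k) = m"
    proof -
      have "q * (L * k) + r * k = j * k" by (simp add: j algebra_simps)
      then show ?thesis using jm by simp
    qed
    finally show "M ^ j * Z w i (m - j * k) \<le> D ^ L * Z w (i + j) m" .
  qed
qed

text \<open>The base 2 comes from summing binomial coefficients and is independent of
  \<open>x\<close>, while \<open>C\<close> may depend on \<open>x\<close>. This lets
  \<open>x\<close> be chosen afterwards to beat the exponential loss.\<close>

lemma Z_upd_le:
  fixes w :: "nat \<Rightarrow> real"
  assumes w: "\<And>k. 0 \<le> w k" "0 < w 0" "conv_radius w = 0" and k: "1 \<le> k" and x: "1 \<le> x"
  shows "\<exists>C\<ge>0. \<forall>n m. Z (w(k := x * w k)) n m \<le> C * 2 ^ n * Z w n m"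
proof (cases "w k = 0")
  case True
  then have "w(k := x * w k) = w" by auto
  moreover have "Z w n m \<le> 1 * 2 ^ n * Z w n m" for n m
    using mult_right_mono[of 1 "2 ^ n :: real" "Z w n m"] Z_nonneg[of w, OF w(1)] by simp
  ultimately show ?thesis by (metis zero_le_one)
next
  case False
  then have wk: "0 < w k" using w(1)[of k] by simp
  obtain C where C: "C \<ge> 0"
    "\<And>i j m. j * k \<le> m \<Longrightarrow> ((x - 1) * w k) ^ j * Z w i (m - j * k) \<le> C * Z w (i + j) m"
    using Z_replace_entries[OF w k wk, of "(x - 1) * w k"] x wk by auto
  show ?thesis
  proof (intro exI[of _ C] conjI allI C)
    fix n m
    have "Z (w(k := x * w k)) n m \<le> (\<Sum>j\<le>n. real (n choose j) * (C * Z w n m))"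
      unfolding Z_expand
    proof (intro sum_mono mult_left_mono)
      fix j assume "j \<in> {..n}"
      then show "(if j * k \<le> m then ((x - 1) * w k) ^ j * Z w (n - j) (m - j * k) else 0) \<le> C * Z w n m"
        using C(2)[of j m "n - j"] C(1) Z_nonneg[of w, OF w(1)] by simp
    qed simp
    also have "\<dots> = (\<Sum>j\<le>n. real (n choose j)) * (C * Z w n m)"
      by (simp add: sum_distrib_right)
    also have "(\<Sum>j\<le>n. real (n choose j)) = 2 ^ n"
      using choose_row_sum[of n] by (metis of_nat_sum of_nat_power of_nat_numeral)
    also have "2 ^ n * (C * Z w n m) = C * 2 ^ n * Z w n m" by simp
    finally show "Z (w(k := x * w k)) n m \<le> C * 2 ^ n * Z w n m" .
  qed
qed

lemma positive_entries_rare: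
  fixes w :: "nat \<Rightarrow> real"
  assumes w: "\<And>k. 0 \<le> w k" "0 < w 0" "conv_radius w = 0" and k: "1 \<le> k" and \<epsilon>: "0 < \<epsilon>"
  shows "\<exists>C\<ge>0. \<forall>n. 0 < Z w n (n - 1) \<longrightarrow>
    probab w n (\<lambda>d. \<epsilon> * real n < real (count_list d k)) \<le> C * (1 / 2) ^ n"
proof -
  \<comment> \<open>Markov's inequality for \<open>x ^ count_list d k\<close> must beat the factor
    \<open>2 ^ n\<close> of \<open>Z_upd_le\<close>; this choice makes
    \<open>x powr (\<epsilon> * n)\<close> equal to \<open>4 ^ n\<close>.\<close>
  define x :: real where "x = 4 powr (1 / \<epsilon>)"
  have x: "1 \<le> x" unfolding x_def using \<epsilon> by (intro ge_one_powr_ge_zero) auto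
  obtain C where C: "C \<ge> 0" "\<And>n m. Z (w(k := x * w k)) n m \<le> C * 2 ^ n * Z w n m"
    using Z_upd_le[OF w k x] by blast
  show ?thesis
  proof (intro exI[of _ C] conjI allI impI C)
    fix n assume n: "0 < Z w n (n - 1)"
    have "probab w n (\<lambda>d. \<epsilon> * real n < real (count_list d k)) \<le>
        expect w n (\<lambda>d. (1 / 4) ^ n * x ^ count_list d k)"
    proof (intro expect_mono w(1))
      fix d
      show "of_bool (\<epsilon> * real n < real (count_list d k)) \<le> (1 / 4) ^ n * x ^ count_list d k"
      proof (cases "\<epsilon> * real n < real (count_list d k)")
        case True
        have "(4 :: real) ^ n = x powr (\<epsilon> * real n)"
          using \<epsilon> by (simp add: x_def powr_powr powr_realpow)
        also have "\<dots> \<le> x powr real (count_list d k)"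
          using True x by (intro powr_mono) auto
        also have "\<dots> = x ^ count_list d k" using x by (simp add: powr_realpow)
        finally show ?thesis by (simp add: power_divide field_simps True)
      qed (use x in simp)
    qed
    also have "\<dots> = (1 / 4) ^ n * (Z (w(k := x * w k)) n (n - 1) / Z w n (n - 1))"
      by (simp add: expect_cmult) (simp add: expect_def sum_wt_count)
    also have "\<dots> \<le> (1 / 4) ^ n * (C * 2 ^ n)"
      using C(2)[of n "n - 1"] n by (intro mult_left_mono) (auto simp: pos_divide_le_eq)
    also have "\<dots> = C * ((1 / 4) ^ n * 2 ^ n)" by simp
    also have "(1 / 4) ^ n * 2 ^ n = (1 / 2 :: real) ^ n"
      by (simp add: power_mult_distrib[symmetric])
    finally show "probab w n (\<lambda>d. \<epsilon> * real n < real (count_list d k)) \<le> C * (1 / 2) ^ n" .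
  qed
qed

text \<open>Each entry above \<open>K\<close> uses up at least \<open>K\<close> of the sum, so such
  entries are few; multiplying by \<open>K\<close> avoids a division.\<close>

lemma length_le_counts:
  "K * length d \<le> K * (count_list d 0 + (\<Sum>b\<in>{1..K}. count_list d b)) + sum_list d"
proof (induction d)
  case (Cons a d)
  have "(\<Sum>b\<in>{1..K}. count_list (a # d) b) = (\<Sum>b\<in>{1..K}. count_list d b + (if b = a then 1 else 0))"
    by (intro sum.cong) auto
  also have "\<dots> = (\<Sum>b\<in>{1..K}. count_list d b) + (if a \<in> {1..K} then 1 else 0)"
    by (simp add: sum.distrib)
  finally have sum: "(\<Sum>b\<in>{1..K}. count_list (a # d) b) =
      (\<Sum>b\<in>{1..K}. count_list d b) + (if a \<in> {1..K} then 1 else 0)" .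
  consider "a = 0" | "a \<in> {1..K}" | "K < a" by fastforce
  then show ?case
    unfolding sum using Cons by cases (auto simp: algebra_simps)
qed simp

lemma type_III_limit:
  assumes w: "weight_sequence w" and III: "type_III w"
  shows "concentrated w (pmf (return_pmf 0))"
  unfolding concentrated_def
proof (intro allI impI)
  fix b and \<epsilon> :: real assume \<epsilon>: "\<epsilon> > 0"
  have w': "\<And>k. 0 \<le> w k" "0 < w 0" "conv_radius w = 0"
    using w III by (auto simp: weight_sequence_def type_III_def)
  let ?p = "pmf (return_pmf 0 :: nat pmf)"
  show "\<exists>C \<rho>. 0 \<le> C \<and> 0 \<le> \<rho> \<and> \<rho> < 1 \<and> (\<forall>n>0. 0 < Z w n (n - 1) \<longrightarrow>
        probab w n (\<lambda>d. \<epsilon> * real n < \<bar>real (count_list d b) - ?p b * real n\<bar>) \<le> C * \<rho> ^ n)"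
  proof (cases "b = 0")
    case False
    then obtain C where "C \<ge> 0" "\<And>n. 0 < Z w n (n - 1) \<Longrightarrow>
        probab w n (\<lambda>d. \<epsilon> * real n < real (count_list d b)) \<le> C * (1 / 2) ^ n"
      using positive_entries_rare[OF w' _ \<epsilon>, of b] by auto
    then show ?thesis using False by (intro exI[of _ C] exI[of _ "1 / 2"]) auto
  next
    case True
    \<comment> \<open>Since the sum is below \<open>n\<close>, at most
      \<open>n / K \<le> \<epsilon> * n / 2\<close> entries exceed \<open>K\<close>. Allowing
      \<open>\<epsilon>' * n\<close> entries for each value from 1 to \<open>K\<close> spends the
      other half.\<close>
    define K where "K = nat \<lceil>2 / \<epsilon>\<rceil>"
    have "2 / \<epsilon> \<le> real K" unfolding K_def by (rule real_nat_ceiling_ge)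
    then have K: "2 \<le> \<epsilon> * real K" using \<epsilon> by (simp add: field_simps)
    then have K0: "0 < K" by (cases K) auto
    define \<epsilon>' where "\<epsilon>' = \<epsilon> / (2 * real K)"
    have \<epsilon>': "0 < \<epsilon>'" using \<epsilon> K0 by (simp add: \<epsilon>'_def)
    have "\<forall>k\<in>{1..K}. \<exists>C\<ge>0. \<forall>n. 0 < Z w n (n - 1) \<longrightarrow>
        probab w n (\<lambda>d. \<epsilon>' * real n < real (count_list d k)) \<le> C * (1 / 2) ^ n"
      using positive_entries_rare[OF w' _ \<epsilon>'] by auto
    then obtain C where C: "\<And>k. k \<in> {1..K} \<Longrightarrow> C k \<ge> 0" "\<And>k n. k \<in> {1..K} \<Longrightarrow> 0 < Z w n (n - 1) \<Longrightarrow>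
        probab w n (\<lambda>d. \<epsilon>' * real n < real (count_list d k)) \<le> C k * (1 / 2) ^ n"
      by metis
    show ?thesis
    proof (rule exI[of _ "\<Sum>k\<in>{1..K}. C k"], rule exI[of _ "1 / 2"], intro conjI allI impI)
      fix n :: nat assume n: "0 < n" "0 < Z w n (n - 1)"
      have "probab w n (\<lambda>d. \<epsilon> * real n < \<bar>real (count_list d b) - ?p b * real n\<bar>) \<le>
          expect w n (\<lambda>d. \<Sum>k\<in>{1..K}. of_bool (\<epsilon>' * real n < real (count_list d k)))"
      proof (intro expect_mono w'(1))
        fix d assume d: "d \<in> seqs n (n - 1)"
        show "of_bool (\<epsilon> * real n < \<bar>real (count_list d b) - ?p b * real n\<bar>) \<le>
          (\<Sum>k\<in>{1..K}. of_bool (\<epsilon>' * real n < real (count_list d k)) :: real)"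
        proof (cases "\<exists>k\<in>{1..K}. \<epsilon>' * real n < real (count_list d k)")
          case True
          then obtain k where k: "k \<in> {1..K}" "\<epsilon>' * real n < real (count_list d k)" ..
          have "of_bool (\<epsilon> * real n < \<bar>real (count_list d b) - ?p b * real n\<bar>) \<le>
              (of_bool (\<epsilon>' * real n < real (count_list d k)) :: real)" using k(2) by simp
          also have "\<dots> \<le> (\<Sum>k\<in>{1..K}. of_bool (\<epsilon>' * real n < real (count_list d k)))"
            using k(1) by (intro member_le_sum) auto
          finally show ?thesis .
        next
          case F: False
          have "(\<Sum>k\<in>{1..K}. real (count_list d k)) \<le> (\<Sum>k\<in>{1..K}. \<epsilon>' * real n)"
            using F by (intro sum_mono) (auto simp: not_less)
          also have "\<dots> = \<epsilon> / 2 * real n" using K0 by (simp add: \<epsilon>'_def)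
          finally have small: "(\<Sum>k\<in>{1..K}. real (count_list d k)) \<le> \<epsilon> / 2 * real n" .
          have "real K * real n \<le> real K * (real (count_list d 0) + (\<Sum>k\<in>{1..K}. real (count_list d k))) + real n"
          proof -
            have "K * n \<le> K * (count_list d 0 + (\<Sum>k\<in>{1..K}. count_list d k)) + n"
              using length_le_counts[of K d] d by (auto simp: seqs_def)
            then have "real (K * n) \<le> real (K * (count_list d 0 + (\<Sum>k\<in>{1..K}. count_list d k)) + n)"
              by (simp only: of_nat_le_iff)
            then show ?thesis by simp
          qed
          also have "\<dots> \<le> real K * (real (count_list d 0) + \<epsilon> / 2 * real n) + real K * (\<epsilon> / 2 * real n)"
          proof (intro add_mono mult_left_mono add_left_mono small)
            have "1 * real n \<le> (\<epsilon> / 2 * real K) * real n" using K by (intro mult_right_mono) auto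
            then show "real n \<le> real K * (\<epsilon> / 2 * real n)" by (simp add: mult_ac)
          qed simp_all
          finally have "real K * real n \<le> real K * (real (count_list d 0) + \<epsilon> * real n)"
            by (simp add: algebra_simps)
          then have "real n \<le> real (count_list d 0) + \<epsilon> * real n" using K0 by simp
          moreover have "count_list d 0 \<le> n" using count_le_length[of d 0] d by (simp add: seqs_def)
          ultimately show ?thesis using True by (simp add: sum_nonneg)
        qed
      qed
      also have "\<dots> \<le> (\<Sum>k\<in>{1..K}. C k * (1 / 2) ^ n)"
        unfolding expect_sum using C(2) n by (intro sum_mono) auto
      finally show "probab w n (\<lambda>d. \<epsilon> * real n < \<bar>real (count_list d b) - ?p b * real n\<bar>) \<le>
          (\<Sum>k\<in>{1..K}. C k) * (1 / 2) ^ n" by (simp add: sum_distrib_right)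
    qed (use C(1) in \<open>auto intro: sum_nonneg\<close>)
  qed
qed

section \<open>Exchangeability of the degree sequence\<close>

text \<open>Exchanging positions \<open>k\<close> and \<open>i\<close> changes neither the first
  \<open>k\<close> entries nor the multiset. Letting \<open>G\<close> see the multiset permits
  restricting to sequences with prescribed entry counts.\<close>

lemma expect_swap:
  assumes i: "k \<le> i" "i < n"
  shows "expect w n (\<lambda>d. G (take k d) (mset d) * f (d ! k)) =
    expect w n (\<lambda>d. G (take k d) (mset d) * f (d ! i))"
proof -
  define s :: "nat list \<Rightarrow> nat list" where "s d = d[k := d ! i, i := d ! k]" for d
  have len: "length (s d) = length d" for d by (simp add: s_def)
  have mset: "mset (s d) = mset d" if "length d = n" for d
    unfolding s_def using i that by (intro mset_swap) auto
  have seqs: "s d \<in> seqs n m" if "d \<in> seqs n m" for d m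
    using that mset[of d] len[of d] by (auto simp: seqs_def sum_mset_sum_list[symmetric] simp del: sum_mset_sum_list)
  have inv: "s (s d) = d" if "length d = n" for d
    by (rule nth_equalityI) (use i that in \<open>auto simp: s_def nth_list_update\<close>)
  have take: "take k (s d) = take k d" for d
    using i by (simp add: s_def)
  have nth: "s d ! i = d ! k" if "length d = n" for d
    using i that by (simp add: s_def)
  have "(\<Sum>d\<in>seqs n (n - 1). wt w d * (G (take k d) (mset d) * f (d ! k))) =
      (\<Sum>d\<in>seqs n (n - 1). wt w d * (G (take k d) (mset d) * f (d ! i)))"
  proof (rule sum.reindex_bij_witness[where i = s and j = s])
    fix d assume d: "d \<in> seqs n (n - 1)"
    then have l: "length d = n" by (simp add: seqs_def)
    show "s (s d) = d" "s (s d) = d" using l by (simp_all add: inv)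
    show "s d \<in> seqs n (n - 1)" "s d \<in> seqs n (n - 1)" using d by (simp_all add: seqs)
    show "wt w (s d) * (G (take k (s d)) (mset (s d)) * f (s d ! i)) =
        wt w d * (G (take k d) (mset d) * f (d ! k))"
      using mset[OF l] take[of d] nth[OF l] wt_mset[OF mset[OF l], of w] by simp
  qed
  then show ?thesis by (simp add: expect_def)
qed

text \<open>Sampling without replacement: given the prefix and the multiset, the next entry is a
  uniform draw from the \<open>n - k\<close> remaining ones.\<close>

lemma expect_nth_average:
  assumes k: "k < n"
  shows "real (n - k) * expect w n (\<lambda>d. G (take k d) (mset d) * f (d ! k)) =
    expect w n (\<lambda>d. G (take k d) (mset d) * (\<Sum>i\<in>{k..<n}. f (d ! i)))"
proof -
  have "expect w n (\<lambda>d. G (take k d) (mset d) * (\<Sum>i\<in>{k..<n}. f (d ! i))) =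
      (\<Sum>i\<in>{k..<n}. expect w n (\<lambda>d. G (take k d) (mset d) * f (d ! i)))"
    by (simp add: sum_distrib_left expect_sum)
  also have "\<dots> = (\<Sum>i\<in>{k..<n}. expect w n (\<lambda>d. G (take k d) (mset d) * f (d ! k)))"
    by (intro sum.cong refl expect_swap[symmetric]) auto
  finally show ?thesis by simp
qed

section \<open>Prefix probabilities and their limits\<close>

lemma count_list_eq_sum: "real (count_list d b) = (\<Sum>i<length d. of_bool (d ! i = b))"
  by (induction d) (simp_all add: sum.lessThan_Suc_shift del: sum_of_bool_eq sum.lessThan_Suc)

lemma probab_le_1: "(\<And>k. 0 \<le> w k) \<Longrightarrow> 0 < Z w n (n - 1) \<Longrightarrow> probab w n P \<le> 1"
  using expect_mono[of w n "\<lambda>d. of_bool (P d)" "\<lambda>_. 1"] by (simp add: expect_const)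

lemma expect_abs_le:
  assumes "\<And>k. 0 \<le> w k" "\<And>d. d \<in> seqs n (n - 1) \<Longrightarrow> \<bar>f d\<bar> \<le> g d"
  shows "\<bar>expect w n f\<bar> \<le> expect w n g"
proof -
  have "expect w n f \<le> expect w n g" "expect w n (\<lambda>d. (-1) * f d) \<le> expect w n g"
    using assms by (intro expect_mono; fastforce)+
  then show ?thesis unfolding expect_cmult by simp
qed

text \<open>The term \<open>2 * real (length a) / real n\<close> pays once for entries
  \<open>b\<close> inside the prefix and once for replacing \<open>n - length a\<close> by
  \<open>n\<close>. Where the count of \<open>b\<close> is not within \<open>\<epsilon> * n\<close>
  of its target, the deviation is bounded crudely by \<open>(1 + p b) * n\<close>.\<close>

lemma prefix_step:
  fixes w p :: "nat \<Rightarrow> real"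
  defines "A n a \<equiv> probab w n (\<lambda>d. take (length a) d = a)"
  assumes w: "\<And>k. 0 \<le> w k" and p: "0 \<le> p b" and n: "length a < n" "0 < Z w n (n - 1)" and \<epsilon>: "0 < \<epsilon>"
  shows "\<bar>A n (a @ [b]) - p b * A n a\<bar> \<le> 2 * real (length a) / real n + \<epsilon> +
    (1 + p b) * probab w n (\<lambda>d. \<epsilon> * real n < \<bar>real (count_list d b) - p b * real n\<bar>)"
proof -
  let ?k = "length a"
  let ?bad = "\<lambda>d. \<epsilon> * real n < \<bar>real (count_list d b) - p b * real n\<bar>"
  let ?S = "\<lambda>d. \<Sum>i\<in>{?k..<n}. of_bool (d ! i = b) :: real"
  have B: "A n (a @ [b]) = expect w n (\<lambda>d. of_bool (take ?k d = a) * of_bool (d ! ?k = b))"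
    unfolding A_def
  proof (intro expect_cong)
    fix d assume "d \<in> seqs n (n - 1)"
    then have "?k < length d" using n by (simp add: seqs_def)
    then show "of_bool (take (length (a @ [b])) d = a @ [b]) =
        (of_bool (take ?k d = a) * of_bool (d ! ?k = b) :: real)"
      by (simp add: take_Suc_conv_app_nth)
  qed
  have "real (n - ?k) * A n (a @ [b]) = expect w n (\<lambda>d. of_bool (take ?k d = a) * ?S d)"
    unfolding B using expect_nth_average[OF n(1), of w "\<lambda>u _. of_bool (u = a)" "\<lambda>x. of_bool (x = b)"] by simp
  then have diff: "real (n - ?k) * A n (a @ [b]) - p b * real n * A n a =
      expect w n (\<lambda>d. of_bool (take ?k d = a) * ?S d - (p b * real n) * of_bool (take ?k d = a))"
    by (simp add: expect_diff expect_cmult A_def)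
  have "\<bar>real (n - ?k) * A n (a @ [b]) - p b * real n * A n a\<bar> \<le>
      expect w n (\<lambda>d. (real ?k + \<epsilon> * real n) + ((1 + p b) * real n) * of_bool (?bad d))"
    unfolding diff
  proof (intro expect_abs_le w)
    fix d assume "d \<in> seqs n (n - 1)"
    then have l: "length d = n" by (simp add: seqs_def)
    have split: "real (count_list d b) = (\<Sum>i<?k. of_bool (d ! i = b)) + ?S d"
      unfolding count_list_eq_sum l using n(1)
      using sum.atLeastLessThan_concat[of 0 ?k n "\<lambda>i. of_bool (d ! i = b) :: real"]
      by (simp add: atLeast0LessThan del: sum_of_bool_eq)
    have "(\<Sum>i<?k. of_bool (d ! i = b)) \<le> (\<Sum>i<?k. 1 :: real)" by (intro sum_mono) auto
    then have first: "(\<Sum>i<?k. of_bool (d ! i = b)) \<le> real ?k" by simp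
    have first0: "0 \<le> (\<Sum>i<?k. of_bool (d ! i = b) :: real)" by (intro sum_nonneg) auto
    have "\<bar>?S d - p b * real n\<bar> \<le> real ?k + \<bar>real (count_list d b) - p b * real n\<bar>"
      using split first first0 by linarith
    also have "\<bar>real (count_list d b) - p b * real n\<bar> \<le> \<epsilon> * real n + ((1 + p b) * real n) * of_bool (?bad d)"
    proof (cases "?bad d")
      case True
      have "real (count_list d b) \<le> real n" using count_le_length[of d b] l by simp
      moreover have "0 \<le> p b * real n" "0 \<le> \<epsilon> * real n" using p \<epsilon> by auto
      ultimately show ?thesis using True by (simp add: algebra_simps abs_le_iff)
    qed simp
    finally have "\<bar>?S d - p b * real n\<bar> \<le> real ?k + \<epsilon> * real n + ((1 + p b) * real n) * of_bool (?bad d)"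
      by simp
    moreover have "0 \<le> real ?k + \<epsilon> * real n + ((1 + p b) * real n) * of_bool (?bad d)"
      using p \<epsilon> by simp
    ultimately show "\<bar>of_bool (take ?k d = a) * ?S d - (p b * real n) * of_bool (take ?k d = a)\<bar> \<le>
        (real ?k + \<epsilon> * real n) + ((1 + p b) * real n) * of_bool (?bad d)"
      by (cases "take ?k d = a") simp_all
  qed
  also have "\<dots> = real ?k + \<epsilon> * real n + ((1 + p b) * real n) * probab w n ?bad"
    by (subst expect_add, subst expect_cmult, subst expect_const[OF n(2)]) (rule refl)
  finally have 1: "\<bar>real (n - ?k) * A n (a @ [b]) - p b * real n * A n a\<bar> \<le>
      real ?k + \<epsilon> * real n + ((1 + p b) * real n) * probab w n ?bad" .
  have A01: "0 \<le> A n (a @ [b])" "A n (a @ [b]) \<le> 1"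
    unfolding A_def using w n by (auto intro: expect_nonneg probab_le_1)
  have "real n * A n (a @ [b]) = real (n - ?k) * A n (a @ [b]) + real ?k * A n (a @ [b])"
    using n(1) by (simp add: of_nat_diff algebra_simps)
  moreover have "0 \<le> real ?k * A n (a @ [b])" "real ?k * A n (a @ [b]) \<le> real ?k"
    using A01 by (auto intro: mult_left_le)
  moreover have factor: "\<bar>real n * A n (a @ [b]) - p b * real n * A n a\<bar> =
      real n * \<bar>A n (a @ [b]) - p b * A n a\<bar>"
  proof -
    have "real n * A n (a @ [b]) - p b * real n * A n a = real n * (A n (a @ [b]) - p b * A n a)"
      by (simp add: algebra_simps)
    then show ?thesis by (simp only: abs_mult abs_of_nat)
  qed
  ultimately have "\<bar>real n * A n (a @ [b]) - p b * real n * A n a\<bar> \<le>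
      2 * real ?k + \<epsilon> * real n + ((1 + p b) * real n) * probab w n ?bad"
    using 1 by linarith
  also have "\<dots> = real n * (2 * real ?k / real n + \<epsilon> + (1 + p b) * probab w n ?bad)"
    using n(1) by (simp add: field_simps)
  finally have "real n * \<bar>A n (a @ [b]) - p b * A n a\<bar> \<le>
      real n * (2 * real ?k / real n + \<epsilon> + (1 + p b) * probab w n ?bad)"
    unfolding factor .
  then show ?thesis using n(1) by simp
qed

text \<open>\<open>admissible_sizes\<close> in terms of \<open>Z\<close>
  (\<open>admissible_sizes_eq\<close>), so that the arguments on sequences need not mention
  trees.\<close>

definition admissible :: "(nat \<Rightarrow> real) \<Rightarrow> nat filter" where
  "admissible w = inf sequentially (principal {n. 0 < n \<and> 0 < Z w n (n - 1)})"

lemma eventually_admissible: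
  "eventually P (admissible w) \<longleftrightarrow> eventually (\<lambda>n. 0 < n \<and> 0 < Z w n (n - 1) \<longrightarrow> P n) sequentially"
  by (simp add: admissible_def eventually_inf_principal)

lemma prefix_limit:
  assumes w: "\<And>k. 0 \<le> w k" and p: "\<And>k. 0 \<le> p k" and conc: "concentrated w p"
  shows "((\<lambda>n. probab w n (\<lambda>d. take (length a) d = a)) \<longlongrightarrow> wt p a) (admissible w)"
proof (induction a rule: rev_induct)
  case Nil
  have "eventually (\<lambda>n. probab w n (\<lambda>d. take (length []) d = []) = 1) (admissible w)"
    unfolding eventually_admissible by (auto simp: expect_const)
  then show ?case by (simp add: tendsto_eventually)
next
  case (snoc b a)
  define A where "A n a = probab w n (\<lambda>d. take (length a) d = a)" for n a
  have "((\<lambda>n. A n (a @ [b]) - p b * A n a) \<longlongrightarrow> 0) (admissible w)"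
  proof (rule tendstoI)
    fix e :: real assume e: "e > 0"
    obtain C \<rho> where C: "0 \<le> C" "0 \<le> \<rho>" "\<rho> < 1"
      "\<And>n. n > 0 \<Longrightarrow> 0 < Z w n (n - 1) \<Longrightarrow>
        probab w n (\<lambda>d. e / 2 * real n < \<bar>real (count_list d b) - p b * real n\<bar>) \<le> C * \<rho> ^ n"
      using conc e unfolding concentrated_def by (metis half_gt_zero)
    have "(\<lambda>n. 2 * real (length a) / real n + (1 + p b) * (C * \<rho> ^ n)) \<longlonglongrightarrow> 0 + (1 + p b) * (C * 0)"
      using C by (intro tendsto_add lim_const_over_n tendsto_mult tendsto_const LIMSEQ_power_zero) auto
    then have "eventually (\<lambda>n. 2 * real (length a) / real n + (1 + p b) * (C * \<rho> ^ n) < e / 2) sequentially"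
      using e by (intro order_tendstoD(2)) auto
    moreover have "eventually (\<lambda>n. length a < n) sequentially" by (rule eventually_gt_at_top)
    ultimately show "eventually (\<lambda>n. dist (A n (a @ [b]) - p b * A n a) 0 < e) (admissible w)"
      unfolding eventually_admissible
    proof eventually_elim
      case (elim n)
      show ?case
      proof
        assume n: "0 < n \<and> 0 < Z w n (n - 1)"
        have "\<bar>A n (a @ [b]) - p b * A n a\<bar> \<le> 2 * real (length a) / real n + e / 2 +
            (1 + p b) * probab w n (\<lambda>d. e / 2 * real n < \<bar>real (count_list d b) - p b * real n\<bar>)"
          unfolding A_def using n e elim(2) by (intro prefix_step w p) auto
        also have "\<dots> \<le> 2 * real (length a) / real n + e / 2 + (1 + p b) * (C * \<rho> ^ n)"
          using C(4)[of n] n p[of b] by (intro add_left_mono mult_left_mono) auto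
        also have "\<dots> < e" using elim(1) by simp
        finally show "dist (A n (a @ [b]) - p b * A n a) 0 < e" by simp
      qed
    qed
  qed
  moreover have "((\<lambda>n. p b * A n a) \<longlongrightarrow> p b * wt p a) (admissible w)"
    using snoc unfolding A_def by (intro tendsto_intros)
  ultimately have "((\<lambda>n. (A n (a @ [b]) - p b * A n a) + p b * A n a) \<longlongrightarrow> 0 + p b * wt p a) (admissible w)"
    by (rule tendsto_add)
  moreover have "wt p (a @ [b]) = p b * wt p a" by (simp add: wt_def)
  ultimately show ?case by (simp add: A_def)
qed

text \<open>If at least \<open>c * n\<close> entries are zero, a prefix without zeros leaves them
  all among the remaining entries, so each further draw is nonzero with conditional probability at
  most \<open>1 - c\<close>. With \<open>c\<close> half of \<open>p 0\<close>, fewer zeros mean a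
  deviation above \<open>c * n\<close>, of probability at most \<open>C * \<rho> ^ n\<close>, and
  \<open>m \<le> n\<close> turns this into a bound in \<open>m\<close>.\<close>

lemma leading_nonzeros_tail:
  assumes w: "\<And>k. 0 \<le> w k" and p0: "0 < p 0" "p 0 \<le> 1" and conc: "concentrated w p"
  shows "\<exists>C r. 0 \<le> C \<and> 0 \<le> r \<and> r < 1 \<and> (\<forall>n m. 0 < n \<longrightarrow> 0 < Z w n (n - 1) \<longrightarrow> m \<le> n \<longrightarrow>
    probab w n (\<lambda>d. \<forall>x\<in>set (take m d). x \<noteq> 0) \<le> C * r ^ m)"
proof -
  define c where "c = p 0 / 2"
  have c: "0 < c" "c < 1" using p0 by (auto simp: c_def)
  obtain C \<rho> where C: "0 \<le> C" "0 \<le> \<rho>" "\<rho> < 1"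
    "\<And>n. n > 0 \<Longrightarrow> 0 < Z w n (n - 1) \<Longrightarrow>
      probab w n (\<lambda>d. c * real n < \<bar>real (count_list d 0) - p 0 * real n\<bar>) \<le> C * \<rho> ^ n"
    using conc c(1) unfolding concentrated_def by metis
  define r where "r = max (1 - c) \<rho>"
  have r: "0 \<le> r" "r < 1" "1 - c \<le> r" "\<rho> \<le> r" using c C by (auto simp: r_def)
  let ?nz = "\<lambda>k d. \<forall>x\<in>set (take k d). x \<noteq> (0 :: nat)"
  let ?good = "\<lambda>n d. c * real n \<le> real (count_list d 0)"
  show ?thesis
  proof (rule exI[of _ "1 + C"], rule exI[of _ r], intro conjI allI impI)
    fix n m :: nat assume n: "0 < n" "0 < Z w n (n - 1)" and m: "m \<le> n"
    define Q where "Q k = expect w n (\<lambda>d. of_bool (?nz k d) * of_bool (?good n d))" for k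
    have Q_step: "Q (Suc k) \<le> (1 - c) * Q k" if k: "k < n" for k
    proof -
      have "real (n - k) * Q (Suc k) =
          real (n - k) * expect w n (\<lambda>d. (of_bool (?nz k d) * of_bool (?good n d)) * of_bool (d ! k \<noteq> 0))"
        unfolding Q_def
      proof (intro arg_cong[where f = "\<lambda>x. real (n - k) * x"] expect_cong)
        fix d assume "d \<in> seqs n (n - 1)"
        then have "k < length d" using k by (simp add: seqs_def)
        then show "of_bool (?nz (Suc k) d) * of_bool (?good n d) =
            (of_bool (?nz k d) * of_bool (?good n d)) * (of_bool (d ! k \<noteq> 0) :: real)"
          by (auto simp: take_Suc_conv_app_nth)
      qed
      also have "\<dots> = expect w n (\<lambda>d. (of_bool (?nz k d) * of_bool (?good n d)) * (\<Sum>i\<in>{k..<n}. of_bool (d ! i \<noteq> 0)))"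
        using expect_nth_average[OF k, of w "\<lambda>u M. of_bool (\<forall>x\<in>set u. x \<noteq> 0) * of_bool (c * real n \<le> real (count M 0))"
            "\<lambda>x. of_bool (x \<noteq> 0)"] by (simp add: count_mset del: sum_of_bool_eq)
      also have "\<dots> \<le> expect w n (\<lambda>d. ((1 - c) * real (n - k)) * (of_bool (?nz k d) * of_bool (?good n d)))"
      proof (intro expect_mono w)
        fix d assume "d \<in> seqs n (n - 1)"
        then have l: "length d = n" by (simp add: seqs_def)
        show "(of_bool (?nz k d) * of_bool (?good n d)) * (\<Sum>i\<in>{k..<n}. of_bool (d ! i \<noteq> 0)) \<le>
            ((1 - c) * real (n - k)) * (of_bool (?nz k d) * of_bool (?good n d))"
        proof (cases "?nz k d \<and> ?good n d")
          case True
          have "real (count_list d 0) = (\<Sum>i<n. of_bool (d ! i = 0))" using l by (simp add: count_list_eq_sum)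
          also have "\<dots> = (\<Sum>i\<in>{k..<n}. of_bool (d ! i = 0))"
          proof (rule sum.mono_neutral_right)
            show "\<forall>i\<in>{..<n} - {k..<n}. of_bool (d ! i = 0) = (0 :: real)"
            proof
              fix i assume "i \<in> {..<n} - {k..<n}"
              then have "d ! i \<in> set (take k d)" using l by (auto simp: in_set_conv_nth intro!: exI[of _ i])
              then have "d ! i \<noteq> 0" using True by blast
              then show "of_bool (d ! i = 0) = (0 :: real)" by simp
            qed
          qed auto
          finally have cnt: "real (count_list d 0) = (\<Sum>i\<in>{k..<n}. of_bool (d ! i = 0))" .
          have "(\<Sum>i\<in>{k..<n}. of_bool (d ! i \<noteq> 0) :: real) = (\<Sum>i\<in>{k..<n}. 1 - of_bool (d ! i = 0))"
            by (intro sum.cong) auto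
          also have "\<dots> = real (n - k) - real (count_list d 0)"
            unfolding cnt by (simp add: sum_subtractf)
          also have "\<dots> \<le> real (n - k) - c * real (n - k)"
          proof -
            have "c * real (n - k) \<le> c * real n" using c by (intro mult_left_mono) auto
            then show ?thesis using True by simp
          qed
          finally show ?thesis using True by (simp add: algebra_simps)
        qed auto
      qed
      also have "\<dots> = real (n - k) * ((1 - c) * Q k)"
        unfolding expect_cmult Q_def by simp
      finally show ?thesis using k by simp
    qed
    have "k \<le> n \<Longrightarrow> Q k \<le> (1 - c) ^ k" for k
    proof (induction k)
      case 0
      have "Q 0 \<le> expect w n (\<lambda>_. 1)" unfolding Q_def by (intro expect_mono w) auto
      then show ?case using expect_const[OF n(2), of 1] by simp
    next
      case (Suc k)
      have "Q (Suc k) \<le> (1 - c) * Q k" using Suc.prems by (intro Q_step) auto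
      also have "\<dots> \<le> (1 - c) * (1 - c) ^ k" using Suc c by (intro mult_left_mono) auto
      finally show ?case by simp
    qed
    then have Q: "Q m \<le> (1 - c) ^ m" using m by blast
    have "probab w n (?nz m) \<le> expect w n (\<lambda>d. of_bool (?nz m d) * of_bool (?good n d) +
        of_bool (c * real n < \<bar>real (count_list d 0) - p 0 * real n\<bar>))"
    proof (intro expect_mono w)
      fix d :: "nat list"
      have "p 0 * real n = c * real n + c * real n" by (simp add: c_def)
      then have "?good n d \<or> c * real n < \<bar>real (count_list d 0) - p 0 * real n\<bar>" by linarith
      then show "of_bool (?nz m d) \<le> of_bool (?nz m d) * of_bool (?good n d) +
          (of_bool (c * real n < \<bar>real (count_list d 0) - p 0 * real n\<bar>) :: real)"
        by (cases "?good n d") auto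
    qed
    also have "\<dots> \<le> (1 - c) ^ m + C * \<rho> ^ n"
      unfolding expect_add using Q C(4) n by (intro add_mono) (auto simp: Q_def)
    also have "\<dots> \<le> r ^ m + C * r ^ m"
    proof (intro add_mono mult_left_mono)
      show "(1 - c) ^ m \<le> r ^ m" using c r by (intro power_mono) auto
      have "\<rho> ^ n \<le> \<rho> ^ m" using C m by (intro power_decreasing) auto
      also have "\<dots> \<le> r ^ m" using C r by (intro power_mono) auto
      finally show "\<rho> ^ n \<le> r ^ m" .
    qed (use C in auto)
    finally show "probab w n (?nz m) \<le> (1 + C) * r ^ m" by (simp add: algebra_simps)
  qed (use C r in auto)
qed

section \<open>Convergence of the protection number\<close>

lemma weighted_trees_eq_Z:
  assumes "0 < n"
  shows "real n * (\<Sum>T\<in>plane_trees n. tree_weight w T) = Z w n (n - 1)"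
proof -
  have "(\<Sum>T\<in>plane_trees n. tree_weight w T) = (\<Sum>t | length (code t) = n. wt w (code t))"
    by (subst sum.reindex_bij_betw[OF bij_betw_verts, symmetric]) (simp add: tree_weight_verts)
  also have "real n * \<dots> = (\<Sum>t | length (code t) = n. wt w (code t) * (\<Sum>s\<leftarrow>fringes t. 1))"
    unfolding sum_distrib_left by (intro sum.cong) (auto simp: sum_list_triv length_fringes)
  also have "\<dots> = Z w n (n - 1)"
    unfolding sum_fringes_eq_sum_seqs[OF assms] Z_def by simp
  finally show ?thesis .
qed

lemma simply_generated_defined_iff:
  assumes w: "weight_sequence w"
  shows "simply_generated_defined w n \<longleftrightarrow> 0 < n \<and> 0 < Z w n (n - 1)"
proof (cases "n = 0")
  case True
  have "plane_trees 0 = {}" by (auto simp: plane_trees_def plane_tree_def)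
  then show ?thesis using True by (simp add: simply_generated_defined_def)
next
  case False
  have nn: "0 \<le> tree_weight w T" for T
    using w unfolding weight_sequence_def tree_weight_def by (intro prod_nonneg) auto
  have "simply_generated_defined w n \<longleftrightarrow> (\<Sum>T\<in>plane_trees n. tree_weight w T) \<noteq> 0"
    unfolding simply_generated_defined_def using nn finite_plane_trees
    by (subst sum_nonneg_eq_0_iff) (auto simp: less_le)
  also have "\<dots> \<longleftrightarrow> 0 < (\<Sum>T\<in>plane_trees n. tree_weight w T)"
    using sum_nonneg[of "plane_trees n" "tree_weight w"] nn by (auto simp: less_le)
  also have "\<dots> \<longleftrightarrow> 0 < Z w n (n - 1)"
    using False by (simp add: weighted_trees_eq_Z[symmetric] zero_less_mult_iff del: One_nat_def)
  finally show ?thesis using False by simp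
qed

lemma admissible_sizes_eq: "weight_sequence w \<Longrightarrow> admissible_sizes w = admissible w"
  by (simp add: admissible_sizes_def admissible_def simply_generated_defined_iff)

text \<open>Nontriviality of the filter lets bounds pass to the limit. The size
  \<open>N * K + 1\<close> is realised by \<open>N\<close> entries \<open>K\<close> and zeros
  elsewhere.\<close>

lemma admissible_neq_bot:
  assumes w: "weight_sequence w"
  shows "admissible w \<noteq> bot"
proof
  assume "admissible w = bot"
  then obtain N where N: "\<And>n. n \<ge> N \<Longrightarrow> \<not> (0 < n \<and> 0 < Z w n (n - 1))"
    by (auto simp: trivial_limit_def eventually_admissible eventually_sequentially)
  obtain K where K: "2 \<le> K" "0 < w K" using w by (auto simp: weight_sequence_def)
  have w0: "\<And>k. 0 \<le> w k" "0 < w 0" using w by (auto simp: weight_sequence_def)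
  define n where "n = N * K + 1"
  define r where "r = n - N"
  have "N * 1 \<le> N * K" using K(1) by (intro mult_left_mono) auto
  then have n: "N \<le> n" "n = N + r" unfolding n_def r_def by linarith+
  have "0 < Z w 1 K ^ N * Z w 1 0 ^ r"
    using K w0 by (simp add: Z_eq_fps_nth)
  also have "\<dots> \<le> Z w (N * 1) (N * K) * Z w (r * 1) (r * 0)"
    by (intro mult_mono Z_power_le) (auto simp: Z_nonneg w0)
  also have "\<dots> \<le> Z w (N * 1 + r * 1) (N * K + r * 0)" by (intro Z_mult_le w0)
  also have "\<dots> = Z w n (n - 1)" by (simp only: n(2)[symmetric] mult_1_right mult_0_right add_0_right) (simp add: n_def)
  finally show False using N[of n] n by (simp add: n_def)
qed

section \<open>The law of the protection number at finite size and in the limit\<close>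

lemma pmf_protection_law:
  assumes w: "weight_sequence w" and n: "simply_generated_defined w n"
  shows "pmf (protection_law w n) x = probab w n (\<lambda>d. enat (border (decode d)) = x)"
proof -
  have n0: "0 < n" "0 < Z w n (n - 1)" using n simply_generated_defined_iff[OF w] by auto
  define S where "S = (\<Sum>T\<in>plane_trees n. tree_weight w T)"
  have S: "real n * S = Z w n (n - 1)" unfolding S_def by (rule weighted_trees_eq_Z[OF n0(1)])
  let ?g = "\<lambda>T. of_bool (border_dist T = x) :: real"
  have inner: "pmf (map_pmf (protection_number T) (pmf_of_set T)) x =
      (\<Sum>v\<in>T. ?g (fringe_subtree T v)) / real n" if "T \<in> plane_trees n" for T
  proof -
    have T: "finite T" "T \<noteq> {}" "card T = n" using that n0 by (auto simp: plane_trees_def plane_tree_def)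
    then have "pmf (map_pmf (protection_number T) (pmf_of_set T)) x =
        real (card (T \<inter> protection_number T -` {x})) / real n"
      by (simp add: pmf_map measure_pmf_of_set)
    also have "T \<inter> protection_number T -` {x} = {v \<in> T. border_dist (fringe_subtree T v) = x}"
      by (auto simp: protection_number_def)
    also have "real (card \<dots>) = (\<Sum>v\<in>T. ?g (fringe_subtree T v))"
      using T(1) by (simp add: Int_def)
    finally show ?thesis .
  qed
  have "pmf (protection_law w n) x =
      (\<Sum>T\<in>plane_trees n. pmf (map_pmf (protection_number T) (pmf_of_set T)) x * pmf (simply_generated_tree w n) T)"
    unfolding protection_law_def pmf_bind
    by (rule integral_measure_pmf_real[OF finite_plane_trees])
       (auto simp: set_pmf_iff pmf_simply_generated_tree[OF w n] split: if_splits)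
  also have "\<dots> = (\<Sum>T\<in>plane_trees n. tree_weight w T * (\<Sum>v\<in>T. ?g (fringe_subtree T v))) / (real n * S)"
    unfolding sum_divide_distrib
    by (intro sum.cong refl) (simp add: inner pmf_simply_generated_tree[OF w n] S_def)
  also have "(\<Sum>T\<in>plane_trees n. tree_weight w T * (\<Sum>v\<in>T. ?g (fringe_subtree T v))) =
      (\<Sum>t | length (code t) = n. wt w (code t) * (\<Sum>s\<leftarrow>fringes t. ?g (verts s)))"
    by (subst sum.reindex_bij_betw[OF bij_betw_verts, symmetric])
       (simp only: tree_weight_verts sum_fringe_verts[of ?g])
  also have "\<dots> = (\<Sum>d\<in>seqs n (n - 1). wt w d * of_bool (enat (border (decode d)) = x))"
    unfolding sum_fringes_eq_sum_seqs[OF n0(1)] border_dist_verts ..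
  finally show ?thesis unfolding S expect_def .
qed

text \<open>A discrete law on the countable type of finite trees. It is the law of the
  Galton--Watson tree only when finite trees carry total mass one, hence the hypothesis of
  \<open>pmf_gw_tree\<close>.\<close>

definition gw_tree :: "nat pmf \<Rightarrow> ptree pmf" where
  "gw_tree \<xi> = embed_pmf (\<lambda>t. wt (pmf \<xi>) (code t))"

lemma pmf_gw_tree:
  assumes "(\<integral>\<^sup>+ t. ennreal (wt (pmf \<xi>) (code t)) \<partial>count_space UNIV) = 1"
  shows "pmf (gw_tree \<xi>) t = wt (pmf \<xi>) (code t)"
  unfolding gw_tree_def using assms by (subst pmf_embed_pmf) (auto simp: wt_nonneg)

text \<open>Both sides are probability measures, so one inequality on all sets suffices.\<close>

lemma bgw_border_law_eq:
  assumes "(\<integral>\<^sup>+ t. ennreal (wt (pmf \<xi>) (code t)) \<partial>count_space UNIV) = 1"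
  shows "bgw_border_law \<xi> = distr (measure_pmf (map_pmf border (gw_tree \<xi>))) borel enat"
    (is "_ = ?R")
proof -
  interpret S: prob_space "bgw_space \<xi>"
    unfolding bgw_space_def by (rule prob_space_PiM) (rule measure_pmf.prob_space_axioms)
  interpret L: prob_space "bgw_border_law \<xi>"
    unfolding bgw_border_law_def by (rule S.prob_space_distr) (rule measurable_border_dist_bgw_tree)
  interpret R: prob_space ?R
    by (rule measure_pmf.prob_space_distr) simp
  let ?B = "\<lambda>N. border_dist (bgw_tree N)"
  let ?E = "\<lambda>t. {N \<in> space (bgw_space \<xi>). bgw_tree N = verts t}"
  have le: "emeasure ?R A \<le> emeasure (bgw_border_law \<xi>) A" if A: "A \<in> sets borel" for A
  proof -
    have disj: "disjoint_family_on ?E {t. enat (border t) \<in> A}"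
      unfolding disjoint_family_on_def by (auto dest: verts_inject)
    have "emeasure ?R A = emeasure (gw_tree \<xi>) {t. enat (border t) \<in> A}"
      using A by (simp add: emeasure_distr vimage_def)
    also have "\<dots> = (\<integral>\<^sup>+ t. ennreal (pmf (gw_tree \<xi>) t) \<partial>count_space {t. enat (border t) \<in> A})"
      by (rule nn_integral_pmf[symmetric])
    also have "\<dots> = (\<integral>\<^sup>+ t. emeasure (bgw_space \<xi>) (?E t) \<partial>count_space {t. enat (border t) \<in> A})"
      by (simp add: pmf_gw_tree[OF assms] bgw_tree_verts_event(2))
    also have "\<dots> = emeasure (bgw_space \<xi>) (\<Union>t\<in>{t. enat (border t) \<in> A}. ?E t)"
      by (rule emeasure_UN_countable[symmetric, OF bgw_tree_verts_event(1) _ disj]) simp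
    also have "\<dots> \<le> emeasure (bgw_space \<xi>) (?B -` A \<inter> space (bgw_space \<xi>))"
      using measurable_sets[OF measurable_border_dist_bgw_tree A]
      by (intro emeasure_mono) (auto simp: border_dist_verts)
    also have "\<dots> = emeasure (bgw_border_law \<xi>) A"
      unfolding bgw_border_law_def by (rule emeasure_distr[symmetric, OF measurable_border_dist_bgw_tree A])
    finally show ?thesis .
  qed
  have space: "space ?R = UNIV" "space (bgw_border_law \<xi>) = UNIV" by (simp_all add: bgw_border_law_def)
  have sets: "sets ?R = sets borel" "sets (bgw_border_law \<xi>) = sets borel"
    by (simp_all add: bgw_border_law_def)
  show ?thesis
  proof (rule measure_eqI)
    fix A assume "A \<in> sets (bgw_border_law \<xi>)"
    then have A: "A \<in> sets borel" "- A \<in> sets borel" using sets by (auto simp: borel_comp)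
    have "measure ?R A \<le> measure (bgw_border_law \<xi>) A"
      using le[OF A(1)] by (simp add: R.emeasure_eq_measure L.emeasure_eq_measure)
    moreover have "1 - measure ?R A \<le> 1 - measure (bgw_border_law \<xi>) A"
      using le[OF A(2)] R.prob_compl[of A] L.prob_compl[of A] A(1) sets space
      by (simp add: R.emeasure_eq_measure L.emeasure_eq_measure Compl_eq_Diff_UNIV)
    ultimately show "emeasure (bgw_border_law \<xi>) A = emeasure ?R A"
      by (simp add: R.emeasure_eq_measure L.emeasure_eq_measure)
  qed (simp add: sets)
qed

text \<open>Single trees converge because decoding to \<open>t\<close> means having
  \<open>code t\<close> as a prefix. Finite subsets then give lower bounds for arbitrary sets, and
  complements give the upper bounds since the limit has mass one.\<close>

lemma probab_decode_limit:
  assumes w: "\<And>k. 0 \<le> w k" and conc: "concentrated w (pmf \<xi>)"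
    and one: "(\<integral>\<^sup>+ t. ennreal (wt (pmf \<xi>) (code t)) \<partial>count_space UNIV) = 1"
  shows "((\<lambda>n. probab w n (\<lambda>d. decode d \<in> A)) \<longlongrightarrow> measure_pmf.prob (gw_tree \<xi>) A) (admissible w)"
proof -
  have single: "((\<lambda>n. probab w n (\<lambda>d. decode d = t)) \<longlongrightarrow> pmf (gw_tree \<xi>) t) (admissible w)" for t
  proof -
    have "probab w n (\<lambda>d. decode d = t) = probab w n (\<lambda>d. take (length (code t)) d = code t)" if "0 < n" for n
    proof (intro expect_cong arg_cong[where f = of_bool])
      fix d assume "d \<in> seqs n (n - 1)"
      then have "sum_list d < length d" using that by (simp add: seqs_def)
      then obtain r where r: "d = code (decode d) @ r" by (rule decode_prefix)
      show "(decode d = t) = (take (length (code t)) d = code t)"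
      proof
        assume "take (length (code t)) d = code t"
        then have "d = code t @ drop (length (code t)) d" by (metis append_take_drop_id)
        then show "decode d = t" by (metis decode_code)
      qed (use r in \<open>metis append_eq_conv_conj\<close>)
    qed
    then have "eventually (\<lambda>n. probab w n (\<lambda>d. take (length (code t)) d = code t) =
        probab w n (\<lambda>d. decode d = t)) (admissible w)"
      unfolding eventually_admissible by simp
    from Lim_transform_eventually[OF prefix_limit[OF w _ conc] this]
    show ?thesis by (simp add: pmf_gw_tree[OF one])
  qed
  have lower: "eventually (\<lambda>n. measure_pmf.prob (gw_tree \<xi>) A - e < probab w n (\<lambda>d. decode d \<in> A)) (admissible w)"
    if e: "0 < e" for e A
  proof -
    \<comment> \<open>An enumeration of the trees exhausts \<open>A\<close> by finite sets, on which
      the limits at single trees can be added.\<close>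
    define B where "B k = A \<inter> to_nat -` {..<k}" for k :: nat
    have fin: "finite (B k)" for k
      unfolding B_def by (intro finite_Int disjI2 finite_vimageI) auto
    have "(\<lambda>k. measure_pmf.prob (gw_tree \<xi>) (B k)) \<longlonglongrightarrow> measure_pmf.prob (gw_tree \<xi>) (\<Union>k. B k)"
      by (intro measure_pmf.finite_Lim_measure_incseq) (auto simp: B_def incseq_def)
    also have "(\<Union>k. B k) = A" by (auto simp: B_def)
    finally have "eventually (\<lambda>k. measure_pmf.prob (gw_tree \<xi>) A - e < measure_pmf.prob (gw_tree \<xi>) (B k)) sequentially"
      using e by (intro order_tendstoD(1)) auto
    then obtain k where k: "measure_pmf.prob (gw_tree \<xi>) A - e < measure_pmf.prob (gw_tree \<xi>) (B k)"
      by (auto dest: eventually_happens)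
    have "((\<lambda>n. \<Sum>t\<in>B k. probab w n (\<lambda>d. decode d = t)) \<longlongrightarrow> (\<Sum>t\<in>B k. pmf (gw_tree \<xi>) t)) (admissible w)"
      by (intro tendsto_sum single)
    also have "(\<Sum>t\<in>B k. pmf (gw_tree \<xi>) t) = measure_pmf.prob (gw_tree \<xi>) (B k)"
      by (rule measure_measure_pmf_finite[symmetric, OF fin])
    finally have "eventually (\<lambda>n. measure_pmf.prob (gw_tree \<xi>) A - e <
        (\<Sum>t\<in>B k. probab w n (\<lambda>d. decode d = t))) (admissible w)"
      using k by (rule order_tendstoD(1))
    then show ?thesis
    proof eventually_elim
      case (elim n)
      have "(\<Sum>t\<in>B k. probab w n (\<lambda>d. decode d = t)) = expect w n (\<lambda>d. \<Sum>t\<in>B k. of_bool (decode d = t))"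
        by (rule expect_sum[symmetric])
      also have "\<dots> \<le> probab w n (\<lambda>d. decode d \<in> A)"
      proof (intro expect_mono w)
        fix d
        have "(\<Sum>t\<in>B k. of_bool (decode d = t)) = (of_bool (decode d \<in> B k) :: real)"
          using fin[of k] by (simp add: of_bool_def sum.delta)
        also have "\<dots> \<le> of_bool (decode d \<in> A)" by (simp add: B_def)
        finally show "(\<Sum>t\<in>B k. of_bool (decode d = t)) \<le> (of_bool (decode d \<in> A) :: real)" .
      qed
      finally show ?case using elim by linarith
    qed
  qed
  show ?thesis
  proof (rule order_tendstoI)
    fix a assume "a < measure_pmf.prob (gw_tree \<xi>) A"
    then show "eventually (\<lambda>n. a < probab w n (\<lambda>d. decode d \<in> A)) (admissible w)"
      using lower[of "measure_pmf.prob (gw_tree \<xi>) A - a" A] by simp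
  next
    fix a assume a: "measure_pmf.prob (gw_tree \<xi>) A < a"
    have "measure_pmf.prob (gw_tree \<xi>) (- A) = 1 - measure_pmf.prob (gw_tree \<xi>) A"
      using measure_pmf.prob_compl[of A "gw_tree \<xi>"] by (simp add: Compl_eq_Diff_UNIV)
    then have "eventually (\<lambda>n. 1 - a < probab w n (\<lambda>d. decode d \<in> - A)) (admissible w)"
      using lower[of "a - measure_pmf.prob (gw_tree \<xi>) A" "- A"] a by simp
    moreover have "probab w n (\<lambda>d. decode d \<in> - A) = 1 - probab w n (\<lambda>d. decode d \<in> A)"
      if "0 < Z w n (n - 1)" for n
    proof -
      have "probab w n (\<lambda>d. decode d \<in> - A) = expect w n (\<lambda>d. 1 - of_bool (decode d \<in> A))"
        by (intro expect_cong) auto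
      then show ?thesis by (simp only: expect_diff expect_const[OF that])
    qed
    ultimately show "eventually (\<lambda>n. probab w n (\<lambda>d. decode d \<in> A) < a) (admissible w)"
      unfolding eventually_admissible by (auto elim!: eventually_mono)
  qed
qed

lemma probab_border_tail:
  assumes w: "\<And>k. 0 \<le> w k" and conc: "concentrated w p" and p0: "0 < p 0" "p 0 \<le> 1"
  shows "\<exists>C r. 0 \<le> C \<and> 0 \<le> r \<and> r < 1 \<and> (\<forall>n m. 0 < n \<longrightarrow> 0 < Z w n (n - 1) \<longrightarrow>
    probab w n (\<lambda>d. border (decode d) = m) \<le> C * r ^ m)"
proof -
  obtain C r where C: "0 \<le> C" "0 \<le> r" "r < 1"
    "\<And>n m. 0 < n \<Longrightarrow> 0 < Z w n (n - 1) \<Longrightarrow> m \<le> n \<Longrightarrow>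
      probab w n (\<lambda>d. \<forall>x\<in>set (take m d). x \<noteq> 0) \<le> C * r ^ m"
    using leading_nonzeros_tail[OF w p0 conc] by blast
  have "probab w n (\<lambda>d. border (decode d) = m) \<le> C * r ^ m" if n: "0 < n" "0 < Z w n (n - 1)" for n m
  proof -
    have *: "m \<le> n \<and> (\<forall>x\<in>set (take m d). x \<noteq> 0)"
      if d: "d \<in> seqs n (n - 1)" and m: "border (decode d) = m" for d
    proof -
      have l: "length d = n" and "sum_list d < length d" using d n by (auto simp: seqs_def)
      then obtain r where r: "d = code (decode d) @ r" by (auto elim: decode_prefix)
      have m': "m < length (code (decode d))" "\<And>i. i < m \<Longrightarrow> code (decode d) ! i \<noteq> 0"
        using le_borderD[of m "decode d"] m by auto
      have "length d = length (code (decode d)) + length r" using r by (metis length_append)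
      moreover have "take m d = take m (code (decode d))" using r m'(1) by (metis append_eq_append_conv_if less_imp_le take_append diff_is_0_eq take0 append_Nil2)
      moreover have "\<forall>x\<in>set (take m (code (decode d))). x \<noteq> 0"
        using m' by (auto simp: in_set_conv_nth)
      ultimately show ?thesis using m'(1) l by simp
    qed
    show ?thesis
    proof (cases "m \<le> n")
      case True
      have "probab w n (\<lambda>d. border (decode d) = m) \<le> probab w n (\<lambda>d. \<forall>x\<in>set (take m d). x \<noteq> 0)"
        using * by (intro expect_mono w) auto
      also have "\<dots> \<le> C * r ^ m" by (rule C(4)[OF n True])
      finally show ?thesis .
    next
      \<comment> \<open>Size excludes \<open>m > n\<close>, so the bound holds for every
        \<open>m\<close>, as a dominating series over all \<open>m\<close> requires.\<close>
      case False
      then have "probab w n (\<lambda>d. border (decode d) = m) = expect w n (\<lambda>d. 0)"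
        using * by (intro expect_cong) auto
      also have "\<dots> = 0" by (simp add: expect_def)
      finally show ?thesis using C by simp
    qed
  qed
  with C(1-3) show ?thesis by blast
qed

section \<open>Series and expectations on the natural numbers\<close>

lemma summable_power_times_geometric:
  fixes r :: real
  assumes "0 \<le> r" "r < 1"
  shows "summable (\<lambda>n. real n ^ k * r ^ n)"
  using assms
proof (induction k arbitrary: r)
  case 0
  then show ?case by (simp add: summable_geometric)
next
  case (Suc k)
  \<comment> \<open>Of the two factors \<open>t ^ n\<close> in \<open>r ^ n\<close>, one absorbs a
    factor \<open>n\<close> and the other is left for the induction hypothesis.\<close>
  define t where "t = sqrt r"
  have t: "0 \<le> t" "t < 1" "r = t * t" using Suc.prems by (auto simp: t_def real_sqrt_lt_1_iff)
  have "(\<lambda>n. real n * t ^ n) \<longlonglongrightarrow> 0"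
    using t by (intro powser_times_n_limit_0) auto
  then have "eventually (\<lambda>n. real n * t ^ n < 1) sequentially" by (rule order_tendstoD(2)) simp
  then have "eventually (\<lambda>n. norm (real n ^ Suc k * r ^ n) \<le> real n ^ k * t ^ n) sequentially"
  proof eventually_elim
    case (elim n)
    have "real n ^ Suc k * r ^ n = (real n ^ k * t ^ n) * (real n * t ^ n)"
      by (simp add: t(3) power_mult_distrib)
    also have "\<dots> \<le> (real n ^ k * t ^ n) * 1" using elim t by (intro mult_left_mono) auto
    finally show ?case using t by simp
  qed
  from summable_comparison_test_ev[OF this Suc.IH[OF t(1,2)]] show ?case .
qed

lemma summable_powr_times_geometric:
  fixes r :: real
  assumes "0 \<le> r" "r < 1" "0 < p"
  shows "summable (\<lambda>n. real n powr p * r ^ n)"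
proof (rule summable_comparison_test'[OF summable_power_times_geometric[OF assms(1,2), of "nat \<lceil>p\<rceil>"]])
  fix n :: nat
  have "real n powr p \<le> real n ^ nat \<lceil>p\<rceil>"
  proof (cases "n = 0")
    case False
    then have "real n powr p \<le> real n powr real (nat \<lceil>p\<rceil>)"
      using assms(3) by (intro powr_mono) (auto simp: real_nat_ceiling_ge)
    then show ?thesis using False by (simp add: powr_realpow)
  qed (use assms in simp)
  then show "norm (real n powr p * r ^ n) \<le> real n ^ nat \<lceil>p\<rceil> * r ^ n"
    using assms by (simp add: mult_right_mono)
qed

lemma integral_nat_pmf:
  fixes f :: "nat \<Rightarrow> real"
  assumes "bounded (range f)"
  shows "(\<integral>m. f m \<partial>measure_pmf R) = (\<Sum>m. pmf R m * f m)"
proof -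
  obtain B where B: "\<And>m. \<bar>f m\<bar> \<le> B" using assms by (auto simp: bounded_iff)
  have "summable (\<lambda>m. \<bar>pmf R m * f m\<bar>)"
  proof (rule summable_comparison_test'[where g = "\<lambda>m. B * pmf R m"])
    show "summable (\<lambda>m. B * pmf R m)"
      using pmf_nat_sums[of R] by (intro summable_mult) (auto simp: sums_iff)
    fix m show "norm \<bar>pmf R m * f m\<bar> \<le> B * pmf R m"
      using mult_left_mono[OF B[of m], of "pmf R m"] by (simp add: abs_mult mult.commute)
  qed
  then have int: "integrable (count_space UNIV) (\<lambda>m. pmf R m * f m)"
    by (simp add: integrable_count_space_nat_iff)
  have "(\<integral>m. f m \<partial>measure_pmf R) = (\<integral>m. pmf R m *\<^sub>R f m \<partial>count_space UNIV)"
    unfolding measure_pmf_eq_density by (intro integral_density) auto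
  also have "\<dots> = (\<Sum>m. pmf R m * f m)"
    using integral_count_space_nat[OF int] by simp
  finally show ?thesis .
qed

lemma nn_integral_nat_pmf:
  assumes "\<And>m. 0 \<le> f m" "summable (\<lambda>m. pmf R m * f m)"
  shows "(\<integral>\<^sup>+ m. ennreal (f m) \<partial>measure_pmf R) = ennreal (\<Sum>m. pmf R m * f m)"
proof -
  have "(\<integral>\<^sup>+ m. ennreal (f m) \<partial>measure_pmf R) = (\<Sum>m. ennreal (pmf R m * f m))"
    by (simp add: nn_integral_measure_pmf nn_integral_count_space_nat ennreal_mult assms(1))
  also have "\<dots> = ennreal (\<Sum>m. pmf R m * f m)"
    using assms by (intro suminf_ennreal2) auto
  finally show ?thesis .
qed

text \<open>All subsets of the countable space \<open>enat\<close> are countable unions of closed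
  points. This settles measurability of every test function.\<close>

lemma sets_borel_enat: "sets (borel :: enat measure) = UNIV"
proof -
  have "A \<in> sets borel" for A :: "enat set"
    by (rule sets.countable) auto
  then show ?thesis by blast
qed

theorem theorem3:
  fixes w :: "nat \<Rightarrow> real" and \<xi> :: "nat pmf"
  assumes "weight_sequence w"
    and "offspring_distribution w \<xi>"
  shows "converges_in_distribution (\<lambda>n. measure_pmf (protection_law w n)) (bgw_border_law \<xi>)
           (admissible_sizes w) \<and>
         (\<forall>p::real. 1 \<le> p \<longrightarrow>
           moment (bgw_border_law \<xi>) p < \<infinity> \<and>
           ((\<lambda>n. moment (measure_pmf (protection_law w n)) p) \<longlongrightarrow> moment (bgw_border_law \<xi>) p)
             (admissible_sizes w))"
proof -
  have w: "\<And>k. 0 \<le> w k" using assms(1) by (simp add: weight_sequence_def)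
  have lim: "concentrated w (pmf \<xi>) \<and>
      (\<integral>\<^sup>+ t. ennreal (wt (pmf \<xi>) (code t)) \<partial>count_space UNIV) = 1 \<and> 0 < pmf \<xi> 0"
    using assms(2) unfolding offspring_distribution_def
  proof (elim disjE exE conjE)
    fix \<tau> assume "type_I w \<tau>" "tilted_by w \<tau> \<xi>"
    then show ?thesis using type_I_II_limit[OF assms(1), of \<tau> \<xi>] by blast
  next
    fix \<tau> assume "type_II w \<tau>" "tilted_by w \<tau> \<xi>"
    then show ?thesis using type_I_II_limit[OF assms(1), of \<tau> \<xi>] by blast
  next
    assume "type_III w" "\<xi> = return_pmf 0"
    then show ?thesis using type_III_limit[OF assms(1)] nn_integral_wt_return_0 by simp
  qed
  then have conc: "concentrated w (pmf \<xi>)" and one: "(\<integral>\<^sup>+ t. ennreal (wt (pmf \<xi>) (code t)) \<partial>count_space UNIV) = 1"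
    and p0: "0 < pmf \<xi> 0" by auto
  define F where "F = admissible w"
  have F: "admissible_sizes w = F" unfolding F_def by (rule admissible_sizes_eq[OF assms(1)])
  have F_bot: "F \<noteq> bot" unfolding F_def by (rule admissible_neq_bot[OF assms(1)])
  define Q where "Q = map_pmf border (gw_tree \<xi>)"
  \<comment> \<open>Passing to \<open>nat\<close> turns expectations into series. For defined sizes
    \<open>the_enat\<close> is harmless, since the protection law gives no mass to infinity.\<close>
  define R where "R n = map_pmf the_enat (protection_law w n)" for n
  have law: "protection_law w n = map_pmf enat (R n) \<and> pmf (R n) m = probab w n (\<lambda>d. border (decode d) = m)"
    if "simply_generated_defined w n" for n m
  proof
    have "pmf (protection_law w n) \<infinity> = 0"
      unfolding pmf_protection_law[OF assms(1) that] by (simp add: expect_def)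
    then have "enat (the_enat x) = x" if "x \<in> set_pmf (protection_law w n)" for x
      using that by (cases x) (auto simp: set_pmf_iff)
    then have "map_pmf (enat \<circ> the_enat) (protection_law w n) = map_pmf id (protection_law w n)"
      by (intro map_pmf_cong) simp_all
    then show eq: "protection_law w n = map_pmf enat (R n)"
      by (simp add: R_def pmf.map_comp)
    have "pmf (R n) m = pmf (protection_law w n) (enat m)"
      unfolding eq by (simp add: pmf_map_inj' inj_def)
    then show "pmf (R n) m = probab w n (\<lambda>d. border (decode d) = m)"
      unfolding pmf_protection_law[OF assms(1) that] by simp
  qed
  have defined: "eventually (\<lambda>n. simply_generated_defined w n) F"
    unfolding F_def eventually_admissible by (simp add: simply_generated_defined_iff[OF assms(1)])
  have pmf_lim: "((\<lambda>n. pmf (R n) m) \<longlongrightarrow> pmf Q m) F" for m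
  proof -
    have "((\<lambda>n. probab w n (\<lambda>d. decode d \<in> border -` {m})) \<longlongrightarrow> pmf Q m) F"
      unfolding F_def Q_def pmf_map by (rule probab_decode_limit[OF w conc one])
    moreover have "eventually (\<lambda>n. probab w n (\<lambda>d. decode d \<in> border -` {m}) = pmf (R n) m) F"
      using defined by eventually_elim (simp add: law)
    ultimately show ?thesis by (rule Lim_transform_eventually)
  qed
  obtain C r where C: "0 \<le> C" "0 \<le> r" "r < 1"
    "\<And>n m. 0 < n \<Longrightarrow> 0 < Z w n (n - 1) \<Longrightarrow> probab w n (\<lambda>d. border (decode d) = m) \<le> C * r ^ m"
    using probab_border_tail[OF w conc p0 pmf_le_1] by blast
  have tail: "pmf (R n) m \<le> C * r ^ m" if "simply_generated_defined w n" for n m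
    using law[OF that] C(4) that simply_generated_defined_iff[OF assms(1)] by auto
  have Q_tail: "pmf Q m \<le> C * r ^ m" for m
    by (rule tendsto_upperbound[OF pmf_lim _ F_bot]) (use defined in eventually_elim, rule tail)
  \<comment> \<open>Bounded \<open>f\<close> yields convergence in distribution,
    \<open>f m = real m powr p\<close> the moments. The dominating series is the same for all
    defined sizes, so Tannery's theorem applies.\<close>
  have sums: "((\<lambda>n. \<Sum>m. pmf (R n) m * f m) \<longlongrightarrow> (\<Sum>m. pmf Q m * f m)) F"
    if f: "summable (\<lambda>m. \<bar>f m\<bar> * r ^ m)" for f :: "nat \<Rightarrow> real"
  proof -
    have "eventually (\<lambda>(m, n). norm (pmf (R n) m * f m) \<le> C * (\<bar>f m\<bar> * r ^ m)) (at_top \<times>\<^sub>F F)"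
      unfolding eventually_prod_filter
    proof (intro exI conjI allI impI)
      show "eventually (\<lambda>_. True) (at_top :: nat filter)" by simp
      show "eventually (\<lambda>n. simply_generated_defined w n) F" by (rule defined)
      fix m n assume "simply_generated_defined w n"
      from mult_right_mono[OF tail[OF this, of m], of "\<bar>f m\<bar>"]
      show "case (m, n) of (m, n) \<Rightarrow> norm (pmf (R n) m * f m) \<le> C * (\<bar>f m\<bar> * r ^ m)"
        by (simp add: abs_mult mult_ac)
    qed
    from tannerys_theorem[OF tendsto_mult[OF pmf_lim tendsto_const] this summable_mult[OF f] F_bot]
    show ?thesis by blast
  qed
  have summ: "summable (\<lambda>m. pmf P m * f m)"
    if "summable (\<lambda>m. \<bar>f m\<bar> * r ^ m)" "\<And>m. pmf P m \<le> C * r ^ m" for f :: "nat \<Rightarrow> real" and P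
  proof (rule summable_comparison_test'[OF summable_mult[OF that(1), of C]])
    fix m show "norm (pmf P m * f m) \<le> C * (\<bar>f m\<bar> * r ^ m)"
      using mult_right_mono[OF that(2)[of m], of "\<bar>f m\<bar>"] by (simp add: abs_mult mult_ac)
  qed
  have bgw: "bgw_border_law \<xi> = distr (measure_pmf Q) borel enat"
    unfolding Q_def by (rule bgw_border_law_eq[OF one])
  have meas: "f \<in> measurable borel M" if "\<And>x. f x \<in> space M" for f :: "enat \<Rightarrow> 'z" and M
    using that by (intro measurableI) (auto simp: sets_borel_enat)
  show ?thesis
    unfolding F converges_in_distribution_def
  proof (intro conjI allI impI)
    fix f :: "enat \<Rightarrow> real" assume f: "continuous_on UNIV f" "bounded (range f)"
    then have bdd: "bounded (range (\<lambda>m. f (enat m)))"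
      by (rule_tac bounded_subset[OF f(2)]) auto
    then obtain B where B: "\<And>m. \<bar>f (enat m)\<bar> \<le> B" by (auto simp: bounded_iff)
    have summable: "summable (\<lambda>m. \<bar>f (enat m)\<bar> * r ^ m)"
      by (rule summable_comparison_test'[OF summable_mult[OF summable_geometric, of r B]])
         (use C B in \<open>auto intro: mult_right_mono\<close>)
    have "(\<integral>x. f x \<partial>bgw_border_law \<xi>) = (\<Sum>m. pmf Q m * f (enat m))"
      unfolding bgw by (subst integral_distr) (auto simp: integral_nat_pmf[OF bdd] meas)
    moreover have "eventually (\<lambda>n. (\<Sum>m. pmf (R n) m * f (enat m)) = (\<integral>x. f x \<partial>measure_pmf (protection_law w n))) F"
      using defined by eventually_elim (simp add: law integral_nat_pmf[OF bdd])
    ultimately show "((\<lambda>n. \<integral>x. f x \<partial>measure_pmf (protection_law w n)) \<longlongrightarrow> (\<integral>x. f x \<partial>bgw_border_law \<xi>)) F"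
      using Lim_transform_eventually[OF sums[OF summable]] by simp
  next
    fix p :: real assume p: "1 \<le> p"
    have summable: "summable (\<lambda>m. \<bar>real m powr p\<bar> * r ^ m)"
      using summable_powr_times_geometric[OF C(2,3), of p] p by simp
    have "moment (bgw_border_law \<xi>) p = (\<integral>\<^sup>+ m. ennreal (real m powr p) \<partial>measure_pmf Q)"
      unfolding moment_def bgw by (subst nn_integral_distr) (auto simp: meas enat_powr_def)
    also have "\<dots> = ennreal (\<Sum>m. pmf Q m * real m powr p)"
      by (intro nn_integral_nat_pmf summ[OF summable] Q_tail) auto
    finally have moment: "moment (bgw_border_law \<xi>) p = ennreal (\<Sum>m. pmf Q m * real m powr p)" .
    then show "moment (bgw_border_law \<xi>) p < \<infinity>" by simp
    have "eventually (\<lambda>n. ennreal (\<Sum>m. pmf (R n) m * real m powr p) = moment (measure_pmf (protection_law w n)) p) F"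
      using defined
    proof eventually_elim
      case (elim n)
      have "moment (measure_pmf (protection_law w n)) p = (\<integral>\<^sup>+ m. ennreal (real m powr p) \<partial>measure_pmf (R n))"
        using law[OF elim] by (simp add: moment_def enat_powr_def)
      also have "\<dots> = ennreal (\<Sum>m. pmf (R n) m * real m powr p)"
        by (intro nn_integral_nat_pmf summ[OF summable] tail elim) auto
      finally show ?case ..
    qed
    with tendsto_ennrealI[OF sums[OF summable]]
    show "((\<lambda>n. moment (measure_pmf (protection_law w n)) p) \<longlongrightarrow> moment (bgw_border_law \<xi>) p) F"
      unfolding moment by (rule Lim_transform_eventually)
  qed
qed

end
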